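(* Let $N\ge2$, let $\mathcal K^*$ be an adjoint Markov generator on $L^1(\nu)$, and let $\Lambda:\hat{\mathcal P}_N(\Pi)\to\mathcal J_+^0(\Pi)$ be an $N$-particle empirical jump kernel such that $M_\Lambda:=\sup_{\mu\in\hat{\mathcal P}_N(\Pi)}\|\Lambda(\mu)\|_{\mathcal J}<\infty$ and, for each $\mu\in\hat{\mathcal P}_N(\Pi)$, $\Lambda(\mu)$ admits an adjoint kernel $\Lambda^*(\mu)$ with respect to $\nu$. Let $\{\mathcal A^*(\mu)\}_{\mu\in\hat{\mathcal P}_N(\Pi)}$ be the corresponding adjoint jump generator and $\bar{\mathcal A}^*$ the averaged adjoint mean-field generator. Consider the averaged mean-field equation $$\partial_t\bar\rho_t=\mathcal K^*\bar\rho_t+\bar{\mathcal A}^*(\bar\rho_t;\bar\rho_t),\quad t>0,\qquad \bar\rho_0\in\mathcal P(\Pi)\cap L^1(\nu).\qquad(\mathrm{AMF})$$ (i) For every $\bar\rho_0\in\mathcal P(\Pi)\cap L^1(\nu)$, the Cauchy problem (AMF) admits a unique mild solution $\{\bar\rho_t\}_{t\ge0}$. (ii) If additionally $\bar\rho_0\in D(\mathcal K^* )$, then the mild solution $\{\bar\rho_t\}_{t\ge0}$ is classical. (iii) Assume in addition that $1\in D(\mathcal K^* )$ with $\|\mathcal K^*1\|_{L^\infty(\nu)}<\infty$, and that $M_\Lambda^*:=\sup_{\mu\in\hat{\mathcal P}_N(\Pi)}\|\Lambda^*(\mu)\|_{\mathcal J}<\infty$. Then the mild solution satisfies, for all $t\ge0$,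 $$\Delta(\log\bar\rho_t)\le\Delta(\log\bar\rho_0)+2Mt,\qquad M:=\sup_{\mu\in\hat{\mathcal P}_N(\Pi)}\|\mathcal K^*(1)+\mathcal A^*(1;\mu)\|_{L^\infty(\nu)} .$$ In particular the bound holds with $M=\|\mathcal K^*(1)\|_{L^\infty(\nu)}+M_\Lambda+M_\Lambda^*$.
   Context: $\Pi$ is a Polish space with Borel $\sigma$-algebra, and $\nu$ is a finite Borel measure on $\Pi$. $\mathcal P(\Pi)$ is the set of Borel probability measures; $\rho\in L^1(\nu)$ is identified with $\rho\,d\nu$. $\|\cdot\|_{\mathrm{TV}}$ is the total variation norm $\|\mu\|_{\mathrm{TV}}=\sup_{\|\varphi\|_\infty\le1}|\int\varphi\,d\mu|$. Adjoint Markov semigroup: a positive, mass conserving ($\int S_t\rho\,d\nu=\int\rho\,d\nu$) $C_0$-semigroup on $L^1(\nu)$. An adjoint Markov generator $(\mathcal K^*,D(\mathcal K^* ))$ is the infinitesimal generator of such a semigroup, written $e^{t\mathcal K^*}$. Kernels: $\|\Lambda\|_{\mathcal J}:=\sup_{x}\|\Lambda(x,\cdot)\|_{\mathrm{TV}}$; $\mathcal J_+(\Pi)$ is the set of positive kernels with $\|\Lambda\|_{\mathcal J}<\infty$; $\mathcal J_+^0(\Pi)$ is the set of those with $\Lambda(x,\{x\})=0$ for all $x$. $\Lambda^*\in\mathcal J_+(\Pi)$ is an adjoint kernel of $\Lambda$ with respect to $\nu$ if $\Lambda(x,dy)\nu(dx)=\Lambda^*(y,dx)\nu(dy)$ as measures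 on $\Pi^2$. $\hat{\mathcal P}_N(\Pi):=\{\frac1{N-1}\sum_{k=1}^{N-1}\delta_{x_k}:x_1,\dots,x_{N-1}\in\Pi\}$ (empirical measures of $N-1$ particles). An $N$-particle empirical jump kernel is a map $\Lambda:\hat{\mathcal P}_N(\Pi)\to\mathcal J_+^0(\Pi)$, written $\Lambda(\mu)=\Lambda(x,dy;\mu)$; the measurability needed for the integrals below is implicit. For $\rho\in L^1(\nu)$, $\mathcal A^*(\rho;\mu)(x):=\int_\Pi\rho(y)\,\Lambda^*(x,dy;\mu)-\Lambda(x,\Pi;\mu)\rho(x)$. For $\boldsymbol y=(y_1,\dots,y_{N-1})$ put $\mu(\boldsymbol y)=\frac1{N-1}\sum_{k=1}^{N-1}\delta_{y_k}$. For $\rho\in\mathcal P(\Pi)$ and $\rho'\in L^1(\nu)$ the averaged adjoint generator is $$\bar{\mathcal A}^*(\rho';\rho)=\int_{\Pi^{N-1}}\mathcal A^*(\rho';\mu(\boldsymbol y))\,d\rho^{\otimes(N-1)}(\boldsymbol y),$$ which is the adjoint jump generator of the averaged kernel $\bar\Lambda(x,dy;\rho)=\int_{\Pi^{N-1}}\Lambda(x,dy;\mu(\boldsymbol y))\,d\rho^{\otimes(N-1)}(\boldsymbol y)$. Mild solution: a curve $\bar\rho\in C([0,\infty);L^1(\nu))$ of probability densities with $\bar\rho_t=e^{t\mathcal K^*}\bar\rho_0+\int_0^te^{(t-s)\mathcal K^*}[\bar{\mathcal A}^*(\bar\rho_s;\bar\rho_s)]\,ds$ for all $t\ge0$. Classical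 solution: $t\mapsto\bar\rho_t$ is continuously differentiable in $L^1(\nu)$ and satisfies the equation pointwise in time. $\Delta(f):=\operatorname{ess\,sup}_{x,y\in\Pi}|f(x)-f(y)|\in[0,\infty]$. *)

theory Defs
  imports "HOL-Probability.Probability" "HOL-Probability.Essential_Supremum"
begin

section \<open>The space $L^1(\nu)$\<close>

text \<open>
  Elements of $L^1(\nu)$ are represented by integrable functions, and equality in $L^1(\nu)$ is
  equality almost everywhere. All notions below are invariant under a change of representative.
  Limits, continuity, derivatives and integrals of $L^1(\nu)$-valued curves are those for the
  $L^1(\nu)$-norm.
\<close>

text \<open>
  The following two notions are meaningful only for integrable functions; integrability is part of
  the definitions that use them.
\<close>

definition L1_norm :: "'a measure \<Rightarrow> ('a \<Rightarrow> real) \<Rightarrow> real" where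
  "L1_norm \<nu> f = (\<integral>x. \<bar>f x\<bar> \<partial>\<nu>)"

definition L1_tendsto :: "'a measure \<Rightarrow> ('i \<Rightarrow> 'a \<Rightarrow> real) \<Rightarrow> ('a \<Rightarrow> real) \<Rightarrow> 'i filter \<Rightarrow> bool" where
  "L1_tendsto \<nu> f g F \<longleftrightarrow> ((\<lambda>i. L1_norm \<nu> (\<lambda>x. f i x - g x)) \<longlongrightarrow> 0) F"

definition L1_continuous_on :: "'a measure \<Rightarrow> real set \<Rightarrow> (real \<Rightarrow> 'a \<Rightarrow> real) \<Rightarrow> bool" where
  "L1_continuous_on \<nu> T f \<longleftrightarrow>
     (\<forall>t\<in>T. integrable \<nu> (f t) \<and> L1_tendsto \<nu> f (f t) (at t within T))"

definition has_L1_derivative ::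
    "'a measure \<Rightarrow> (real \<Rightarrow> 'a \<Rightarrow> real) \<Rightarrow> ('a \<Rightarrow> real) \<Rightarrow> real \<Rightarrow> real set \<Rightarrow> bool" where
  "has_L1_derivative \<nu> f f' t T \<longleftrightarrow>
     (\<forall>s\<in>T. integrable \<nu> (f s)) \<and> integrable \<nu> f' \<and>
     L1_tendsto \<nu> (\<lambda>s x. (f s x - f t x) / (s - t)) f' (at t within T)"

text \<open>
  The definition of \<^const>\<open>has_integral\<close> on an interval, with the limit of the
  Riemann sums taken in the $L^1(\nu)$-norm. For continuous integrands, the only ones that occur, the
  Riemann, Bochner and gauge integrals agree.
\<close>

definition has_L1_integral ::
    "'a measure \<Rightarrow> (real \<Rightarrow> 'a \<Rightarrow> real) \<Rightarrow> ('a \<Rightarrow> real) \<Rightarrow> real \<Rightarrow> real \<Rightarrow> bool" where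
  "has_L1_integral \<nu> f I a b \<longleftrightarrow>
     (\<forall>s\<in>{a..b}. integrable \<nu> (f s)) \<and> integrable \<nu> I \<and>
     L1_tendsto \<nu> (\<lambda>p x. \<Sum>(s, J)\<in>p. measure lborel J * f s x) I (division_filter {a..b})"

definition Linf_norm :: "'a measure \<Rightarrow> ('a \<Rightarrow> real) \<Rightarrow> ereal" where
  "Linf_norm \<nu> f = esssup \<nu> (\<lambda>x. ereal \<bar>f x\<bar>)"

text \<open>The set $\mathcal P(\Pi) \cap L^1(\nu)$, with $\rho$ identified with $\rho\,d\nu$.\<close>

definition prob_densities :: "'a measure \<Rightarrow> ('a \<Rightarrow> real) set" where
  "prob_densities \<nu> =
     {\<rho>. integrable \<nu> \<rho> \<and> (AE x in \<nu>. 0 \<le> \<rho> x) \<and> (\<integral>x. \<rho> x \<partial>\<nu>) = 1}"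

section \<open>Adjoint Markov semigroups and their generators\<close>

text \<open>Linearity and boundedness imply that the operator respects equality almost everywhere.\<close>

definition L1_bounded_linear :: "'a measure \<Rightarrow> (('a \<Rightarrow> real) \<Rightarrow> 'a \<Rightarrow> real) \<Rightarrow> bool" where
  "L1_bounded_linear \<nu> T \<longleftrightarrow>
     (\<forall>f. integrable \<nu> f \<longrightarrow> integrable \<nu> (T f)) \<and>
     (\<forall>f g. integrable \<nu> f \<longrightarrow> integrable \<nu> g \<longrightarrow>
        (AE x in \<nu>. T (\<lambda>x. f x + g x) x = T f x + T g x)) \<and>
     (\<forall>c f. integrable \<nu> f \<longrightarrow> (AE x in \<nu>. T (\<lambda>x. c * f x) x = c * T f x)) \<and>
     (\<exists>C. \<forall>f. integrable \<nu> f \<longrightarrow> L1_norm \<nu> (T f) \<le> C * L1_norm \<nu> f)"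

definition L1_C0_semigroup :: "'a measure \<Rightarrow> (real \<Rightarrow> ('a \<Rightarrow> real) \<Rightarrow> 'a \<Rightarrow> real) \<Rightarrow> bool" where
  "L1_C0_semigroup \<nu> S \<longleftrightarrow>
     (\<forall>t\<ge>0. L1_bounded_linear \<nu> (S t)) \<and>
     (\<forall>f. integrable \<nu> f \<longrightarrow> (AE x in \<nu>. S 0 f x = f x)) \<and>
     (\<forall>s\<ge>0. \<forall>t\<ge>0. \<forall>f. integrable \<nu> f \<longrightarrow> (AE x in \<nu>. S (s + t) f x = S s (S t f) x)) \<and>
     (\<forall>f. integrable \<nu> f \<longrightarrow> L1_tendsto \<nu> (\<lambda>t. S t f) f (at_right 0))"

definition adjoint_Markov_semigroup ::
    "'a measure \<Rightarrow> (real \<Rightarrow> ('a \<Rightarrow> real) \<Rightarrow> 'a \<Rightarrow> real) \<Rightarrow> bool" where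
  "adjoint_Markov_semigroup \<nu> S \<longleftrightarrow>
     L1_C0_semigroup \<nu> S \<and>
     (\<forall>t\<ge>0. \<forall>f. integrable \<nu> f \<longrightarrow> (AE x in \<nu>. 0 \<le> f x) \<longrightarrow> (AE x in \<nu>. 0 \<le> S t f x)) \<and>
     (\<forall>t\<ge>0. \<forall>f. integrable \<nu> f \<longrightarrow> (\<integral>x. S t f x \<partial>\<nu>) = (\<integral>x. f x \<partial>\<nu>))"

text \<open>\<open>K\<close> with domain \<open>D\<close> is the infinitesimal generator of \<open>S\<close>.\<close>

definition infinitesimal_generator ::
    "'a measure \<Rightarrow> (real \<Rightarrow> ('a \<Rightarrow> real) \<Rightarrow> 'a \<Rightarrow> real) \<Rightarrow>
     ('a \<Rightarrow> real) set \<Rightarrow> (('a \<Rightarrow> real) \<Rightarrow> 'a \<Rightarrow> real) \<Rightarrow> bool" where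
  "infinitesimal_generator \<nu> S D K \<longleftrightarrow>
     D = {f. integrable \<nu> f \<and>
             (\<exists>g. integrable \<nu> g \<and> L1_tendsto \<nu> (\<lambda>h x. (S h f x - f x) / h) g (at_right 0))} \<and>
     (\<forall>f\<in>D. integrable \<nu> (K f) \<and>
             L1_tendsto \<nu> (\<lambda>h x. (S h f x - f x) / h) (K f) (at_right 0))"

section \<open>Kernels\<close>

definition tv_norm :: "'a::topological_space measure \<Rightarrow> ereal" where
  "tv_norm \<mu> = (SUP \<phi>\<in>{\<phi> \<in> borel_measurable borel. \<forall>x. \<bar>\<phi> x\<bar> \<le> 1}. ereal \<bar>\<integral>x. \<phi> x \<partial>\<mu>\<bar>)"

definition J_norm :: "('a::topological_space \<Rightarrow> 'a measure) \<Rightarrow> ereal" where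
  "J_norm \<Lambda> = (SUP x. tv_norm (\<Lambda> x))"

definition J_plus :: "('a::topological_space \<Rightarrow> 'a measure) set" where
  "J_plus = {\<Lambda>. (\<forall>x. finite_measure (\<Lambda> x) \<and> sets (\<Lambda> x) = sets borel) \<and>
                (\<forall>B\<in>sets borel. (\<lambda>x. measure (\<Lambda> x) B) \<in> borel_measurable borel) \<and>
                J_norm \<Lambda> < \<infinity>}"

definition J_plus0 :: "('a::topological_space \<Rightarrow> 'a measure) set" where
  "J_plus0 = {\<Lambda> \<in> J_plus. \<forall>x. measure (\<Lambda> x) {x} = 0}"

text \<open>
  $\Lambda(x,dy)\nu(dx) = \Lambda^*(y,dx)\nu(dy)$ as measures on $\Pi^2$: both sides, evaluated at a
  measurable set \<open>C\<close> of pairs $(x,y)$, agree.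
\<close>

definition adjoint_kernel ::
    "'a::topological_space measure \<Rightarrow> ('a \<Rightarrow> 'a measure) \<Rightarrow> ('a \<Rightarrow> 'a measure) \<Rightarrow> bool" where
  "adjoint_kernel \<nu> \<Lambda> \<Lambda>s \<longleftrightarrow> \<Lambda>s \<in> J_plus \<and>
     (\<forall>C\<in>sets (borel \<Otimes>\<^sub>M borel).
        (\<integral>\<^sup>+x. emeasure (\<Lambda> x) {y. (x, y) \<in> C} \<partial>\<nu>) = (\<integral>\<^sup>+y. emeasure (\<Lambda>s y) {x. (x, y) \<in> C} \<partial>\<nu>))"

section \<open>Empirical jump kernels and the averaged generator\<close>

text \<open>
  The law of \<open>y k\<close> for an index \<open>k < n\<close> chosen uniformly, i.e. the empirical measure
  $\frac1n\sum_{k<n}\delta_{y_k}$. Points of $\Pi^n$ are functions on \<open>{..<n}\<close>.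
\<close>

definition empirical_measure :: "nat \<Rightarrow> (nat \<Rightarrow> 'a::topological_space) \<Rightarrow> 'a measure" where
  "empirical_measure n y = distr (uniform_count_measure {..<n}) borel y"

lemma emeasure_empirical_measure:
  fixes y :: "nat \<Rightarrow> 'a::topological_space"
  assumes "n > 0" "B \<in> sets borel"
  shows "emeasure (empirical_measure n y) B = ennreal ((\<Sum>k<n. indicator B (y k)) / real n)"
proof -
  let ?K = "{k\<in>{..<n}. y k \<in> B}"
  have "emeasure (empirical_measure n y) B = emeasure (uniform_count_measure {..<n}) ?K"
    unfolding empirical_measure_def
    by (subst emeasure_distr)
       (use assms in \<open>auto simp: space_uniform_count_measure measurable_def
          sets_uniform_count_measure intro!: arg_cong[where f = "emeasure _"]\<close>)
  also have "\<dots> = ennreal (real (card ?K) / real n)"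
    by (subst emeasure_uniform_count_measure) auto
  also have "real (card ?K) = (\<Sum>k<n. indicator B (y k))"
    by (simp add: indicator_def sum.If_cases Int_def conj_commute)
  finally show ?thesis .
qed

text \<open>The set $\hat{\mathcal P}_N(\Pi)$.\<close>

definition empirical_measures :: "nat \<Rightarrow> 'a::topological_space measure set" where
  "empirical_measures N = range (empirical_measure (N - 1))"

text \<open>
  The measurability that the averages over $\Pi^{N-1}$ presuppose: joint measurability of
  $(\boldsymbol y, x) \mapsto \Lambda(x, B; \mu(\boldsymbol y))$.
\<close>

definition jointly_measurable ::
    "nat \<Rightarrow> ('a::topological_space measure \<Rightarrow> 'a \<Rightarrow> 'a measure) \<Rightarrow> bool" where
  "jointly_measurable N \<Lambda> \<longleftrightarrow>
     (\<forall>B\<in>sets borel. (\<lambda>(y, x). measure (\<Lambda> (empirical_measure (N - 1) y) x) B)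
        \<in> borel_measurable (Pi\<^sub>M {..<N - 1} (\<lambda>_. borel) \<Otimes>\<^sub>M borel))"

definition empirical_jump_kernel ::
    "nat \<Rightarrow> ('a::topological_space measure \<Rightarrow> 'a \<Rightarrow> 'a measure) \<Rightarrow> bool" where
  "empirical_jump_kernel N \<Lambda> \<longleftrightarrow>
     (\<forall>\<mu>\<in>empirical_measures N. \<Lambda> \<mu> \<in> J_plus0) \<and> jointly_measurable N \<Lambda>"

text \<open>$\mathcal A^*(\rho;\mu)$ for the kernels $\Lambda = \Lambda(\mu)$, $\Lambda^* = \Lambda^*(\mu)$.\<close>

definition adjoint_jump_generator ::
    "('a \<Rightarrow> 'a measure) \<Rightarrow> ('a \<Rightarrow> 'a measure) \<Rightarrow> ('a \<Rightarrow> real) \<Rightarrow> 'a \<Rightarrow> real" where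
  "adjoint_jump_generator \<Lambda> \<Lambda>s \<rho> x = (\<integral>y. \<rho> y \<partial>\<Lambda>s x) - measure (\<Lambda> x) UNIV * \<rho> x"

text \<open>$\bar{\mathcal A}^*(\rho';\rho)$; the argument \<open>\<rho>\<close> is a probability measure.\<close>

definition averaged_adjoint_generator ::
    "nat \<Rightarrow> ('a::topological_space measure \<Rightarrow> 'a \<Rightarrow> 'a measure) \<Rightarrow> ('a measure \<Rightarrow> 'a \<Rightarrow> 'a measure) \<Rightarrow>
     ('a \<Rightarrow> real) \<Rightarrow> 'a measure \<Rightarrow> 'a \<Rightarrow> real" where
  "averaged_adjoint_generator N \<Lambda> \<Lambda>s \<rho>' \<rho> x =
     (\<integral>y. adjoint_jump_generator (\<Lambda> (empirical_measure (N - 1) y)) (\<Lambda>s (empirical_measure (N - 1) y)) \<rho>' x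
        \<partial>Pi\<^sub>M {..<N - 1} (\<lambda>_. \<rho>))"

text \<open>$\bar{\mathcal A}^*(\rho;\rho)$ for a probability density \<open>\<rho>\<close>.\<close>

abbreviation mean_field_term ::
    "'a::topological_space measure \<Rightarrow> nat \<Rightarrow> ('a measure \<Rightarrow> 'a \<Rightarrow> 'a measure) \<Rightarrow>
     ('a measure \<Rightarrow> 'a \<Rightarrow> 'a measure) \<Rightarrow> ('a \<Rightarrow> real) \<Rightarrow> 'a \<Rightarrow> real" where
  "mean_field_term \<nu> N \<Lambda> \<Lambda>s \<rho> \<equiv>
     averaged_adjoint_generator N \<Lambda> \<Lambda>s \<rho> (density \<nu> (\<lambda>x. ennreal (\<rho> x)))"

definition kernel_bound ::
    "nat \<Rightarrow> ('a::topological_space measure \<Rightarrow> 'a \<Rightarrow> 'a measure) \<Rightarrow> ereal" where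
  "kernel_bound N \<Lambda> = (SUP \<mu>\<in>empirical_measures N. J_norm (\<Lambda> \<mu>))"

text \<open>$\sup_\mu \|\mathcal K^*(1) + \mathcal A^*(1;\mu)\|_{L^\infty(\nu)}$\<close>

definition total_rate_bound ::
    "'a::topological_space measure \<Rightarrow> nat \<Rightarrow> (('a \<Rightarrow> real) \<Rightarrow> 'a \<Rightarrow> real) \<Rightarrow>
     ('a measure \<Rightarrow> 'a \<Rightarrow> 'a measure) \<Rightarrow> ('a measure \<Rightarrow> 'a \<Rightarrow> 'a measure) \<Rightarrow> ereal" where
  "total_rate_bound \<nu> N K \<Lambda> \<Lambda>s =
     (SUP \<mu>\<in>empirical_measures N.
        Linf_norm \<nu> (\<lambda>x. K (\<lambda>_. 1) x + adjoint_jump_generator (\<Lambda> \<mu>) (\<Lambda>s \<mu>) (\<lambda>_. 1) x))"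

section \<open>Solutions of the averaged mean-field equation\<close>

text \<open>Here \<open>S t\<close> plays the role of $e^{t\mathcal K^*}$.\<close>

definition mild_solution ::
    "'a::topological_space measure \<Rightarrow> (real \<Rightarrow> ('a \<Rightarrow> real) \<Rightarrow> 'a \<Rightarrow> real) \<Rightarrow> nat \<Rightarrow>
     ('a measure \<Rightarrow> 'a \<Rightarrow> 'a measure) \<Rightarrow> ('a measure \<Rightarrow> 'a \<Rightarrow> 'a measure) \<Rightarrow>
     ('a \<Rightarrow> real) \<Rightarrow> (real \<Rightarrow> 'a \<Rightarrow> real) \<Rightarrow> bool" where
  "mild_solution \<nu> S N \<Lambda> \<Lambda>s \<rho>0 \<rho> \<longleftrightarrow>
     L1_continuous_on \<nu> {0..} \<rho> \<and>
     (\<forall>t\<ge>0. \<rho> t \<in> prob_densities \<nu>) \<and>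
     (AE x in \<nu>. \<rho> 0 x = \<rho>0 x) \<and>
     (\<forall>t\<ge>0. \<exists>I. has_L1_integral \<nu> (\<lambda>s. S (t - s) (mean_field_term \<nu> N \<Lambda> \<Lambda>s (\<rho> s))) I 0 t \<and>
                (AE x in \<nu>. \<rho> t x = S t (\<rho> 0) x + I x))"

text \<open>At \<open>t = 0\<close> the time derivative is one-sided.\<close>

definition classical_solution ::
    "'a::topological_space measure \<Rightarrow> ('a \<Rightarrow> real) set \<Rightarrow> (('a \<Rightarrow> real) \<Rightarrow> 'a \<Rightarrow> real) \<Rightarrow> nat \<Rightarrow>
     ('a measure \<Rightarrow> 'a \<Rightarrow> 'a measure) \<Rightarrow> ('a measure \<Rightarrow> 'a \<Rightarrow> 'a measure) \<Rightarrow>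
     ('a \<Rightarrow> real) \<Rightarrow> (real \<Rightarrow> 'a \<Rightarrow> real) \<Rightarrow> bool" where
  "classical_solution \<nu> D K N \<Lambda> \<Lambda>s \<rho>0 \<rho> \<longleftrightarrow>
     (AE x in \<nu>. \<rho> 0 x = \<rho>0 x) \<and>
     (\<forall>t\<ge>0. \<rho> t \<in> prob_densities \<nu>) \<and>
     (\<exists>\<rho>'. L1_continuous_on \<nu> {0..} \<rho>' \<and>
        (\<forall>t\<ge>0. has_L1_derivative \<nu> \<rho> (\<rho>' t) t {0..} \<and>
                \<rho> t \<in> D \<and>
                (AE x in \<nu>. \<rho>' t x = K (\<rho> t) x + mean_field_term \<nu> N \<Lambda> \<Lambda>s (\<rho> t) x)))"

section \<open>Logarithmic oscillation\<close>

text \<open>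
  Densities may vanish, so the logarithm is extended by $\log 0 = -\infty$. In the extended reals of
  the library \<open>\<bar>-\<infinity> - (-\<infinity>)\<bar> = \<infinity>\<close>; this convention is immaterial for a probability density, where
  the oscillation of the logarithm is infinite anyway as soon as the density vanishes on a set of
  positive measure.
\<close>

definition elog :: "real \<Rightarrow> ereal" where
  "elog r = (if r > 0 then ereal (ln r) else -\<infinity>)"

definition ess_osc :: "'a measure \<Rightarrow> ('a \<Rightarrow> ereal) \<Rightarrow> ereal" where
  "ess_osc \<nu> f = esssup (\<nu> \<Otimes>\<^sub>M \<nu>) (\<lambda>(x, y). \<bar>f x - f y\<bar>)"

end

theory Submission
  imports Defs "HOL-Probability.Discrete_Topology"
begin

text \<open>
  Write \<open>F \<rho>\<close> for the mean-field term. With \<open>c > M\<^sub>\<Lambda>\<close> the shifted term \<open>F \<rho> + c \<rho>\<close> is nonnegative, and the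
  mild equation is equivalent to the one for the semigroup \<open>e\<^bsup>-ct\<^esup> S\<^sub>t\<close> and the shifted term: both say that
  \<open>s \<mapsto> S\<^sub>t\<^sub>-\<^sub>s \<rho>\<^sub>s\<close> has derivative \<open>S\<^sub>t\<^sub>-\<^sub>s F \<rho>\<^sub>s\<close>. The right-hand side of the shifted equation maps curves of
  probability densities to such curves and is a contraction in an exponentially weighted norm, whence (i).

  Since \<open>F\<close> is a polynomial in \<open>\<rho>\<close>, its difference quotients depend in a Lipschitz way on those of
  \<open>\<rho>\<close>. For an initial value in the domain, Gronwall's inequality then makes the right difference quotients of the
  solution Cauchy, locally uniformly in time, whence (ii).

  For (iii), let \<open>a \<le> \<rho>\<^sub>0 \<le> b\<close>. The constraint \<open>a e\<^bsup>-Mt\<^esup> \<le> \<rho>\<^sub>t \<le> b e\<^bsup>Mt\<^esup>\<close> is preserved by the contraction, so the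
  fixed point satisfies it.
\<close>

section \<open>Mild solutions for contraction semigroups\<close>

text \<open>The analysis is carried out on a closed subspace \<open>V\<close> of a Banach space with
  a cone \<open>Q\<close> and a mass functional \<open>m\<close>, because L1 of a given measure is
  not itself a type. The nonlinearity makes sense only on the set \<open>P\<close> of unit mass
  elements of the cone, and there the product densities of N - 1 particles have norm one. All
  Lipschitz constants are therefore global, and no local existence, continuation or blow-up
  alternative arises; what must be guarded is that the Picard map stays in \<open>P\<close>.
  Positivity is endangered by the loss part of the generator, mass is safe because the gain balances
  the loss. In (i) and (ii) the adjoint kernel carries no uniform bound; the adjoint relation turns
  its total action on an L1 function into that of the forward kernel, which is bounded. In (iii) the
  generator is linear once the averaging measure is frozen, so a density can be split into a
  constant plus or minus a nonnegative remainder; M controls the constant, the bound on the loss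
  controls the remainder.\<close>

lemma has_integral_in_closed_cone:
  fixes f :: "real \<Rightarrow> 'b::banach"
  assumes f: "(f has_integral I) {a..b}" and fQ: "\<And>s. s \<in> {a..b} \<Longrightarrow> f s \<in> Q"
    and Q: "closed Q" "0 \<in> Q" "\<And>x y. x \<in> Q \<Longrightarrow> y \<in> Q \<Longrightarrow> x + y \<in> Q"
      "\<And>c x. 0 \<le> c \<Longrightarrow> x \<in> Q \<Longrightarrow> c *\<^sub>R x \<in> Q"
  shows "I \<in> Q"
proof -
  let ?F = "division_filter (cbox a b)"
  have lim: "((\<lambda>p. \<Sum>(x,k)\<in>p. measure lborel k *\<^sub>R f x) \<longlongrightarrow> I) ?F"
    using f has_integral_cbox[of f I a b] by simp
  \<comment> \<open>Riemann sums are combinations of values of \<open>f\<close> with nonnegative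
    coefficients, so they stay in the cone; closedness passes to their limit. An infinite
    \<open>p\<close> gives the default sum 0, which lies in \<open>Q\<close>.\<close>
  have sumQ: "sum g p \<in> Q" if "\<And>z. z \<in> p \<Longrightarrow> g z \<in> Q" for g and p :: "(real \<times> real set) set"
    using that by (induction p rule: infinite_finite_induct) (auto intro: Q)
  have "\<forall>\<^sub>F p in ?F. (\<Sum>(x,k)\<in>p. measure lborel k *\<^sub>R f x) \<in> Q"
    using eventually_division_filter_tagged_division[of "cbox a b"]
  proof eventually_elim
    case (elim p)
    have "x \<in> {a..b}" if "(x, k) \<in> p" for x k
      using tag_in_interval[OF elim that] by simp
    then show ?case
      by (intro sumQ) (auto intro!: Q fQ)
  qed
  then show ?thesis
    by (rule Lim_in_closed_set[OF Q(1) _ division_filter_not_empty lim])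
qed

text \<open>The function \<open>\<psi>\<close> is the right-hand side damped by exp (- C * t). Its
  derivative is C * exp (- C * t) times the difference of \<open>\<phi>\<close> and its bound, hence
  nonpositive, so it stays below its initial value \<open>a\<close>.\<close>

lemma gronwall:
  fixes \<phi> :: "real \<Rightarrow> real"
  assumes cont: "continuous_on {0..\<tau>} \<phi>" and "0 \<le> C"
    and le: "\<And>t. t \<in> {0..\<tau>} \<Longrightarrow> \<phi> t \<le> a + C * integral {0..t} \<phi>"
    and t: "t \<in> {0..\<tau>}"
  shows "\<phi> t \<le> a * exp (C * t)"
proof -
  define \<psi> where "\<psi> t = exp (- C * t) * (a + C * integral {0..t} \<phi>)" for t
  have der: "(\<psi> has_real_derivative exp (- C * s) * (C * (\<phi> s - (a + C * integral {0..s} \<phi>))))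
      (at s within {0..\<tau>})" if "s \<in> {0..\<tau>}" for s
  proof -
    have "((\<lambda>t. integral {0..t} \<phi>) has_real_derivative \<phi> s) (at s within {0..\<tau>})"
      using integral_has_vector_derivative[OF cont that]
      by (simp add: has_real_derivative_iff_has_vector_derivative)
    then show ?thesis
      unfolding \<psi>_def by (auto intro!: derivative_eq_intros simp: algebra_simps)
  qed
  have "\<psi> t \<le> \<psi> 0"
  proof (rule DERIV_nonpos_imp_decreasing_open[where f = \<psi> and a = 0 and b = t])
    fix s assume s: "0 < s" "s < t"
    then have "at s within {0..\<tau>} = at s"
      using t by (intro at_within_Icc_at) auto
    moreover have "C * (\<phi> s - (a + C * integral {0..s} \<phi>)) \<le> 0"
      using le[of s] s t \<open>0 \<le> C\<close> by (intro mult_nonneg_nonpos) auto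
    moreover have "s \<in> {0..\<tau>}"
      using s t by auto
    ultimately show "\<exists>y. (\<psi> has_real_derivative y) (at s) \<and> y \<le> 0"
      using der[of s] by (intro exI[of _ "exp (- C * s) * (C * (\<phi> s - (a + C * integral {0..s} \<phi>)))"])
        (simp add: mult_nonneg_nonpos)
  next
    show "continuous_on {0..t} \<psi>"
      using t by (intro continuous_on_subset[OF DERIV_continuous_on[OF der]]) auto
  qed (use t in auto)
  then have "a + C * integral {0..t} \<phi> \<le> a * exp (C * t)"
    by (simp add: \<psi>_def exp_minus field_simps)
  then show ?thesis
    using le[OF t] by linarith
qed

text \<open>\<open>T\<close> is constrained on \<open>V\<close> only: \<open>V\<close> will be the
  isometric image of L1 in a larger space of bounded functions, to which the semigroup has no
  natural extension. Hence every law carries a membership premise.\<close>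

locale contraction_semigroup_on =
  fixes V :: "'x::banach set" and T :: "real \<Rightarrow> 'x \<Rightarrow> 'x"
  assumes V_subspace: "subspace V" and V_closed: "closed V"
    and T_mem: "0 \<le> t \<Longrightarrow> v \<in> V \<Longrightarrow> T t v \<in> V"
    and T_add: "0 \<le> t \<Longrightarrow> v \<in> V \<Longrightarrow> w \<in> V \<Longrightarrow> T t (v + w) = T t v + T t w"
    and T_scale: "0 \<le> t \<Longrightarrow> v \<in> V \<Longrightarrow> T t (r *\<^sub>R v) = r *\<^sub>R T t v"
    and T_norm: "0 \<le> t \<Longrightarrow> v \<in> V \<Longrightarrow> norm (T t v) \<le> norm v"
    and T_0: "v \<in> V \<Longrightarrow> T 0 v = v"
    and T_semigroup: "0 \<le> s \<Longrightarrow> 0 \<le> t \<Longrightarrow> v \<in> V \<Longrightarrow> T s (T t v) = T (s + t) v"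
    and T_cont0: "v \<in> V \<Longrightarrow> ((\<lambda>h. T h v) \<longlongrightarrow> v) (at_right 0)"
begin

lemma V_0 [simp]: "0 \<in> V"
  and V_add: "v \<in> V \<Longrightarrow> w \<in> V \<Longrightarrow> v + w \<in> V"
  and V_diff: "v \<in> V \<Longrightarrow> w \<in> V \<Longrightarrow> v - w \<in> V"
  and V_scale: "v \<in> V \<Longrightarrow> r *\<^sub>R v \<in> V"
  using V_subspace by (auto simp: subspace_0 subspace_add subspace_diff subspace_scale)

lemma T_diff: "0 \<le> t \<Longrightarrow> v \<in> V \<Longrightarrow> w \<in> V \<Longrightarrow> T t (v - w) = T t v - T t w"
  using T_add[of t v "(-1) *\<^sub>R w"] T_scale[of t w "-1"] V_scale[of w "-1"] by simp

lemma T_zero: "0 \<le> t \<Longrightarrow> T t 0 = 0"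
  using T_scale[of t 0 0] by simp

lemma T_sum: "0 \<le> t \<Longrightarrow> (\<And>i. i \<in> A \<Longrightarrow> g i \<in> V) \<Longrightarrow> T t (\<Sum>i\<in>A. g i) = (\<Sum>i\<in>A. T t (g i))"
  by (induction A rule: infinite_finite_induct)
     (simp_all add: T_zero T_add subspace_sum[OF V_subspace])

text \<open>Factoring out \<open>T\<close> at the earlier time, which is a contraction, leaves only
  the increment from time 0. Right continuity at 0 thus yields two-sided continuity of
  orbits.\<close>

lemma T_orbit_modulus:
  assumes "0 \<le> s" "0 \<le> t" "v \<in> V"
  shows "norm (T t v - T s v) \<le> norm (T \<bar>t - s\<bar> v - v)"
proof -
  have *: "norm (T t v - T s v) \<le> norm (T (t - s) v - v)" if "0 \<le> s" "s \<le> t" for s t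
  proof -
    have "T t v - T s v = T s (T (t - s) v - v)"
      using that assms(3) by (simp add: T_diff T_mem T_semigroup)
    then show ?thesis
      using that assms(3) by (simp add: T_norm T_mem V_diff)
  qed
  show ?thesis
    using *[of s t] *[of t s] assms by (cases "s \<le> t") (auto simp: norm_minus_commute)
qed

text \<open>Joint continuity of T t v in both arguments: the change of the vector is absorbed by
  contractivity, uniformly in time, and the change of the time by \<open>T_orbit_modulus\<close> at
  the fixed vector \<open>f z\<close>.\<close>

lemma continuous_on_T_comp:
  fixes f :: "'c::topological_space \<Rightarrow> 'x"
  assumes f: "continuous_on A f" "\<And>z. z \<in> A \<Longrightarrow> f z \<in> V"
    and r: "continuous_on A r" "\<And>z. z \<in> A \<Longrightarrow> 0 \<le> r z"
  shows "continuous_on A (\<lambda>z. T (r z) (f z))"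
  unfolding continuous_on_def
proof
  fix z assume z: "z \<in> A"
  have ev: "\<forall>\<^sub>F y in at z within A. y \<in> A"
    by (simp add: eventually_at_filter)
  have lim0: "((\<lambda>h. norm (T h (f z) - f z)) \<longlongrightarrow> 0) (at_right 0)"
    using T_cont0[OF f(2)[OF z]] by (simp add: tendsto_norm_zero_iff LIM_zero_iff)
  \<comment> \<open>The time differences \<bar>r y - r z\<bar> may be zero, so the limit along
    \<open>at_right 0\<close> is completed by the value at 0 before composing.\<close>
  have cont0: "continuous (at 0 within {0..}) (\<lambda>h. norm (T h (f z) - f z))"
  proof -
    have "at (0::real) within {0..} = at_right 0"
      by (rule at_within_nhd[where S = UNIV]) auto
    with lim0 show ?thesis
      by (simp add: continuous_within T_0 f(2) z)
  qed
  have "((\<lambda>y. \<bar>r y - r z\<bar>) \<longlongrightarrow> 0) (at z within A)"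
    using r(1) z by (simp add: continuous_on_def tendsto_rabs_zero LIM_zero_iff)
  moreover have "\<forall>\<^sub>F y in at z within A. \<bar>r y - r z\<bar> \<in> {0..}"
    by simp
  ultimately have "((\<lambda>y. norm (T \<bar>r y - r z\<bar> (f z) - f z)) \<longlongrightarrow> norm (T 0 (f z) - f z)) (at z within A)"
    by (intro continuous_within_tendsto_compose[OF cont0])
  moreover have "((\<lambda>y. norm (f y - f z)) \<longlongrightarrow> 0) (at z within A)"
    using f(1) z by (simp add: continuous_on_def tendsto_norm_zero LIM_zero_iff)
  ultimately have lim: "((\<lambda>y. norm (f y - f z) + norm (T \<bar>r y - r z\<bar> (f z) - f z)) \<longlongrightarrow> 0) (at z within A)"
    using tendsto_add by (fastforce simp: T_0 f(2) z)
  have "\<forall>\<^sub>F y in at z within A. norm (T (r y) (f y) - T (r z) (f z))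
      \<le> norm (f y - f z) + norm (T \<bar>r y - r z\<bar> (f z) - f z)"
    using ev
  proof eventually_elim
    case (elim y)
    have "T (r y) (f y) - T (r z) (f z) = T (r y) (f y - f z) + (T (r y) (f z) - T (r z) (f z))"
      using elim z by (simp add: T_diff f r)
    also have "norm \<dots> \<le> norm (T (r y) (f y - f z)) + norm (T (r y) (f z) - T (r z) (f z))"
      by (rule norm_triangle_ineq)
    also have "\<dots> \<le> norm (f y - f z) + norm (T \<bar>r y - r z\<bar> (f z) - f z)"
      using elim z by (intro add_mono T_norm T_orbit_modulus) (auto simp: f r V_diff)
    finally show ?case .
  qed
  then have "((\<lambda>y. T (r y) (f y) - T (r z) (f z)) \<longlongrightarrow> 0) (at z within A)"
    by (rule Lim_null_comparison[OF _ lim])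
  then show "((\<lambda>y. T (r y) (f y)) \<longlongrightarrow> T (r z) (f z)) (at z within A)"
    by (simp add: LIM_zero_iff)
qed

lemma has_integral_in_V:
  fixes a b :: real
  assumes "(f has_integral I) {a..b}" "\<And>s. s \<in> {a..b} \<Longrightarrow> f s \<in> V"
  shows "I \<in> V"
  by (rule has_integral_in_closed_cone[OF assms]) (auto simp: V_closed V_add V_scale)

text \<open>\<open>T t\<close> is linear and bounded on \<open>V\<close> only, not on the whole
  type, so it is pushed through the Riemann sums by hand; contractivity keeps their error from
  growing.\<close>

lemma has_integral_T:
  fixes a b :: real
  assumes f: "(f has_integral I) {a..b}" "\<And>s. s \<in> {a..b} \<Longrightarrow> f s \<in> V" and t: "0 \<le> t"
  shows "((\<lambda>s. T t (f s)) has_integral T t I) {a..b}"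
proof -
  let ?F = "division_filter (cbox a b)"
  let ?R = "\<lambda>f p. \<Sum>(x,k)\<in>p. measure lborel k *\<^sub>R f x"
  have I: "I \<in> V"
    by (rule has_integral_in_V[OF f])
  have lim: "((\<lambda>p. norm (?R f p - I)) \<longlongrightarrow> 0) ?F"
    using f(1) has_integral_cbox[of f I a b] by (simp add: LIM_zero_iff tendsto_norm_zero)
  have "\<forall>\<^sub>F p in ?F. norm (?R (\<lambda>s. T t (f s)) p - T t I) \<le> norm (?R f p - I)"
    using eventually_division_filter_tagged_division[of "cbox a b"]
  proof eventually_elim
    case (elim p)
    have fV: "f x \<in> V" if "(x, k) \<in> p" for x k
      using tag_in_interval[OF elim that] f(2) by simp
    have RV: "?R f p \<in> V"
      by (rule subspace_sum[OF V_subspace]) (auto intro: V_scale fV)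
    have "?R (\<lambda>s. T t (f s)) p = T t (?R f p)"
      using t by (subst T_sum) (auto intro!: sum.cong simp: T_scale V_scale fV)
    then have "?R (\<lambda>s. T t (f s)) p - T t I = T t (?R f p - I)"
      using T_diff[OF t RV I] by simp
    then show ?case
      using T_norm[OF t V_diff[OF RV I]] by simp
  qed
  then have "((\<lambda>p. ?R (\<lambda>s. T t (f s)) p - T t I) \<longlongrightarrow> 0) ?F"
    by (rule Lim_null_comparison[OF _ lim])
  then show ?thesis
    using has_integral_cbox[of "\<lambda>s. T t (f s)" "T t I" a b] by (simp add: LIM_zero_iff)
qed

text \<open>The equation \<open>u t = e\<^bsup>-ct\<^esup> T\<^sub>t x + \<integral>\<^sub>0\<^sup>t e\<^bsup>-c(t-s)\<^esup> T\<^sub>t\<^sub>-\<^sub>s (g s) ds\<close>, multiplied by \<open>e\<^bsup>ct\<^esup>\<close>.\<close>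

definition mild :: "real \<Rightarrow> (real \<Rightarrow> 'x) \<Rightarrow> 'x \<Rightarrow> (real \<Rightarrow> 'x) \<Rightarrow> bool" where
  "mild c g x u \<longleftrightarrow>
     (\<forall>t\<ge>0. ((\<lambda>s. exp (c * s) *\<^sub>R T (t - s) (g s)) has_integral (exp (c * t) *\<^sub>R u t - T t x)) {0..t})"

lemma continuous_on_duhamel:
  assumes "continuous_on A g" "\<And>s. s \<in> A \<Longrightarrow> g s \<in> V" "A \<subseteq> {..t}"
  shows "continuous_on A (\<lambda>s. exp (c * s) *\<^sub>R T (t - s) (g s))"
  using assms by (intro continuous_intros continuous_on_T_comp) auto

lemma mild_mem:
  assumes "mild c g x u" "\<And>s. 0 \<le> s \<Longrightarrow> g s \<in> V" "x \<in> V" "0 \<le> t"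
  shows "u t \<in> V"
proof -
  have "((\<lambda>s. exp (c * s) *\<^sub>R T (t - s) (g s)) has_integral (exp (c * t) *\<^sub>R u t - T t x)) {0..t}"
    using assms(1,4) unfolding mild_def by blast
  then have "exp (c * t) *\<^sub>R u t - T t x \<in> V"
    by (rule has_integral_in_V) (simp add: V_scale T_mem assms(2))
  then have "exp (c * t) *\<^sub>R u t \<in> V"
    using V_add[OF _ T_mem[OF \<open>0 \<le> t\<close> \<open>x \<in> V\<close>], of "exp (c * t) *\<^sub>R u t - T t x"] by simp
  then show ?thesis
    using V_scale[of "exp (c * t) *\<^sub>R u t" "exp (- c * t)"] by (simp add: exp_minus)
qed

lemma mild_at_0:
  assumes "mild c g x u" "x \<in> V"
  shows "u 0 = x"
proof -
  have "((\<lambda>s. exp (c * s) *\<^sub>R T (0 - s) (g s)) has_integral (exp (c * 0) *\<^sub>R u 0 - T 0 x)) {0..0}"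
    using assms(1) unfolding mild_def by blast
  then have "exp (c * 0) *\<^sub>R u 0 - T 0 x = 0"
    by (simp add: has_integral_null_eq[of 0 0, simplified])
  then show ?thesis
    by (simp add: T_0 assms)
qed

text \<open>Applying T (t - r) to the equation at time r turns T (r - s) into T (t - s). The
  integrand no longer depends on r, and the fundamental theorem of calculus applies. In this
  derivative form the equation can be shifted and restarted.\<close>

lemma mild_has_vector_derivative:
  assumes u: "mild c g x u" and g: "continuous_on {0..} g" "\<And>s. 0 \<le> s \<Longrightarrow> g s \<in> V" and x: "x \<in> V"
    and s: "0 \<le> s" "s \<le> t"
  shows "((\<lambda>s. exp (c * s) *\<^sub>R T (t - s) (u s)) has_vector_derivative exp (c * s) *\<^sub>R T (t - s) (g s))
     (at s within {0..t})"
proof -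
  let ?k = "\<lambda>s. exp (c * s) *\<^sub>R T (t - s) (g s)"
  have uV: "u r \<in> V" if "0 \<le> r" for r
    using mild_mem[OF u g(2) x] that by simp
  have eq: "exp (c * r) *\<^sub>R T (t - r) (u r) = T t x + integral {0..r} ?k" if r: "r \<in> {0..t}" for r
  proof -
    have "((\<lambda>s. exp (c * s) *\<^sub>R T (r - s) (g s)) has_integral (exp (c * r) *\<^sub>R u r - T r x)) {0..r}"
      using u r by (simp add: mild_def)
    then have h: "((\<lambda>s. T (t - r) (exp (c * s) *\<^sub>R T (r - s) (g s))) has_integral
        T (t - r) (exp (c * r) *\<^sub>R u r - T r x)) {0..r}"
      by (rule has_integral_T) (use r in \<open>auto intro!: V_scale T_mem g\<close>)
    have "T (t - r) (exp (c * r) *\<^sub>R u r - T r x) = exp (c * r) *\<^sub>R T (t - r) (u r) - T t x"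
      using r x by (simp add: T_diff V_scale T_scale uV T_mem T_semigroup)
    with h have "(?k has_integral (exp (c * r) *\<^sub>R T (t - r) (u r) - T t x)) {0..r}"
      using r by (intro has_integral_eq[OF _ h[unfolded \<open>T (t - r) (exp (c * r) *\<^sub>R u r - T r x) = _\<close>]])
        (simp add: T_scale T_mem T_semigroup g)
    then show ?thesis
      by (simp add: integral_unique)
  qed
  have "continuous_on {0..t} ?k"
    by (rule continuous_on_duhamel) (auto intro: continuous_on_subset[OF g(1)] g(2))
  then have "((\<lambda>r. integral {0..r} ?k) has_vector_derivative ?k s) (at s within {0..t})"
    using s by (intro integral_has_vector_derivative) auto
  then have "((\<lambda>r. T t x + integral {0..r} ?k) has_vector_derivative ?k s) (at s within {0..t})"
    by (auto intro!: derivative_eq_intros)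
  then show ?thesis
    by (rule has_vector_derivative_transform[rotated 2]) (use s in \<open>auto simp: eq\<close>)
qed

lemma mildI:
  assumes u: "u 0 = x" "\<And>s. 0 \<le> s \<Longrightarrow> u s \<in> V"
    and der: "\<And>s t. 0 \<le> s \<Longrightarrow> s \<le> t \<Longrightarrow>
      ((\<lambda>s. exp (c * s) *\<^sub>R T (t - s) (u s)) has_vector_derivative exp (c * s) *\<^sub>R T (t - s) (g s))
      (at s within {0..t})"
  shows "mild c g x u"
  unfolding mild_def
proof safe
  fix t :: real assume "0 \<le> t"
  then show "((\<lambda>s. exp (c * s) *\<^sub>R T (t - s) (g s)) has_integral (exp (c * t) *\<^sub>R u t - T t x)) {0..t}"
    using fundamental_theorem_of_calculus[of 0 t "\<lambda>s. exp (c * s) *\<^sub>R T (t - s) (u s)", OF _ der]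
    by (simp add: u T_0)
qed

text \<open>The product rule with the factor exp (b * s) adds b times the curve to the source. With
  b = - c and b = c it removes and inserts the shift.\<close>

lemma mild_shift:
  assumes u: "mild c g x u" and g: "continuous_on {0..} g" "\<And>s. 0 \<le> s \<Longrightarrow> g s \<in> V" and x: "x \<in> V"
  shows "mild (c + b) (\<lambda>s. g s + b *\<^sub>R u s) x u"
proof (rule mildI)
  show "u 0 = x"
    by (rule mild_at_0[OF u x])
  show uV: "u s \<in> V" if "0 \<le> s" for s
    using mild_mem[OF u g(2) x] that by simp
  fix s t :: real assume s: "0 \<le> s" "s \<le> t"
  have "((\<lambda>s. exp (b * s) *\<^sub>R (exp (c * s) *\<^sub>R T (t - s) (u s))) has_vector_derivative
      (exp (b * s) *\<^sub>R exp (c * s) *\<^sub>R T (t - s) (g s) + (exp (b * s) * b) *\<^sub>R exp (c * s) *\<^sub>R T (t - s) (u s)))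
      (at s within {0..t})"
    by (rule has_vector_derivative_scaleR[OF _ mild_has_vector_derivative[OF u g x s]])
      (auto intro!: derivative_eq_intros)
  also have "(\<lambda>s. exp (b * s) *\<^sub>R (exp (c * s) *\<^sub>R T (t - s) (u s)))
      = (\<lambda>s. exp ((c + b) * s) *\<^sub>R T (t - s) (u s))"
    by (auto simp: exp_add[symmetric] algebra_simps)
  also have "exp (b * s) *\<^sub>R exp (c * s) *\<^sub>R T (t - s) (g s) + (exp (b * s) * b) *\<^sub>R exp (c * s) *\<^sub>R T (t - s) (u s)
      = exp ((c + b) * s) *\<^sub>R T (t - s) (g s + b *\<^sub>R u s)"
    using s by (simp add: T_add V_scale T_scale uV g exp_add algebra_simps)
  finally show "((\<lambda>s. exp ((c + b) * s) *\<^sub>R T (t - s) (u s)) has_vector_derivative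
      exp ((c + b) * s) *\<^sub>R T (t - s) (g s + b *\<^sub>R u s)) (at s within {0..t})" .
qed

end

section \<open>Positivity, mass and the Picard fixed point\<close>

lemma bounded_linear_apply_bcontfun: "bounded_linear (\<lambda>w::'a::topological_space \<Rightarrow>\<^sub>C 'b::real_normed_vector. apply_bcontfun w z)"
  by (rule bounded_linear_intro[where K = 1]) (auto simp: norm_bounded)

text \<open>L1 as an ordered space: \<open>Q\<close> is the cone of nonnegative functions and
  \<open>m\<close> the integral. That norm and mass agree on \<open>Q\<close> puts every unit mass
  element of the cone on the unit sphere, so curves in \<open>P\<close> are bounded without any
  estimate.\<close>

locale markov_semigroup_on = contraction_semigroup_on V T for V :: "'x::banach set" and T +
  fixes Q :: "'x set" and m :: "'x \<Rightarrow> real"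
  assumes Q_sub: "Q \<subseteq> V" and Q_closed: "closed Q" and Q_0: "0 \<in> Q"
    and Q_add: "v \<in> Q \<Longrightarrow> w \<in> Q \<Longrightarrow> v + w \<in> Q"
    and Q_scale: "0 \<le> r \<Longrightarrow> v \<in> Q \<Longrightarrow> r *\<^sub>R v \<in> Q"
    and T_Q: "0 \<le> t \<Longrightarrow> v \<in> Q \<Longrightarrow> T t v \<in> Q"
    and m_linear: "bounded_linear m"
    and T_m: "0 \<le> t \<Longrightarrow> v \<in> V \<Longrightarrow> m (T t v) = m v"
    and norm_Q: "v \<in> Q \<Longrightarrow> norm v = m v"
begin

definition P :: "'x set" where "P = {v \<in> Q. m v = 1}"

lemma P_V: "u \<in> P \<Longrightarrow> u \<in> V" and P_Q: "u \<in> P \<Longrightarrow> u \<in> Q" and P_m: "u \<in> P \<Longrightarrow> m u = 1"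
  and P_norm: "u \<in> P \<Longrightarrow> norm u = 1"
  using Q_sub by (auto simp: P_def norm_Q)

lemma closed_P: "closed P"
proof -
  have "P = Q \<inter> m -` {1}"
    by (auto simp: P_def)
  moreover have "closed (m -` {1})"
    by (intro continuous_closed_vimage linear_continuous_at m_linear) auto
  ultimately show ?thesis
    by (simp add: Q_closed closed_Int)
qed

lemma has_integral_in_Q:
  fixes a b :: real
  assumes "(f has_integral I) {a..b}" "\<And>s. s \<in> {a..b} \<Longrightarrow> f s \<in> Q"
  shows "I \<in> Q"
  by (rule has_integral_in_closed_cone[OF assms]) (auto simp: Q_closed Q_add Q_scale Q_0)

end

text \<open>\<open>F_quotients\<close> is a derivative-free form of \<open>F\<close> being differentiable with Lipschitz derivative; for
  \<open>v' = u\<close> it is a Lipschitz bound. Lipschitz continuity alone would not yield classical solutions, since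
  difference quotients bounded in L1 need not converge.\<close>

locale mean_field_semigroup = markov_semigroup_on V T Q m
  for V :: "'x::banach set" and T Q m +
  fixes F :: "'x \<Rightarrow> 'x" and c L :: real
  assumes c_pos: "0 < c" and L_nonneg: "0 \<le> L"
    and F_mem: "u \<in> P \<Longrightarrow> F u \<in> V"
    and F_Q: "u \<in> P \<Longrightarrow> F u + c *\<^sub>R u \<in> Q"
    and F_m: "u \<in> P \<Longrightarrow> m (F u) = 0"
    and F_quotients: "u \<in> P \<Longrightarrow> v \<in> P \<Longrightarrow> v' \<in> P \<Longrightarrow> 0 < h \<Longrightarrow> 0 < k \<Longrightarrow>
      norm ((F v - F u) /\<^sub>R h - (F v' - F u) /\<^sub>R k) \<le>
        L * norm ((v - u) /\<^sub>R h - (v' - u) /\<^sub>R k) + L * norm (v - v') * norm ((v' - u) /\<^sub>R k)"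
begin

lemma F_lipschitz: "u \<in> P \<Longrightarrow> v \<in> P \<Longrightarrow> norm (F v - F u) \<le> L * norm (v - u)"
  using F_quotients[of u v u 1 1] by simp

lemma continuous_on_F: "continuous_on P F"
proof -
  have "L-lipschitz_on P F"
    using F_lipschitz by (intro lipschitz_onI) (auto simp: dist_norm L_nonneg)
  then show ?thesis
    by (rule lipschitz_on_continuous_on)
qed

lemma continuous_on_F_comp:
  "continuous_on A u \<Longrightarrow> (\<And>t. t \<in> A \<Longrightarrow> u t \<in> P) \<Longrightarrow> continuous_on A (\<lambda>t. F (u t))"
  by (rule continuous_on_compose2[OF continuous_on_F]) auto

text \<open>The shifted Duhamel formula solved for its left-hand side. Keeping exp (c * s) inside
  the integral and dividing once outside makes fixed points literally solutions in the sense of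
  \<open>mild\<close>.\<close>

definition picard :: "'x \<Rightarrow> (real \<Rightarrow> 'x) \<Rightarrow> real \<Rightarrow> 'x" where
  "picard x u t = exp (- c * t) *\<^sub>R
     (T t x + integral {0..t} (\<lambda>s. exp (c * s) *\<^sub>R T (t - s) (F (u s) + c *\<^sub>R u s)))"

lemma picard_has_integral:
  assumes u: "continuous_on {0..} u" "\<And>t. 0 \<le> t \<Longrightarrow> u t \<in> P" and t: "0 \<le> t"
  shows "((\<lambda>s. exp (c * s) *\<^sub>R T (t - s) (F (u s) + c *\<^sub>R u s)) has_integral
     (exp (c * t) *\<^sub>R picard x u t - T t x)) {0..t}"
proof -
  have "continuous_on {0..t} (\<lambda>s. exp (c * s) *\<^sub>R T (t - s) (F (u s) + c *\<^sub>R u s))"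
    by (intro continuous_on_duhamel continuous_intros continuous_on_F_comp continuous_on_subset[OF u(1)])
       (auto simp: u V_add V_scale P_V F_mem)
  then have "((\<lambda>s. exp (c * s) *\<^sub>R T (t - s) (F (u s) + c *\<^sub>R u s)) has_integral
      integral {0..t} (\<lambda>s. exp (c * s) *\<^sub>R T (t - s) (F (u s) + c *\<^sub>R u s))) {0..t}"
    by (intro integrable_integral integrable_continuous_real)
  then show ?thesis
    by (simp add: picard_def exp_minus)
qed

lemma picard_fixpoint_iff_mild:
  assumes u: "continuous_on {0..} u" "\<And>t. 0 \<le> t \<Longrightarrow> u t \<in> P"
  shows "(\<forall>t\<ge>0. picard x u t = u t) \<longleftrightarrow> mild c (\<lambda>s. F (u s) + c *\<^sub>R u s) x u"
proof -
  have "picard x u t = u t" if "mild c (\<lambda>s. F (u s) + c *\<^sub>R u s) x u" "0 \<le> t" for t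
  proof -
    have "exp (c * t) *\<^sub>R u t - T t x = exp (c * t) *\<^sub>R picard x u t - T t x"
      using that has_integral_unique[OF _ picard_has_integral[OF u]] unfolding mild_def by blast
    then show ?thesis by simp
  qed
  moreover have "mild c (\<lambda>s. F (u s) + c *\<^sub>R u s) x u" if "\<forall>t\<ge>0. picard x u t = u t"
    unfolding mild_def
  proof safe
    fix t :: real assume "0 \<le> t"
    then show "((\<lambda>s. exp (c * s) *\<^sub>R T (t - s) (F (u s) + c *\<^sub>R u s)) has_integral
      exp (c * t) *\<^sub>R u t - T t x) {0..t}"
      using picard_has_integral[OF u, of t x] that by simp
  qed
  ultimately show ?thesis by blast
qed

lemma mild_absorb_iff:
  assumes u: "continuous_on {0..} u" "\<And>t. 0 \<le> t \<Longrightarrow> u t \<in> P" and x: "x \<in> V"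
  shows "mild c (\<lambda>s. F (u s) + c *\<^sub>R u s) x u \<longleftrightarrow> mild 0 (\<lambda>s. F (u s)) x u"
proof
  assume "mild c (\<lambda>s. F (u s) + c *\<^sub>R u s) x u"
  then have "mild (c + (- c)) (\<lambda>s. F (u s) + c *\<^sub>R u s + (- c) *\<^sub>R u s) x u"
    by (rule mild_shift)
      (auto intro!: continuous_intros continuous_on_F_comp simp: u V_add V_scale P_V F_mem x)
  then show "mild 0 (\<lambda>s. F (u s)) x u"
    by simp
next
  assume "mild 0 (\<lambda>s. F (u s)) x u"
  then have "mild (0 + c) (\<lambda>s. F (u s) + c *\<^sub>R u s) x u"
    by (rule mild_shift) (auto intro!: continuous_on_F_comp simp: u F_mem x)
  then show "mild c (\<lambda>s. F (u s) + c *\<^sub>R u s) x u"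
    by simp
qed

text \<open>Both the integration domain and the integrand depend on t. The substitution s = t * r
  fixes the domain to the unit interval, where the integral depends continuously on the
  parameter.\<close>

lemma continuous_on_picard:
  assumes u: "continuous_on {0..} u" "\<And>t. 0 \<le> t \<Longrightarrow> u t \<in> P" and x: "x \<in> V"
  shows "continuous_on {0..} (picard x u)"
proof -
  let ?k = "\<lambda>s. F (u s) + c *\<^sub>R u s"
  let ?f = "\<lambda>t s. exp (c * s) *\<^sub>R T (t - s) (?k s)"
  have k: "continuous_on {0..} ?k" "\<And>s. 0 \<le> s \<Longrightarrow> ?k s \<in> V"
    by (auto intro!: continuous_intros continuous_on_F_comp simp: u V_add V_scale P_V F_mem)
  have "continuous_on ({0..} \<times> cbox 0 1) (\<lambda>(t, r). ?f t (t * r))"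
    unfolding case_prod_beta
    by (intro continuous_intros continuous_on_T_comp continuous_on_compose2[OF k(1)])
      (auto simp: k mult_left_le)
  then have "continuous_on {0..} (\<lambda>t. integral (cbox 0 1) (\<lambda>r. ?f t (t * r)))"
    by (rule integral_continuous_on_param)
  then have cont: "continuous_on {0..} (\<lambda>t. t *\<^sub>R integral {0..1} (\<lambda>r. ?f t (t * r)))"
    by (intro continuous_intros) auto
  have "t *\<^sub>R integral {0..1} (\<lambda>r. ?f t (t * r)) = integral {0..t} (?f t)" if "t \<in> {0..}" for t
  proof (cases "t = 0")
    case False
    have "(?f t has_integral integral {0..t} (?f t)) (cbox 0 t)"
      using picard_has_integral[OF u, of t x] that
      by (simp add: has_integral_iff)
    from has_integral_affinity'[OF this, of t 0] have
      "((\<lambda>r. ?f t (t * r)) has_integral (integral {0..t} (?f t) /\<^sub>R t)) {0..1}"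
      using False that by simp
    then show ?thesis
      using False by (simp add: integral_unique)
  qed simp
  with cont have "continuous_on {0..} (\<lambda>t. integral {0..t} (?f t))"
    by (rule continuous_on_eq)
  then show ?thesis
    unfolding picard_def
    by (intro continuous_intros continuous_on_T_comp) (auto simp: x)
qed

text \<open>Positivity: the integrand lies in the cone, and so does its integral. Mass:
  \<open>F\<close> has mass zero and \<open>T\<close> preserves mass, so the integrand has mass c *
  exp (c * s), which integrates to exp (c * t) - 1; adding the mass 1 of T t x and dividing by exp
  (c * t) gives 1.\<close>

lemma picard_in_P:
  assumes u: "continuous_on {0..} u" "\<And>t. 0 \<le> t \<Longrightarrow> u t \<in> P" and x: "x \<in> P" and t: "0 \<le> t"
  shows "picard x u t \<in> P"
proof -
  let ?f = "\<lambda>s. exp (c * s) *\<^sub>R T (t - s) (F (u s) + c *\<^sub>R u s)"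
  let ?I = "exp (c * t) *\<^sub>R picard x u t - T t x"
  have I: "(?f has_integral ?I) {0..t}"
    by (rule picard_has_integral[OF u t])
  interpret m: bounded_linear m by (rule m_linear)
  have "?I \<in> Q"
    by (rule has_integral_in_Q[OF I]) (auto intro!: Q_scale T_Q F_Q u)
  then have "exp (- c * t) *\<^sub>R (?I + T t x) \<in> Q"
    using x t by (intro Q_scale Q_add T_Q) (auto simp: P_Q)
  then have Q: "picard x u t \<in> Q"
    by (simp add: exp_minus)
  have "((\<lambda>s. m (?f s)) has_integral m ?I) {0..t}"
    using has_integral_linear[OF I m_linear] by (simp add: o_def)
  moreover have "m (?f s) = c * exp (c * s)" if "s \<in> {0..t}" for s
    using that by (simp add: m.scaleR T_m V_add V_scale P_V F_mem u m.add F_m P_m)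
  ultimately have i1: "((\<lambda>s. c * exp (c * s)) has_integral m ?I) {0..t}"
    by (rule has_integral_eq[rotated])
  have i2: "((\<lambda>s. c * exp (c * s)) has_integral (exp (c * t) - exp (c * 0))) {0..t}"
    by (rule fundamental_theorem_of_calculus)
      (auto intro!: derivative_eq_intros simp: t has_real_derivative_iff_has_vector_derivative[symmetric])
  have "m ?I = exp (c * t) - 1"
    using has_integral_unique[OF i1 i2] by simp
  then have "m (picard x u t) = 1"
    using x t by (simp add: m.diff m.scaleR T_m P_V P_m)
  then show ?thesis
    using Q by (simp add: P_def)
qed

text \<open>The shifted nonlinearity has Lipschitz constant L + c. The rate 2 * L + c is chosen so
  that exp (c * s) times the weight is exp (2 * (L + c) * s); integration then supplies 1 / (2 * (L
  + c)), and the contraction constant is 1/2.\<close>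

lemma picard_diff_le:
  assumes u: "continuous_on {0..} u" "\<And>t. 0 \<le> t \<Longrightarrow> u t \<in> P"
    and v: "continuous_on {0..} v" "\<And>t. 0 \<le> t \<Longrightarrow> v t \<in> P"
    and x: "x \<in> V" and t: "0 \<le> t" and d: "\<And>s. 0 \<le> s \<Longrightarrow> norm (u s - v s) \<le> exp ((2 * L + c) * s) * d"
  shows "norm (picard x u t - picard x v t) \<le> exp ((2 * L + c) * t) * (d / 2)"
proof -
  let ?f = "\<lambda>u s. exp (c * s) *\<^sub>R T (t - s) (F (u s) + c *\<^sub>R u s)"
  let ?b = "2 * (L + c)"
  have d0: "0 \<le> d"
    using order_trans[OF norm_ge_zero d[of 0]] by simp
  have "((\<lambda>s. ?f u s - ?f v s) has_integral
      (exp (c * t) *\<^sub>R picard x u t - T t x - (exp (c * t) *\<^sub>R picard x v t - T t x))) {0..t}"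
    by (intro has_integral_diff picard_has_integral u v t)
  then have int: "((\<lambda>s. ?f u s - ?f v s) has_integral (exp (c * t) *\<^sub>R (picard x u t - picard x v t))) {0..t}"
    by (simp add: scaleR_diff_right)
  have "((\<lambda>s. (L + c) * d * exp (?b * s)) has_integral (d / 2 * exp (?b * t) - d / 2 * exp (?b * 0))) {0..t}"
    using c_pos L_nonneg
    by (intro fundamental_theorem_of_calculus)
      (auto intro!: derivative_eq_intros simp: t has_real_derivative_iff_has_vector_derivative[symmetric])
  moreover have "norm (?f u s - ?f v s) \<le> (L + c) * d * exp (?b * s)" if s: "s \<in> {0..t}" for s
  proof -
    have P: "u s \<in> P" "v s \<in> P"
      using s u v by auto
    have "?f u s - ?f v s = exp (c * s) *\<^sub>R T (t - s) (F (u s) - F (v s) + c *\<^sub>R (u s - v s))"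
    proof -
      have "F (u s) + c *\<^sub>R u s - (F (v s) + c *\<^sub>R v s) = F (u s) - F (v s) + c *\<^sub>R (u s - v s)"
        by (simp add: scaleR_diff_right)
      moreover have "T (t - s) (F (u s) + c *\<^sub>R u s - (F (v s) + c *\<^sub>R v s))
          = T (t - s) (F (u s) + c *\<^sub>R u s) - T (t - s) (F (v s) + c *\<^sub>R v s)"
        using s P by (intro T_diff V_add V_scale P_V F_mem) auto
      ultimately show ?thesis
        by (simp only: scaleR_diff_right[of "exp (c * s)"])
    qed
    also have "norm \<dots> \<le> exp (c * s) * norm (F (u s) - F (v s) + c *\<^sub>R (u s - v s))"
      using s T_norm[OF _ V_add[OF V_diff[OF F_mem F_mem] V_scale[OF V_diff[OF P_V P_V]]], OF _ P P, of "t - s" c]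
      by simp
    also have "norm (F (u s) - F (v s) + c *\<^sub>R (u s - v s)) \<le> L * norm (u s - v s) + c * norm (u s - v s)"
      using F_lipschitz[OF P(2,1)] c_pos by (intro norm_triangle_le add_mono) auto
    also have "\<dots> = (L + c) * norm (u s - v s)"
      by (simp add: algebra_simps)
    also have "\<dots> \<le> (L + c) * (exp ((2 * L + c) * s) * d)"
      using s c_pos L_nonneg by (intro mult_left_mono d) auto
    also have "exp (c * s) * ((L + c) * (exp ((2 * L + c) * s) * d))
        = (L + c) * d * (exp (c * s) * exp ((2 * L + c) * s))"
      by simp
    also have "exp (c * s) * exp ((2 * L + c) * s) = exp (?b * s)"
      by (simp add: exp_add[symmetric] algebra_simps)
    finally show ?thesis
      by simp
  qed
  ultimately have "norm (exp (c * t) *\<^sub>R (picard x u t - picard x v t)) \<le> d / 2 * exp (?b * t) - d / 2"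
    using integral_norm_bound_integral[of "\<lambda>s. ?f u s - ?f v s" "{0..t}" "\<lambda>s. (L + c) * d * exp (?b * s)"] int
    by (simp add: has_integral_iff)
  also have "\<dots> \<le> exp (c * t) * (exp ((2 * L + c) * t) * (d / 2))"
    using d0 by (simp add: exp_add[symmetric] algebra_simps)
  finally show ?thesis
    by simp
qed

text \<open>The constraint sets \<open>A t\<close> are built into the fixed point problem: every
  closed constraint respected by the Picard map is inherited by the solution. Taking
  \<open>P\<close> for all times gives existence, taking the elements between two moving barriers
  gives the bounds for (iii).\<close>

lemma picard_iteration:
  fixes A :: "real \<Rightarrow> 'x set"
  assumes x: "x \<in> P" and A: "\<And>t. 0 \<le> t \<Longrightarrow> closed (A t)" "\<And>t. 0 \<le> t \<Longrightarrow> A t \<subseteq> P"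
    and start: "continuous_on {0..} \<gamma>" "\<And>t. 0 \<le> t \<Longrightarrow> \<gamma> t \<in> A t"
    and inv: "\<And>u t. continuous_on {0..} u \<Longrightarrow> (\<And>s. 0 \<le> s \<Longrightarrow> u s \<in> A s) \<Longrightarrow> 0 \<le> t \<Longrightarrow> picard x u t \<in> A t"
  shows "\<exists>u. continuous_on {0..} u \<and> (\<forall>t\<ge>0. u t \<in> A t) \<and> mild 0 (\<lambda>s. F (u s)) x u"
proof -
  define b where "b = 2 * L + c"
  have "0 \<le> b"
    using L_nonneg c_pos by (simp add: b_def)
  define curve where "curve w s = exp (b * s) *\<^sub>R apply_bcontfun w s" for w :: "real \<Rightarrow>\<^sub>C 'x" and s
  define W where "W = {w. \<forall>t\<ge>0. curve w t \<in> A t}"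
  \<comment> \<open>Weighted curves are extended to negative times by their value at 0, since the
    complete space in use consists of functions on the whole real line. Elements of \<open>P\<close>
    have norm one and the weight is at most 1, so these functions are bounded by 1.\<close>
  define wt where "wt u t = exp (- b * max 0 t) *\<^sub>R u (max 0 t)" for u :: "real \<Rightarrow> 'x" and t
  define \<Phi> where "\<Phi> w = Bcontfun (wt (picard x (curve w)))" for w
  have wt: "apply_bcontfun (Bcontfun (wt u)) = wt u"
    if u: "continuous_on {0..} u" "\<And>t. 0 \<le> t \<Longrightarrow> u t \<in> A t" for u
  proof (rule Bcontfun_inverse, rule bcontfun_normI)
    show "continuous_on UNIV (wt u)"
      unfolding wt_def by (intro continuous_intros continuous_on_compose2[OF u(1)]) auto
    fix t show "norm (wt u t) \<le> 1"
      using u(2)[of "max 0 t"] A(2)[of "max 0 t"] P_norm[of "u (max 0 t)"] \<open>0 \<le> b\<close> by (auto simp: wt_def)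
  qed
  have curve_cont: "continuous_on B (curve w)" for B w
    unfolding curve_def by (intro continuous_intros continuous_on_apply_bcontfun)
  have curve_wt: "curve (Bcontfun (wt u)) t = u t"
    if "continuous_on {0..} u" "\<And>t. 0 \<le> t \<Longrightarrow> u t \<in> A t" "0 \<le> t" for u t
    using that by (simp add: curve_def wt) (simp add: wt_def exp_minus)
  have pic: "continuous_on {0..} (picard x (curve w))" "\<And>t. 0 \<le> t \<Longrightarrow> picard x (curve w) t \<in> A t"
    if "w \<in> W" for w
    using that A(2) x by (auto intro!: continuous_on_picard curve_cont inv simp: P_V W_def)
  have "\<exists>!w\<in>W. \<Phi> w = w"
  proof (rule Banach_fix[OF iffD2[OF complete_eq_closed]])
    show "closed W"
    proof -
      have "W = (\<Inter>t\<in>{0..}. (\<lambda>w. curve w t) -` A t)"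
        by (auto simp: W_def)
      moreover have "closed ((\<lambda>w. curve w t) -` A t)" if "0 \<le> t" for t
        unfolding curve_def
        by (intro continuous_closed_vimage A that continuous_intros
            linear_continuous_at bounded_linear_apply_bcontfun)
      ultimately show ?thesis
        by auto
    qed
    have "Bcontfun (wt \<gamma>) \<in> W"
      by (auto simp: W_def curve_wt start)
    then show "W \<noteq> {}" by auto
    show "\<Phi> ` W \<subseteq> W"
      using pic by (auto simp: W_def \<Phi>_def curve_wt)
    \<comment> \<open>Only the values at nonnegative times enter \<open>\<Phi>\<close>, and its
      image is constant on negative times, so the estimate at max 0 t controls the distance on the
      whole line.\<close>
    show "dist (\<Phi> w) (\<Phi> v) \<le> 1 / 2 * dist w v" if wv: "w \<in> W" "v \<in> W" for w v
    proof (rule dist_bound)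
      fix t :: real
      let ?t = "max 0 t"
      have P: "curve w s \<in> P" "curve v s \<in> P" if "0 \<le> s" for s
        using wv that A(2) by (auto simp: W_def)
      have "norm (picard x (curve w) ?t - picard x (curve v) ?t) \<le> exp (b * ?t) * (dist w v / 2)"
        unfolding b_def
      proof (rule picard_diff_le)
        fix s :: real
        have "norm (curve w s - curve v s) = exp (b * s) * dist (apply_bcontfun w s) (apply_bcontfun v s)"
          by (simp add: curve_def dist_norm scaleR_diff_right[symmetric])
        also have "\<dots> \<le> exp (b * s) * dist w v"
          by (intro mult_left_mono dist_bounded) auto
        finally show "norm (curve w s - curve v s) \<le> exp ((2 * L + c) * s) * dist w v"
          by (simp add: b_def)
      qed (auto simp: curve_cont P P_V x)
      then show "dist (apply_bcontfun (\<Phi> w) t) (apply_bcontfun (\<Phi> v) t) \<le> 1 / 2 * dist w v"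
        using pic wv
        by (simp add: \<Phi>_def wt dist_norm)
           (simp add: wt_def scaleR_diff_right[symmetric] exp_minus divide_simps mult_ac)
    qed
  qed auto
  then obtain w where w: "w \<in> W" "\<Phi> w = w"
    by blast
  have fix_curve: "picard x (curve w) t = curve w t" if "0 \<le> t" for t
    using curve_wt[OF pic, OF w(1) w(1) _ that] w(2) by (simp add: \<Phi>_def)
  have wP: "curve w t \<in> P" if "0 \<le> t" for t
    using w(1) A(2) that by (auto simp: W_def)
  have "mild 0 (\<lambda>s. F (curve w s)) x (curve w)"
    using fix_curve picard_fixpoint_iff_mild[of "curve w" x] mild_absorb_iff[of "curve w" x] wP x
    by (simp add: curve_cont P_V)
  then show ?thesis
    using w(1) by (intro exI[of _ "curve w"]) (auto simp: W_def curve_cont)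
qed

lemma mild_exists:
  assumes x: "x \<in> P"
  shows "\<exists>u. continuous_on {0..} u \<and> (\<forall>t\<ge>0. u t \<in> P) \<and> mild 0 (\<lambda>s. F (u s)) x u"
  using picard_iteration[of x "\<lambda>_. P" "\<lambda>_. x"] picard_in_P closed_P x by simp

text \<open>By contractivity the distance of two solutions is at most L times its own integral;
  Gronwall with initial constant 0 makes it vanish.\<close>

lemma mild_unique:
  assumes u: "continuous_on {0..} u" "\<And>t. 0 \<le> t \<Longrightarrow> u t \<in> P" "mild 0 (\<lambda>s. F (u s)) x u"
    and v: "continuous_on {0..} v" "\<And>t. 0 \<le> t \<Longrightarrow> v t \<in> P" "mild 0 (\<lambda>s. F (v s)) x v"
    and t: "0 \<le> t"
  shows "u t = v t"
proof -
  let ?\<phi> = "\<lambda>t. norm (u t - v t)"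
  have cont: "continuous_on {0..t} ?\<phi>" for t
    by (intro continuous_intros continuous_on_subset[OF u(1)] continuous_on_subset[OF v(1)]) auto
  have "?\<phi> t \<le> 0 * exp (L * t)"
  proof (rule gronwall[where \<tau> = t])
    fix r assume r: "r \<in> {0..t}"
    have "((\<lambda>s. T (r - s) (F (u s)) - T (r - s) (F (v s))) has_integral (u r - T r x - (v r - T r x))) {0..r}"
      using u(3) v(3) r by (intro has_integral_diff) (auto simp: mild_def)
    then have int: "((\<lambda>s. T (r - s) (F (u s)) - T (r - s) (F (v s))) has_integral (u r - v r)) {0..r}"
      by simp
    have int': "((\<lambda>s. L * ?\<phi> s) has_integral (L * integral {0..r} ?\<phi>)) {0..r}"
      by (intro has_integral_mult_right integrable_integral integrable_continuous_real cont)
    have "norm (T (r - s) (F (u s)) - T (r - s) (F (v s))) \<le> L * ?\<phi> s" if s: "s \<in> {0..r}" for s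
    proof -
      have "norm (T (r - s) (F (u s)) - T (r - s) (F (v s))) = norm (T (r - s) (F (u s) - F (v s)))"
        using s by (simp add: T_diff F_mem u v)
      also have "\<dots> \<le> norm (F (u s) - F (v s))"
        using s by (intro T_norm V_diff F_mem u v) auto
      also have "\<dots> \<le> L * ?\<phi> s"
        using s by (intro F_lipschitz u v) auto
      finally show ?thesis .
    qed
    then have "norm (integral {0..r} (\<lambda>s. T (r - s) (F (u s)) - T (r - s) (F (v s))))
        \<le> integral {0..r} (\<lambda>s. L * ?\<phi> s)"
      using int int' by (intro integral_norm_bound_integral) (auto simp: has_integral_iff)
    then show "?\<phi> r \<le> 0 + L * integral {0..r} ?\<phi>"
      using int int' by (simp add: has_integral_iff)
  qed (use t L_nonneg cont in auto)
  then show ?thesis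
    by simp
qed

end

section \<open>Differentiability of mild solutions\<close>

lemma has_vector_derivative_iff_quotient:
  "(f has_vector_derivative D) (at t within S) \<longleftrightarrow> ((\<lambda>s. (f s - f t) /\<^sub>R (s - t)) \<longlongrightarrow> D) (at t within S)"
proof -
  have "(f has_vector_derivative D) (at t within S) \<longleftrightarrow>
      ((\<lambda>s. norm (f s - f t - (s - t) *\<^sub>R D) / norm (s - t)) \<longlongrightarrow> 0) (at t within S)"
    by (simp add: has_vector_derivative_def has_derivative_iff_norm bounded_linear_scaleR_left)
  also have "\<dots> \<longleftrightarrow> ((\<lambda>s. norm ((f s - f t) /\<^sub>R (s - t) - D)) \<longlongrightarrow> 0) (at t within S)"
  proof (rule tendsto_cong)
    have "\<forall>\<^sub>F s in at t within S. s \<noteq> t"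
      by (simp add: eventually_at_filter)
    then show "\<forall>\<^sub>F s in at t within S.
        norm (f s - f t - (s - t) *\<^sub>R D) / norm (s - t) = norm ((f s - f t) /\<^sub>R (s - t) - D)"
    proof eventually_elim
      case (elim s)
      then have "(f s - f t) /\<^sub>R (s - t) - D = (f s - f t - (s - t) *\<^sub>R D) /\<^sub>R (s - t)"
        by (simp add: scaleR_diff_right)
      then show ?case
        by (simp add: divide_inverse mult.commute abs_inverse)
    qed
  qed
  also have "\<dots> \<longleftrightarrow> ((\<lambda>s. (f s - f t) /\<^sub>R (s - t)) \<longlongrightarrow> D) (at t within S)"
    by (simp add: tendsto_norm_zero_iff LIM_zero_iff)
  finally show ?thesis .
qed

text \<open>Locally uniform convergence of the right difference quotients also controls the left ones, since
  \<open>(u t - u s) / (t - s)\<close> is the right quotient at the smaller of the two points.\<close>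

lemma has_vector_derivative_if_uniform_right_quotients:
  fixes u w :: "real \<Rightarrow> 'x::real_normed_vector"
  assumes w: "continuous_on {0..} w"
    and unif: "\<And>\<tau> \<epsilon>. 0 < \<epsilon> \<Longrightarrow> \<exists>\<eta>>0. \<forall>h t. 0 < h \<longrightarrow> h < \<eta> \<longrightarrow> 0 \<le> t \<longrightarrow> t \<le> \<tau> \<longrightarrow>
      norm ((u (t + h) - u t) /\<^sub>R h - w t) \<le> \<epsilon>"
    and t: "0 \<le> t"
  shows "(u has_vector_derivative w t) (at t within {0..})"
  unfolding has_vector_derivative_iff_quotient
proof (rule tendstoI)
  fix \<epsilon> :: real assume \<epsilon>: "0 < \<epsilon>"
  obtain \<eta> where \<eta>: "0 < \<eta>" and close: "\<And>h q. 0 < h \<Longrightarrow> h < \<eta> \<Longrightarrow> 0 \<le> q \<Longrightarrow> q \<le> t \<Longrightarrow>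
      norm ((u (q + h) - u q) /\<^sub>R h - w q) \<le> \<epsilon> / 3"
    using unif[of "\<epsilon> / 3" t] \<epsilon> by auto
  have "\<forall>\<epsilon>>0. \<exists>\<delta>>0. \<forall>q\<in>{0..}. dist q t < \<delta> \<longrightarrow> dist (w q) (w t) < \<epsilon>"
    using w t unfolding continuous_on_iff by auto
  then have "\<exists>\<delta>>0. \<forall>q\<in>{0..}. dist q t < \<delta> \<longrightarrow> dist (w q) (w t) < \<epsilon> / 3"
    using \<epsilon> by (auto elim!: allE[of _ "\<epsilon> / 3"])
  then obtain \<theta> where \<theta>: "0 < \<theta>" and wclose: "\<And>q. 0 \<le> q \<Longrightarrow> \<bar>q - t\<bar> < \<theta> \<Longrightarrow> norm (w q - w t) < \<epsilon> / 3"
    by (auto simp: dist_norm)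
  show "\<forall>\<^sub>F s in at t within {0..}. dist ((u s - u t) /\<^sub>R (s - t)) (w t) < \<epsilon>"
    unfolding eventually_at
  proof (intro exI[of _ "min \<eta> \<theta>"] conjI ballI impI)
    fix s assume s: "s \<in> {0..}" "s \<noteq> t \<and> dist s t < min \<eta> \<theta>"
    define q where "q = min s t"
    define h where "h = \<bar>s - t\<bar>"
    have "(u s - u t) /\<^sub>R (s - t) = (u (q + h) - u q) /\<^sub>R h"
    proof (cases "s \<le> t")
      case True
      then have "(u s - u t) /\<^sub>R (s - t) = (- (u t - u s)) /\<^sub>R (- (t - s))"
        by simp
      also have "\<dots> = (u t - u s) /\<^sub>R (t - s)"
        by (simp only: inverse_minus_eq scaleR_minus_left scaleR_minus_right minus_minus)
      finally show ?thesis
        using True by (simp add: q_def h_def)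
    qed (simp add: q_def h_def)
    moreover have "norm ((u (q + h) - u q) /\<^sub>R h - w q) \<le> \<epsilon> / 3"
      using s t by (intro close) (auto simp: q_def h_def dist_real_def)
    moreover have "norm (w q - w t) < \<epsilon> / 3"
      using s t \<theta> by (intro wclose) (auto simp: q_def dist_real_def min_def split: if_splits)
    moreover have "norm ((u (q + h) - u q) /\<^sub>R h - w t)
        \<le> norm ((u (q + h) - u q) /\<^sub>R h - w q) + norm (w q - w t)"
      using norm_triangle_ineq[of "(u (q + h) - u q) /\<^sub>R h - w q" "w q - w t"] by simp
    ultimately show "dist ((u s - u t) /\<^sub>R (s - t)) (w t) < \<epsilon>"
      using \<epsilon> by (simp add: dist_norm)
  qed (use \<eta> \<theta> in auto)
qed

context contraction_semigroup_on
begin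

text \<open>A relation rather than a partial operator: membership in the domain and the value of the
  generator become one statement.\<close>

definition generates :: "'x \<Rightarrow> 'x \<Rightarrow> bool" where
  "generates f k \<longleftrightarrow> ((\<lambda>h. (T h f - f) /\<^sub>R h) \<longlongrightarrow> k) (at_right 0)"

lemma generates_mem:
  assumes "generates f k" "f \<in> V"
  shows "k \<in> V"
proof (rule Lim_in_closed_set[OF V_closed _ _ assms(1)[unfolded generates_def]])
  have "\<forall>\<^sub>F h in at_right 0. (0::real) < h"
    by (simp add: eventually_at_filter)
  then show "\<forall>\<^sub>F h in at_right 0. (T h f - f) /\<^sub>R h \<in> V"
    by eventually_elim (simp add: V_scale V_diff T_mem assms)
qed simp

text \<open>The quotient at time t is T t applied to the quotient at time 0, so contractivity makes
  the convergence uniform in t and the criterion by right quotients applies.\<close>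

lemma orbit_has_vector_derivative:
  assumes f: "f \<in> V" and k: "generates f k" and t: "0 \<le> t"
  shows "((\<lambda>t. T t f) has_vector_derivative T t k) (at t within {0..})"
proof (rule has_vector_derivative_if_uniform_right_quotients[OF _ _ t])
  have kV: "k \<in> V"
    by (rule generates_mem[OF k f])
  then show "continuous_on {0..} (\<lambda>t. T t k)"
    by (intro continuous_on_T_comp continuous_intros) auto
  fix \<tau> \<epsilon> :: real assume "0 < \<epsilon>"
  then have "\<forall>\<^sub>F h in at_right 0. dist ((T h f - f) /\<^sub>R h) k < \<epsilon>"
    using k unfolding generates_def by (rule tendstoD[rotated])
  then obtain \<eta> where \<eta>: "0 < \<eta>" "\<And>h. 0 < h \<Longrightarrow> h < \<eta> \<Longrightarrow> norm ((T h f - f) /\<^sub>R h - k) < \<epsilon>"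
    by (auto simp: eventually_at_right_field dist_norm)
  have "norm ((T (t + h) f - T t f) /\<^sub>R h - T t k) \<le> \<epsilon>" if "0 < h" "h < \<eta>" "0 \<le> t" for h t
  proof -
    have "(T (t + h) f - T t f) /\<^sub>R h - T t k = T t ((T h f - f) /\<^sub>R h - k)"
      using that f kV by (simp add: T_diff V_diff V_scale T_mem T_scale T_semigroup)
    then show ?thesis
      using T_norm[of t "(T h f - f) /\<^sub>R h - k"] \<eta>(2)[of h] that f kV
      by (simp add: V_diff V_scale T_mem)
  qed
  then show "\<exists>\<eta>>0. \<forall>h t. 0 < h \<longrightarrow> h < \<eta> \<longrightarrow> 0 \<le> t \<longrightarrow> t \<le> \<tau> \<longrightarrow>
      norm ((T (t + h) f - T t f) /\<^sub>R h - T t k) \<le> \<epsilon>"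
    using \<eta>(1) by blast
qed

lemma reversed_orbit_has_vector_derivative:
  assumes f: "f \<in> V" and k: "generates f k" and s: "0 \<le> s" "s \<le> t"
  shows "((\<lambda>s. T (t - s) f) has_vector_derivative - T (t - s) k) (at s within {0..t})"
proof -
  have "((\<lambda>r. t - r) has_vector_derivative - 1) (at s within {0..t})"
    by (auto intro!: derivative_eq_intros)
  moreover have "((\<lambda>t. T t f) has_vector_derivative T (t - s) k) (at (t - s) within (\<lambda>r. t - r) ` {0..t})"
    by (rule has_vector_derivative_within_subset[OF orbit_has_vector_derivative[OF f k]]) (use s in auto)
  ultimately show ?thesis
    using vector_diff_chain_within[of "\<lambda>r. t - r" "- 1" s "{0..t}" "\<lambda>t. T t f" "T (t - s) k"]
    by (simp add: o_def)
qed

text \<open>To first order the Duhamel term over [0, h] is h times g 0; this is how the nonlinearity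
  enters right derivatives. For s in [0, h] both h - s and s are small, so joint continuity of T r
  (g s) at (0, 0) controls the integrand.\<close>

lemma duhamel_average_tendsto:
  assumes g: "continuous_on {0..} g" "\<And>s. 0 \<le> s \<Longrightarrow> g s \<in> V"
    and J: "\<And>h. 0 < h \<Longrightarrow> ((\<lambda>s. T (h - s) (g s)) has_integral J h) {0..h}"
  shows "((\<lambda>h. J h /\<^sub>R h) \<longlongrightarrow> g 0) (at_right 0)"
proof (rule tendstoI)
  fix \<epsilon> :: real assume \<epsilon>: "0 < \<epsilon>"
  have "continuous_on ({0..} \<times> {0..}) (\<lambda>(r, s). T r (g s))"
    unfolding case_prod_beta
    by (intro continuous_on_T_comp continuous_intros continuous_on_compose2[OF g(1)]) (auto simp: g)
  moreover have "(0, 0) \<in> {0::real..} \<times> {0::real..}"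
    by simp
  ultimately obtain d where d: "0 < d"
    "\<And>z. z \<in> {0..} \<times> {0..} \<Longrightarrow> dist z (0, 0) < d \<Longrightarrow> dist (T (fst z) (g (snd z))) (T 0 (g 0)) < \<epsilon> / 2"
    using \<epsilon> unfolding continuous_on_iff case_prod_beta by (metis (no_types, lifting) fst_conv half_gt_zero snd_conv)
  have close: "norm (T r (g s) - g 0) \<le> \<epsilon> / 2" if "0 \<le> r" "0 \<le> s" "r < d / 2" "s < d / 2" for r s
  proof -
    have "dist (r, s) (0, 0) \<le> \<bar>r\<bar> + \<bar>s\<bar>"
      unfolding dist_Pair_Pair dist_real_def by (rule order_trans[OF sqrt_sum_squares_le_sum_abs]) simp
    then show ?thesis
      using d(2)[of "(r, s)"] that by (simp add: dist_norm T_0 g)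
  qed
  have "dist (J h /\<^sub>R h) (g 0) < \<epsilon>" if h: "0 < h" "h < d / 2" for h
  proof -
    have "((\<lambda>s. T (h - s) (g s) - g 0) has_integral (J h - h *\<^sub>R g 0)) (cbox 0 h)"
      using has_integral_diff[OF J[OF h(1)] has_integral_const_real[of "g 0" 0 h]] h by simp
    then have "norm (J h - h *\<^sub>R g 0) \<le> \<epsilon> / 2 * h"
      using has_integral_bound[of "\<epsilon> / 2" _ "J h - h *\<^sub>R g 0" 0 h] close h \<epsilon> by fastforce
    moreover have "J h /\<^sub>R h - g 0 = (J h - h *\<^sub>R g 0) /\<^sub>R h"
      using h by (simp add: scaleR_diff_right)
    ultimately have "norm (J h /\<^sub>R h - g 0) \<le> \<epsilon> / 2"
      using h by (simp add: divide_simps mult_ac)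
    then show ?thesis
      using \<epsilon> by (simp add: dist_norm)
  qed
  then show "\<forall>\<^sub>F h in at_right 0. dist (J h /\<^sub>R h) (g 0) < \<epsilon>"
    using d(1) by (auto simp: eventually_at_right_field intro!: exI[of _ "d / 2"])
qed

text \<open>The derivative form is integrated over [h, t + h] and translated. This puts the solution
  and its time translate into Duhamel formulas over the same interval, so that increments in time
  can be subtracted.\<close>

lemma mild_restart:
  assumes u: "mild 0 g x u" and g: "continuous_on {0..} g" "\<And>s. 0 \<le> s \<Longrightarrow> g s \<in> V" and x: "x \<in> V"
    and h: "0 \<le> h" and t: "0 \<le> t"
  shows "((\<lambda>s. T (t - s) (g (s + h))) has_integral (u (t + h) - T t (u h))) {0..t}"
proof -
  have uV: "u r \<in> V" if "0 \<le> r" for r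
    using mild_mem[OF u g(2) x] that by simp
  have "((\<lambda>s. T (t + h - s) (g s)) has_integral (T (t + h - (t + h)) (u (t + h)) - T (t + h - h) (u h))) {h..t + h}"
  proof (rule fundamental_theorem_of_calculus)
    fix s assume s: "s \<in> {h..t + h}"
    have "((\<lambda>s. T (t + h - s) (u s)) has_vector_derivative T (t + h - s) (g s)) (at s within {0..t + h})"
      using mild_has_vector_derivative[OF u g x, of s "t + h"] s h by simp
    then show "((\<lambda>s. T (t + h - s) (u s)) has_vector_derivative T (t + h - s) (g s)) (at s within {h..t + h})"
      by (rule has_vector_derivative_within_subset) (use h in auto)
  qed (use t in simp)
  then have "((\<lambda>s. T (t + h - s) (g s)) has_integral (u (t + h) - T t (u h))) {0 + h..t + h}"
    using uV[of "t + h"] h t by (simp add: T_0)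
  then show ?thesis
    unfolding has_integral_shift_Icc_real[symmetric] by (simp add: o_def add.commute)
qed

end

context contraction_semigroup_on
begin

text \<open>Stability of a Duhamel equation whose source is controlled by the unknown itself. It
  serves twice for difference quotients: with b = 0 to bound one of them, and with small b to
  compare two.\<close>

lemma duhamel_gronwall:
  assumes D: "continuous_on {0..\<tau>} D" "\<And>t. t \<in> {0..\<tau>} \<Longrightarrow> D t \<in> V"
    and \<Psi>: "\<And>s. s \<in> {0..\<tau>} \<Longrightarrow> \<Psi> s \<in> V" "\<And>s. s \<in> {0..\<tau>} \<Longrightarrow> norm (\<Psi> s) \<le> C * norm (D s) + b"
    and int: "\<And>t. t \<in> {0..\<tau>} \<Longrightarrow> ((\<lambda>s. T (t - s) (\<Psi> s)) has_integral (D t - T t (D 0))) {0..t}"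
    and "0 \<le> C" "0 \<le> b" and t: "t \<in> {0..\<tau>}"
  shows "norm (D t) \<le> (norm (D 0) + b * \<tau>) * exp (C * \<tau>)"
proof -
  have cont: "continuous_on {0..r} (\<lambda>t. norm (D t))" if "r \<in> {0..\<tau>}" for r
    using that by (intro continuous_intros continuous_on_subset[OF D(1)]) auto
  have "norm (D t) \<le> (norm (D 0) + b * \<tau>) * exp (C * t)"
  proof (rule gronwall[OF _ \<open>0 \<le> C\<close> _ t])
    show "continuous_on {0..\<tau>} (\<lambda>t. norm (D t))"
      using t by (intro cont) auto
    fix r assume r: "r \<in> {0..\<tau>}"
    have "((\<lambda>s. C * norm (D s) + b) has_integral (C * integral {0..r} (\<lambda>s. norm (D s)) + b * r)) {0..r}"
      using r has_integral_const_real[of b 0 r]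
      by (intro has_integral_add has_integral_mult_right integrable_integral integrable_continuous_real cont)
        (simp_all add: mult.commute)
    moreover have "norm (T (r - s) (\<Psi> s)) \<le> C * norm (D s) + b" if "s \<in> {0..r}" for s
      using that r T_norm[of "r - s" "\<Psi> s"] \<Psi>[of s] by fastforce
    ultimately have "norm (D r - T r (D 0)) \<le> C * integral {0..r} (\<lambda>s. norm (D s)) + b * r"
      using int[OF r] integral_norm_bound_integral[of "\<lambda>s. T (r - s) (\<Psi> s)" "{0..r}" "\<lambda>s. C * norm (D s) + b"]
      by (auto simp: has_integral_iff)
    moreover have "norm (T r (D 0)) \<le> norm (D 0)"
      using r D(2)[of 0] by (intro T_norm) auto
    moreover have "norm (D r) \<le> norm (D r - T r (D 0)) + norm (T r (D 0))"
      by (metis diff_add_cancel norm_triangle_ineq)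
    moreover have "b * r \<le> b * \<tau>"
      using r \<open>0 \<le> b\<close> by (intro mult_left_mono) auto
    ultimately show "norm (D r) \<le> norm (D 0) + b * \<tau> + C * integral {0..r} (\<lambda>s. norm (D s))"
      by linarith
  qed
  also have "\<dots> \<le> (norm (D 0) + b * \<tau>) * exp (C * \<tau>)"
    using t \<open>0 \<le> C\<close> \<open>0 \<le> b\<close> by (intro mult_left_mono) (auto intro!: mult_left_mono)
  finally show ?thesis .
qed

end

context mean_field_semigroup
begin

text \<open>The right quotients \<open>\<delta> h\<close> satisfy a Duhamel equation whose source is
  the difference quotient of \<open>F\<close> along the solution. \<open>F_quotients\<close> makes
  this equation stable in h: the quotients are Cauchy as h tends to 0, uniformly on bounded time
  intervals, once they converge at time 0. That is where the domain condition on x enters.\<close>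

lemma mild_classical:
  assumes u: "continuous_on {0..} u" "\<And>t. 0 \<le> t \<Longrightarrow> u t \<in> P" "mild 0 (\<lambda>s. F (u s)) x u"
    and x: "x \<in> P" and k: "generates x k"
  shows "\<exists>w. continuous_on {0..} w \<and> (\<forall>t\<ge>0. (u has_vector_derivative w t) (at t within {0..}) \<and>
    generates (u t) (w t - F (u t)))"
proof -
  define \<delta> where "\<delta> h t = (u (t + h) - u t) /\<^sub>R h" for h t
  define \<Phi> where "\<Phi> h s = (F (u (s + h)) - F (u s)) /\<^sub>R h" for h s
  have xV: "x \<in> V" and u0: "u 0 = x"
    using x mild_at_0[OF u(3)] by (auto simp: P_V)
  have uV: "u t \<in> V" and FV: "F (u t) \<in> V" if "0 \<le> t" for t
    using u(2) that by (auto simp: P_V F_mem)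
  have F_cont: "continuous_on {0..} (\<lambda>s. F (u s))"
    by (intro continuous_on_F_comp u) auto
  note restart = mild_restart[OF u(3) F_cont FV xV]
  have \<delta>V: "\<delta> h t \<in> V" and \<Phi>V: "\<Phi> h t \<in> V" if "0 < h" "0 \<le> t" for h t
    using that by (auto simp: \<delta>_def \<Phi>_def V_scale V_diff uV FV)
  have \<delta>_cont: "continuous_on {0..\<tau>} (\<delta> h)" if "0 < h" for h \<tau>
    unfolding \<delta>_def using that by (intro continuous_intros continuous_on_compose2[OF u(1)]) auto
  have \<delta>_int: "((\<lambda>s. T (t - s) (\<Phi> h s)) has_integral (\<delta> h t - T t (\<delta> h 0))) {0..t}"
    if h: "0 < h" and t: "0 \<le> t" for h t
  proof -
    have "((\<lambda>s. (T (t - s) (F (u (s + h))) - T (t - s) (F (u (s + 0)))) /\<^sub>R h) has_integral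
        ((u (t + h) - T t (u h) - (u (t + 0) - T t (u 0))) /\<^sub>R h)) {0..t}"
      using h t by (intro has_integral_cmul has_integral_diff restart) auto
    moreover have "(T (t - s) (F (u (s + h))) - T (t - s) (F (u (s + 0)))) /\<^sub>R h = T (t - s) (\<Phi> h s)"
      if "s \<in> {0..t}" for s
      using that h by (simp add: \<Phi>_def T_scale T_diff V_diff FV)
    moreover have "(u (t + h) - T t (u h) - (u (t + 0) - T t (u 0))) /\<^sub>R h = \<delta> h t - T t (\<delta> h 0)"
      using h t by (simp add: \<delta>_def T_scale T_diff V_diff uV scaleR_diff_right[symmetric])
    ultimately show ?thesis
      by (metis (no_types, lifting) has_integral_eq)
  qed
  \<comment> \<open>At time 0 the quotient is a Duhamel average, with limit F x, plus the generator
    quotient of x, with limit k.\<close>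
  have "((\<lambda>h. (u h - T h x) /\<^sub>R h) \<longlongrightarrow> F (u 0)) (at_right 0)"
    using u(3) by (intro duhamel_average_tendsto[OF F_cont FV]) (auto simp: mild_def)
  then have "((\<lambda>h. (u h - T h x) /\<^sub>R h + (T h x - x) /\<^sub>R h) \<longlongrightarrow> F (u 0) + k) (at_right 0)"
    using k unfolding generates_def by (rule tendsto_add)
  then have \<delta>0: "((\<lambda>h. \<delta> h 0) \<longlongrightarrow> F x + k) (at_right 0)"
    by (simp add: \<delta>_def u0 scaleR_add_right[symmetric])
  define w0 where "w0 = F x + k"
  note \<delta>0 = \<delta>0[folded w0_def]
  have cauchy: "\<exists>\<eta>>0. \<forall>h k t. 0 < h \<longrightarrow> h < \<eta> \<longrightarrow> 0 < k \<longrightarrow> k < \<eta> \<longrightarrow> 0 \<le> t \<longrightarrow> t \<le> \<tau> \<longrightarrow>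
      norm (\<delta> h t - \<delta> k t) \<le> \<epsilon>" if \<epsilon>: "0 < \<epsilon>" and \<tau>: "0 \<le> \<tau>" for \<epsilon> \<tau>
  proof -
    \<comment> \<open>\<open>B\<close> is the Gronwall bound for the quotients on [0, \<tau>]; norm
      w0 + 1 dominates their initial values for h below \<open>\<eta>1\<close>. The modulus
      \<open>\<omega>\<close> is made for L * \<omega> * B * \<tau> to stay below \<epsilon> / (2 *
      exp (L * \<tau>)), with + 1 keeping its denominator positive.\<close>
    define B where "B = (norm w0 + 1) * exp (L * \<tau>)"
    define \<omega> where "\<omega> = \<epsilon> / (2 * exp (L * \<tau>) * (L * B * \<tau> + 1))"
    have B: "0 \<le> B"
      by (simp add: B_def)
    then have LB: "0 < L * B * \<tau> + 1"
      using L_nonneg \<tau> by (simp add: add_nonneg_pos)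
    then have \<omega>: "0 < \<omega>"
      using \<epsilon> by (simp add: \<omega>_def)
    have "0 < min 1 (\<epsilon> / (4 * exp (L * \<tau>)))"
      using \<epsilon> by simp
    from tendstoD[OF \<delta>0 this] obtain \<eta>1 where \<eta>1: "0 < \<eta>1"
      "\<And>h. 0 < h \<Longrightarrow> h < \<eta>1 \<Longrightarrow> norm (\<delta> h 0 - w0) < min 1 (\<epsilon> / (4 * exp (L * \<tau>)))"
      by (auto simp: eventually_at_right_field dist_norm)
    \<comment> \<open>The margin 1 contains the translated times s + h and s + k, since
      \<open>\<eta>\<close> is at most 1.\<close>
    have "uniformly_continuous_on {0..\<tau> + 1} u"
      by (intro compact_uniformly_continuous continuous_on_subset[OF u(1)]) auto
    then obtain \<eta>2 where \<eta>2: "0 < \<eta>2"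
      "\<And>r s. r \<in> {0..\<tau> + 1} \<Longrightarrow> s \<in> {0..\<tau> + 1} \<Longrightarrow> dist s r < \<eta>2 \<Longrightarrow> dist (u s) (u r) < \<omega>"
      using \<omega> unfolding uniformly_continuous_on_def by metis
    define \<eta> where "\<eta> = min 1 (min \<eta>1 \<eta>2)"
    have "norm (\<delta> h t - \<delta> k t) \<le> \<epsilon>" if h: "0 < h" "h < \<eta>" and k: "0 < k" "k < \<eta>" and t: "t \<in> {0..\<tau>}" for h k t
    proof -
      have \<Phi>_le: "norm (\<Phi> k s) \<le> L * norm (\<delta> k s)" if s: "0 \<le> s" for s
        using F_lipschitz[OF u(2) u(2), of s "s + k"] s k
        by (simp add: \<Phi>_def \<delta>_def divide_simps)
      have \<delta>k0: "norm (\<delta> k 0) \<le> norm w0 + 1"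
        using \<eta>1(2)[of k] k norm_triangle_sub[of "\<delta> k 0" w0] by (simp add: \<eta>_def)
      have \<delta>k: "norm (\<delta> k s) \<le> B" if s: "s \<in> {0..\<tau>}" for s
      proof -
        have "norm (\<delta> k s) \<le> (norm (\<delta> k 0) + 0 * \<tau>) * exp (L * \<tau>)"
          by (rule duhamel_gronwall[where \<Psi> = "\<Phi> k"])
            (use s k in \<open>auto simp: \<delta>_cont \<delta>V \<Phi>V \<Phi>_le L_nonneg intro!: \<delta>_int\<close>)
        also have "\<dots> \<le> B"
          unfolding B_def using \<delta>k0 by (intro mult_right_mono) auto
        finally show ?thesis .
      qed
      have "norm (\<delta> h t - \<delta> k t) \<le> (norm (\<delta> h 0 - \<delta> k 0) + L * \<omega> * B * \<tau>) * exp (L * \<tau>)"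
      proof (rule duhamel_gronwall[where D = "\<lambda>t. \<delta> h t - \<delta> k t" and \<Psi> = "\<lambda>s. \<Phi> h s - \<Phi> k s"])
        show "continuous_on {0..\<tau>} (\<lambda>t. \<delta> h t - \<delta> k t)"
          using h k by (intro continuous_intros \<delta>_cont)
        fix s assume s: "s \<in> {0..\<tau>}"
        show "\<delta> h s - \<delta> k s \<in> V" "\<Phi> h s - \<Phi> k s \<in> V"
          using h k s by (auto intro!: V_diff \<delta>V \<Phi>V)
        have "norm (\<Phi> h s - \<Phi> k s) \<le> L * norm (\<delta> h s - \<delta> k s) + L * norm (u (s + h) - u (s + k)) * norm (\<delta> k s)"
          unfolding \<Phi>_def \<delta>_def using s h k by (intro F_quotients u) auto
        also have "L * norm (u (s + h) - u (s + k)) * norm (\<delta> k s) \<le> L * \<omega> * B"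
        proof -
          have "dist (s + h) (s + k) < \<eta>2"
            using h k by (auto simp: \<eta>_def dist_real_def)
          then have "norm (u (s + h) - u (s + k)) \<le> \<omega>"
            using \<eta>2(2)[of "s + k" "s + h"] s h k by (simp add: \<eta>_def dist_norm)
          then show ?thesis
            using \<delta>k[OF s] L_nonneg B \<omega> by (intro mult_mono) auto
        qed
        finally show "norm (\<Phi> h s - \<Phi> k s) \<le> L * norm (\<delta> h s - \<delta> k s) + L * \<omega> * B"
          by simp
        have "((\<lambda>r. T (s - r) (\<Phi> h r) - T (s - r) (\<Phi> k r)) has_integral
            (\<delta> h s - T s (\<delta> h 0) - (\<delta> k s - T s (\<delta> k 0)))) {0..s}"
          using s h k by (intro has_integral_diff \<delta>_int) auto
        moreover have "T (s - r) (\<Phi> h r) - T (s - r) (\<Phi> k r) = T (s - r) (\<Phi> h r - \<Phi> k r)" if "r \<in> {0..s}" for r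
          using that h k by (simp add: T_diff \<Phi>V)
        moreover have "\<delta> h s - T s (\<delta> h 0) - (\<delta> k s - T s (\<delta> k 0)) = \<delta> h s - \<delta> k s - T s (\<delta> h 0 - \<delta> k 0)"
          using s h k by (simp add: T_diff \<delta>V)
        ultimately show "((\<lambda>r. T (s - r) (\<Phi> h r - \<Phi> k r)) has_integral
            (\<delta> h s - \<delta> k s - T s (\<delta> h 0 - \<delta> k 0))) {0..s}"
          by (metis (no_types, lifting) has_integral_eq)
      qed (use L_nonneg \<omega> B t in auto)
      also have "\<dots> \<le> (\<epsilon> / (2 * exp (L * \<tau>)) + \<epsilon> / (2 * exp (L * \<tau>))) * exp (L * \<tau>)"
      proof (intro mult_right_mono add_mono)
        have "\<delta> h 0 - \<delta> k 0 = (\<delta> h 0 - w0) - (\<delta> k 0 - w0)"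
          by simp
        also have "norm \<dots> \<le> norm (\<delta> h 0 - w0) + norm (\<delta> k 0 - w0)"
          by (rule norm_triangle_ineq4)
        also have "\<dots> \<le> \<epsilon> / (4 * exp (L * \<tau>)) + \<epsilon> / (4 * exp (L * \<tau>))"
          using \<eta>1(2)[of h] \<eta>1(2)[of k] h k by (intro add_mono) (auto simp: \<eta>_def)
        finally show "norm (\<delta> h 0 - \<delta> k 0) \<le> \<epsilon> / (2 * exp (L * \<tau>))"
          by simp
        have "L * \<omega> * B * \<tau> = \<omega> * (L * B * \<tau>)"
          by simp
        also have "\<dots> \<le> \<omega> * (L * B * \<tau> + 1)"
          using \<omega> by (intro mult_left_mono) auto
        also have "\<dots> = \<epsilon> / (2 * exp (L * \<tau>))"
        proof -
          have "\<epsilon> / (2 * E * X) * X = \<epsilon> / (2 * E)" if "0 < X" for E X :: real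
            using that by simp
          from this[OF LB] show ?thesis
            by (simp only: \<omega>_def)
        qed
        finally show "L * \<omega> * B * \<tau> \<le> \<epsilon> / (2 * exp (L * \<tau>))" .
      qed auto
      also have "\<dots> = \<epsilon>"
        by simp
      finally show ?thesis .
    qed
    then show ?thesis
      using \<eta>1(1) \<eta>2(1) by (intro exI[of _ \<eta>]) (auto simp: \<eta>_def)
  qed
  \<comment> \<open>The limit is taken along h = 1 / (n + 1); the uniform Cauchy estimate then
    extends the convergence to all small h.\<close>
  define w where "w t = lim (\<lambda>n. \<delta> (inverse (real (Suc n))) t)" for t
  have small: "\<forall>\<^sub>F n in sequentially. inverse (real (Suc n)) < \<eta>" if "0 < \<eta>" for \<eta>
    using LIMSEQ_inverse_real_of_nat that by (rule order_tendstoD)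
  have w: "(\<lambda>n. \<delta> (inverse (real (Suc n))) t) \<longlonglongrightarrow> w t" if t: "0 \<le> t" for t
  proof -
    have "Cauchy (\<lambda>n. \<delta> (inverse (real (Suc n))) t)"
    proof (rule CauchyI)
      fix \<epsilon> :: real assume "0 < \<epsilon>"
      then obtain \<eta> where "0 < \<eta>" and \<eta>: "\<And>h k. 0 < h \<Longrightarrow> h < \<eta> \<Longrightarrow> 0 < k \<Longrightarrow> k < \<eta> \<Longrightarrow> norm (\<delta> h t - \<delta> k t) \<le> \<epsilon> / 2"
        using cauchy[of "\<epsilon> / 2" t] t by auto
      from small[OF \<open>0 < \<eta>\<close>] obtain n0 where n0: "\<And>n. n \<ge> n0 \<Longrightarrow> inverse (real (Suc n)) < \<eta>"
        by (auto simp: eventually_sequentially)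
      show "\<exists>n0. \<forall>m\<ge>n0. \<forall>n\<ge>n0. norm (\<delta> (inverse (real (Suc m))) t - \<delta> (inverse (real (Suc n))) t) < \<epsilon>"
      proof (intro exI[of _ n0] allI impI)
        fix m n assume "n0 \<le> m" "n0 \<le> n"
        then have "norm (\<delta> (inverse (real (Suc m))) t - \<delta> (inverse (real (Suc n))) t) \<le> \<epsilon> / 2"
          by (intro \<eta> n0) simp_all
        then show "norm (\<delta> (inverse (real (Suc m))) t - \<delta> (inverse (real (Suc n))) t) < \<epsilon>"
          using \<open>0 < \<epsilon>\<close> by linarith
      qed
    qed
    then show ?thesis
      unfolding w_def by (simp add: Cauchy_convergent_iff convergent_LIMSEQ_iff)
  qed
  have unif: "\<exists>\<eta>>0. \<forall>h t. 0 < h \<longrightarrow> h < \<eta> \<longrightarrow> 0 \<le> t \<longrightarrow> t \<le> \<tau> \<longrightarrow> norm (\<delta> h t - w t) \<le> \<epsilon>"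
    if \<epsilon>: "0 < \<epsilon>" for \<epsilon> \<tau>
  proof (cases "0 \<le> \<tau>")
    case True
    obtain \<eta> where "0 < \<eta>" and \<eta>: "\<And>h k t. 0 < h \<Longrightarrow> h < \<eta> \<Longrightarrow> 0 < k \<Longrightarrow> k < \<eta> \<Longrightarrow> 0 \<le> t \<Longrightarrow> t \<le> \<tau> \<Longrightarrow>
        norm (\<delta> h t - \<delta> k t) \<le> \<epsilon>"
      using cauchy[OF \<epsilon> True] by blast
    have "norm (\<delta> h t - w t) \<le> \<epsilon>" if h: "0 < h" "h < \<eta>" "0 \<le> t" "t \<le> \<tau>" for h t
    proof (rule tendsto_upperbound)
      show "(\<lambda>n. norm (\<delta> h t - \<delta> (inverse (real (Suc n))) t)) \<longlonglongrightarrow> norm (\<delta> h t - w t)"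
        by (intro tendsto_intros w h)
      show "\<forall>\<^sub>F n in sequentially. norm (\<delta> h t - \<delta> (inverse (real (Suc n))) t) \<le> \<epsilon>"
        using small[OF \<open>0 < \<eta>\<close>] by eventually_elim (intro \<eta> h; simp)
    qed simp
    then show ?thesis
      using \<open>0 < \<eta>\<close> by blast
  qed (auto intro: exI[of _ 1])
  have w_cont: "continuous_on {0..} w"
    unfolding continuous_on_eq_continuous_within
  proof
    fix t :: real assume "t \<in> {0..}"
    \<comment> \<open>Continuity at t is a local matter, so locally uniform convergence of the
      continuous quotients suffices.\<close>
    have "uniform_limit {0..t + 1} \<delta> w (at_right 0)"
      unfolding uniform_limit_iff
    proof safe
      fix \<epsilon> :: real assume "0 < \<epsilon>"
      then obtain \<eta> where "0 < \<eta>" "\<And>h s. 0 < h \<Longrightarrow> h < \<eta> \<Longrightarrow> 0 \<le> s \<Longrightarrow> s \<le> t + 1 \<Longrightarrow> norm (\<delta> h s - w s) \<le> \<epsilon> / 2"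
        using unif[of "\<epsilon> / 2" "t + 1"] by auto
      with \<open>0 < \<epsilon>\<close> show "\<forall>\<^sub>F h in at_right 0. \<forall>s\<in>{0..t + 1}. dist (\<delta> h s) (w s) < \<epsilon>"
        by (fastforce simp: eventually_at_right_field dist_norm intro!: exI[of _ \<eta>])
    qed
    moreover have "\<forall>\<^sub>F h in at_right 0. continuous_on {0..t + 1} (\<delta> h)"
      by (rule eventually_mono[OF eventually_at_right_less]) (rule \<delta>_cont)
    ultimately have "continuous_on {0..t + 1} w"
      using uniform_limit_theorem trivial_limit_at_right_real by blast
    then have "continuous (at t within {0..t + 1}) w"
      using \<open>t \<in> {0..}\<close> by (simp add: continuous_on_eq_continuous_within)
    moreover have "at t within {0..t + 1} = at t within {0..}"
      by (rule at_within_nhd[where S = "{..<t + 1}"]) auto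
    ultimately show "continuous (at t within {0..}) w"
      by simp
  qed
  have "(u has_vector_derivative w t) (at t within {0..})" if "0 \<le> t" for t
    by (rule has_vector_derivative_if_uniform_right_quotients[OF w_cont unif[unfolded \<delta>_def] that])
  moreover have "generates (u t) (w t - F (u t))" if t: "0 \<le> t" for t
  proof -
    have \<delta>_lim: "((\<lambda>h. \<delta> h t) \<longlongrightarrow> w t) (at_right 0)"
    proof (rule tendstoI)
      fix \<epsilon> :: real assume "0 < \<epsilon>"
      then obtain \<eta> where "0 < \<eta>" "\<And>h. 0 < h \<Longrightarrow> h < \<eta> \<Longrightarrow> norm (\<delta> h t - w t) \<le> \<epsilon> / 2"
        using unif[of "\<epsilon> / 2" t] t by auto
      with \<open>0 < \<epsilon>\<close> show "\<forall>\<^sub>F h in at_right 0. dist (\<delta> h t) (w t) < \<epsilon>"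
        by (fastforce simp: eventually_at_right_field dist_norm intro!: exI[of _ \<eta>])
    qed
    \<comment> \<open>After a restart at time t the Duhamel average tends to F (u t). Subtracting it
      from the right quotient of u leaves exactly the generator quotient at u t.\<close>
    have "((\<lambda>h. (u (h + t) - T h (u t)) /\<^sub>R h) \<longlongrightarrow> F (u (0 + t))) (at_right 0)"
      using t by (intro duhamel_average_tendsto[of "\<lambda>s. F (u (s + t))"] restart FV
          continuous_on_compose2[OF F_cont] continuous_intros) auto
    with \<delta>_lim have "((\<lambda>h. \<delta> h t - (u (h + t) - T h (u t)) /\<^sub>R h) \<longlongrightarrow> w t - F (u (0 + t))) (at_right 0)"
      by (rule tendsto_diff)
    then show ?thesis
      by (simp add: generates_def \<delta>_def scaleR_diff_right[symmetric] add.commute)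
  qed
  ultimately show ?thesis
    using w_cont by blast
qed

end

section \<open>Exponential barriers\<close>

context mean_field_semigroup
begin

text \<open>The source is what remains of the time derivative of the profile after the generator is
  subtracted and the shift added. The profile then has the same Duhamel form as a Picard image, so
  comparing the two reduces to comparing sources and initial values.\<close>

lemma mild_exp_profile:
  assumes e: "e \<in> V" "generates e k"
  shows "mild c (\<lambda>s. (r * exp (\<sigma> * s)) *\<^sub>R ((c + \<sigma>) *\<^sub>R e - k)) (r *\<^sub>R e) (\<lambda>s. (r * exp (\<sigma> * s)) *\<^sub>R e)"
proof (rule mildI)
  fix s t :: real assume s: "0 \<le> s" "s \<le> t"
  have kV: "k \<in> V"
    by (rule generates_mem[OF e(2,1)])
  have der: "((\<lambda>s. (r * exp ((c + \<sigma>) * s)) *\<^sub>R T (t - s) e) has_vector_derivative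
      (r * exp ((c + \<sigma>) * s)) *\<^sub>R (- T (t - s) k) + (r * (exp ((c + \<sigma>) * s) * (c + \<sigma>))) *\<^sub>R T (t - s) e)
      (at s within {0..t})"
    by (rule has_vector_derivative_scaleR[OF _ reversed_orbit_has_vector_derivative[OF e s]])
      (auto intro!: derivative_eq_intros)
  have ex: "exp ((c + \<sigma>) * s) = exp (\<sigma> * s) * exp (c * s)" for s
    by (simp add: exp_add[symmetric] algebra_simps)
  have curve: "(r * exp ((c + \<sigma>) * s)) *\<^sub>R T (t - s) e = exp (c * s) *\<^sub>R T (t - s) ((r * exp (\<sigma> * s)) *\<^sub>R e)"
    if "s \<in> {0..t}" for s
    using that by (simp only: ex) (simp add: T_scale e mult_ac)
  have slope: "(r * exp ((c + \<sigma>) * s)) *\<^sub>R (- T (t - s) k) + (r * (exp ((c + \<sigma>) * s) * (c + \<sigma>))) *\<^sub>R T (t - s) e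
      = exp (c * s) *\<^sub>R T (t - s) ((r * exp (\<sigma> * s)) *\<^sub>R ((c + \<sigma>) *\<^sub>R e - k))"
    using s by (simp only: ex) (simp add: T_scale T_diff V_scale V_diff e kV scaleR_diff_right mult_ac)
  show "((\<lambda>s. exp (c * s) *\<^sub>R T (t - s) ((r * exp (\<sigma> * s)) *\<^sub>R e)) has_vector_derivative
      exp (c * s) *\<^sub>R T (t - s) ((r * exp (\<sigma> * s)) *\<^sub>R ((c + \<sigma>) *\<^sub>R e - k))) (at s within {0..t})"
    by (rule has_vector_derivative_transform[OF _ _ der[unfolded slope]]) (use s in \<open>auto simp: curve\<close>)
qed (simp_all add: e V_scale)

text \<open>The set of curves between the two exponential profiles is invariant under the Picard map, so the
  fixed point lies in it; no comparison argument for the solution itself is needed.\<close>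

lemma mild_between_profiles:
  assumes u: "continuous_on {0..} u" "\<And>t. 0 \<le> t \<Longrightarrow> u t \<in> P" "mild 0 (\<lambda>s. F (u s)) x u"
    and x: "x \<in> P" and e: "e \<in> Q" "generates e k"
    and lower: "\<And>v r. v \<in> P \<Longrightarrow> 0 \<le> r \<Longrightarrow> v - r *\<^sub>R e \<in> Q \<Longrightarrow>
      F v + c *\<^sub>R v - r *\<^sub>R ((c - M) *\<^sub>R e - k) \<in> Q"
    and upper: "\<And>v r. v \<in> P \<Longrightarrow> 0 \<le> r \<Longrightarrow> r *\<^sub>R e - v \<in> Q \<Longrightarrow>
      r *\<^sub>R ((c + M) *\<^sub>R e - k) - (F v + c *\<^sub>R v) \<in> Q"
    and ab: "0 \<le> a" "0 \<le> b" "x - a *\<^sub>R e \<in> Q" "b *\<^sub>R e - x \<in> Q" and M: "0 \<le> M" and t: "0 \<le> t"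
  shows "u t - (a * exp (- M * t)) *\<^sub>R e \<in> Q" "(b * exp (M * t)) *\<^sub>R e - u t \<in> Q"
proof -
  define A where "A t = {v \<in> P. v - (a * exp (- M * t)) *\<^sub>R e \<in> Q \<and> (b * exp (M * t)) *\<^sub>R e - v \<in> Q}" for t
  have eV: "e \<in> V"
    using e Q_sub by auto
  have "\<exists>v. continuous_on {0..} v \<and> (\<forall>t\<ge>0. v t \<in> A t) \<and> mild 0 (\<lambda>s. F (v s)) x v"
  proof (rule picard_iteration[where \<gamma> = "\<lambda>_. x"])
    fix t :: real assume t: "0 \<le> t"
    have "A t = P \<inter> ((\<lambda>v. v - (a * exp (- M * t)) *\<^sub>R e) -` Q \<inter> (\<lambda>v. (b * exp (M * t)) *\<^sub>R e - v) -` Q)"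
      by (auto simp: A_def)
    then show "closed (A t)"
      by (simp, intro closed_Int closed_P continuous_closed_vimage Q_closed continuous_intros)
    show "A t \<subseteq> P"
      by (auto simp: A_def)
    \<comment> \<open>The constant curve x is admissible: the lower barrier decreases from a and the
      upper one increases from b, so each differs from its initial position by a nonnegative
      multiple of e.\<close>
    have "x - (a * exp (- M * t)) *\<^sub>R e = (x - a *\<^sub>R e) + (a * (1 - exp (- M * t))) *\<^sub>R e"
      by (simp add: algebra_simps)
    moreover have "\<dots> \<in> Q"
      using ab M t e by (intro Q_add Q_scale) auto
    moreover have "(b * exp (M * t)) *\<^sub>R e - x = (b *\<^sub>R e - x) + (b * (exp (M * t) - 1)) *\<^sub>R e"
      by (simp add: algebra_simps)
    moreover have "\<dots> \<in> Q"
      using ab M t e by (intro Q_add Q_scale) auto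
    ultimately show "x \<in> A t"
      using x by (simp only: A_def mem_Collect_eq)
  next
    fix v :: "real \<Rightarrow> 'x" and t :: real
    assume v: "continuous_on {0..} v" and vA: "\<And>s. 0 \<le> s \<Longrightarrow> v s \<in> A s" and t: "0 \<le> t"
    have vP: "v s \<in> P" if "0 \<le> s" for s
      using vA[OF that] by (simp add: A_def)
    have pic: "((\<lambda>s. exp (c * s) *\<^sub>R T (t - s) (F (v s) + c *\<^sub>R v s)) has_integral
        (exp (c * t) *\<^sub>R picard x v t - T t x)) {0..t}"
      by (rule picard_has_integral[OF v vP t])
    have profile: "((\<lambda>s. exp (c * s) *\<^sub>R T (t - s) ((r * exp (\<sigma> * s)) *\<^sub>R ((c + \<sigma>) *\<^sub>R e - k))) has_integral
        (exp (c * t) *\<^sub>R ((r * exp (\<sigma> * t)) *\<^sub>R e) - T t (r *\<^sub>R e))) {0..t}" for r \<sigma>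
      using mild_exp_profile[OF eV e(2), of r \<sigma>] t unfolding mild_def by blast
    have kV: "k \<in> V"
      by (rule generates_mem[OF e(2) eV])
    have V: "F (v s) + c *\<^sub>R v s \<in> V" "r *\<^sub>R ((c + \<sigma>) *\<^sub>R e - k) \<in> V" if "0 \<le> s" for s r \<sigma>
      using vP[OF that] eV kV by (auto intro!: V_add V_scale V_diff F_mem simp: P_V)
    \<comment> \<open>Subtracting two Duhamel formulas leaves T t applied to the initial difference
      z; as \<open>T\<close> preserves the cone, adding this back and rescaling keeps
      membership.\<close>
    have unscale: "y \<in> Q" if "exp (c * t) *\<^sub>R y - T t z \<in> Q" "z \<in> Q" for y z
    proof -
      have "exp (- c * t) *\<^sub>R ((exp (c * t) *\<^sub>R y - T t z) + T t z) \<in> Q"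
        using that t by (intro Q_scale Q_add T_Q) auto
      then show ?thesis
        by (simp add: exp_minus)
    qed
    \<comment> \<open>Both terms are Duhamel integrals with the same propagator, so their difference
      lies in the cone as soon as the difference of the sources does. The lower barrier is the
      profile with rate - M.\<close>
    have "exp (c * t) *\<^sub>R picard x v t - T t x -
        (exp (c * t) *\<^sub>R ((a * exp (- M * t)) *\<^sub>R e) - T t (a *\<^sub>R e)) \<in> Q"
    proof (rule has_integral_in_Q[OF has_integral_diff[OF pic profile]])
      fix s assume s: "s \<in> {0..t}"
      have "T (t - s) (F (v s) + c *\<^sub>R v s - (a * exp (- M * s)) *\<^sub>R ((c + - M) *\<^sub>R e - k)) \<in> Q"
        using lower[of "v s" "a * exp (- M * s)"] vA[of s] s ab by (intro T_Q) (auto simp: A_def)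
      from Q_scale[OF exp_ge_zero this, of "c * s"]
      show "exp (c * s) *\<^sub>R T (t - s) (F (v s) + c *\<^sub>R v s) - exp (c * s) *\<^sub>R T (t - s) ((a * exp (- M * s)) *\<^sub>R ((c + - M) *\<^sub>R e - k)) \<in> Q"
        using T_diff[OF _ V(1)[of s] V(2)[of s "a * exp (- M * s)" "- M"], of "t - s"] s by (simp add: scaleR_diff_right[of "exp (c * s)"])
    qed
    moreover have "exp (c * t) *\<^sub>R picard x v t - T t x - (exp (c * t) *\<^sub>R ((a * exp (- M * t)) *\<^sub>R e) - T t (a *\<^sub>R e))
        = exp (c * t) *\<^sub>R (picard x v t - (a * exp (- M * t)) *\<^sub>R e) - T t (x - a *\<^sub>R e)"
      using t x eV by (simp add: T_diff V_scale P_V scaleR_diff_right del: scaleR_scaleR)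
    ultimately have "picard x v t - (a * exp (- M * t)) *\<^sub>R e \<in> Q"
      using ab unscale by metis
    moreover have "exp (c * t) *\<^sub>R ((b * exp (M * t)) *\<^sub>R e) - T t (b *\<^sub>R e) -
        (exp (c * t) *\<^sub>R picard x v t - T t x) \<in> Q"
    proof (rule has_integral_in_Q[OF has_integral_diff[OF profile pic]])
      fix s assume s: "s \<in> {0..t}"
      have "T (t - s) ((b * exp (M * s)) *\<^sub>R ((c + M) *\<^sub>R e - k) - (F (v s) + c *\<^sub>R v s)) \<in> Q"
        using upper[of "v s" "b * exp (M * s)"] vA[of s] s ab by (intro T_Q) (auto simp: A_def)
      from Q_scale[OF exp_ge_zero this, of "c * s"]
      show "exp (c * s) *\<^sub>R T (t - s) ((b * exp (M * s)) *\<^sub>R ((c + M) *\<^sub>R e - k)) - exp (c * s) *\<^sub>R T (t - s) (F (v s) + c *\<^sub>R v s) \<in> Q"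
        using T_diff[OF _ V(2)[of s "b * exp (M * s)" M] V(1)[of s], of "t - s"] s by (simp add: scaleR_diff_right[of "exp (c * s)"])
    qed
    moreover have "exp (c * t) *\<^sub>R ((b * exp (M * t)) *\<^sub>R e) - T t (b *\<^sub>R e) - (exp (c * t) *\<^sub>R picard x v t - T t x)
        = exp (c * t) *\<^sub>R ((b * exp (M * t)) *\<^sub>R e - picard x v t) - T t (b *\<^sub>R e - x)"
      using t x eV by (simp add: T_diff V_scale P_V scaleR_diff_right del: scaleR_scaleR)
    ultimately show "picard x v t \<in> A t"
      using ab unscale picard_in_P[OF v vP x t] unfolding A_def by (metis (no_types, lifting) mem_Collect_eq)
  qed (use x in auto)
  then obtain v where v: "continuous_on {0..} v" "\<And>t. 0 \<le> t \<Longrightarrow> v t \<in> A t" "mild 0 (\<lambda>s. F (v s)) x v"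
    by blast
  \<comment> \<open>Uniqueness identifies the constrained fixed point with the given
    solution.\<close>
  have "u t = v t"
    using v by (intro mild_unique[OF u _ _ _ t]) (auto simp: A_def)
  then show "u t - (a * exp (- M * t)) *\<^sub>R e \<in> Q" "(b * exp (M * t)) *\<^sub>R e - u t \<in> Q"
    using v(2)[OF t] by (auto simp: A_def)
qed

end

section \<open>Embedding L1 into a Banach space type\<close>

lemma L1_norm_nonneg [simp]: "0 \<le> L1_norm \<nu> f"
  by (simp add: L1_norm_def)

lemma L1_norm_cong_AE:
  "integrable \<nu> f \<Longrightarrow> integrable \<nu> g \<Longrightarrow> AE x in \<nu>. f x = g x \<Longrightarrow> L1_norm \<nu> f = L1_norm \<nu> g"
  unfolding L1_norm_def by (intro integral_cong_AE) auto

lemma ennreal_L1_norm: "integrable \<nu> f \<Longrightarrow> ennreal (L1_norm \<nu> f) = (\<integral>\<^sup>+x. ennreal \<bar>f x\<bar> \<partial>\<nu>)"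
  unfolding L1_norm_def by (subst nn_integral_eq_integral) auto

lemma L1_norm_eq_0_iff: "integrable \<nu> f \<Longrightarrow> L1_norm \<nu> f = 0 \<longleftrightarrow> (AE x in \<nu>. f x = 0)"
  unfolding L1_norm_def by (subst integral_nonneg_eq_0_iff_AE) auto

text \<open>An almost everywhere convergent subsequence supplies the limit function. Fatou along
  this subsequence, with the index n held fixed, bounds the distance from s n to the limit.\<close>

lemma L1_complete:
  assumes s: "\<And>n. integrable \<nu> (s n)"
    and cauchy: "\<And>\<epsilon>. 0 < \<epsilon> \<Longrightarrow> \<exists>N. \<forall>i\<ge>N. \<forall>j\<ge>N. L1_norm \<nu> (\<lambda>x. s i x - s j x) < \<epsilon>"
  shows "\<exists>f. integrable \<nu> f \<and> (\<lambda>n. L1_norm \<nu> (\<lambda>x. s n x - f x)) \<longlonglongrightarrow> 0"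
proof -
  note [measurable] = borel_measurable_integrable[OF s]
  obtain r where r: "strict_mono r" "AE x in \<nu>. Cauchy (\<lambda>i. s (r i) x)"
    by (rule cauchy_L1_AE_cauchy_subseq[of \<nu> s]) (use s cauchy in \<open>auto simp: L1_norm_def\<close>)
  define f where "f x = lim (\<lambda>i. s (r i) x)" for x
  have f [measurable]: "f \<in> borel_measurable \<nu>"
    unfolding f_def by (intro borel_measurable_lim_metric) simp
  have lim: "AE x in \<nu>. (\<lambda>i. s (r i) x) \<longlonglongrightarrow> f x"
    using r(2) by eventually_elim (simp add: f_def Cauchy_convergent_iff convergent_LIMSEQ_iff)
  have close: "\<exists>N. \<forall>n\<ge>N. (\<integral>\<^sup>+x. ennreal \<bar>s n x - f x\<bar> \<partial>\<nu>) \<le> ennreal \<epsilon>" if \<epsilon>: "0 < \<epsilon>" for \<epsilon>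
  proof -
    obtain N where N: "\<And>i j. N \<le> i \<Longrightarrow> N \<le> j \<Longrightarrow> L1_norm \<nu> (\<lambda>x. s i x - s j x) < \<epsilon>"
      using cauchy[OF \<epsilon>] by blast
    have "(\<integral>\<^sup>+x. ennreal \<bar>s n x - f x\<bar> \<partial>\<nu>) \<le> ennreal \<epsilon>" if n: "N \<le> n" for n
    proof -
      have "(\<integral>\<^sup>+x. ennreal \<bar>s n x - f x\<bar> \<partial>\<nu>) = (\<integral>\<^sup>+x. liminf (\<lambda>i. ennreal \<bar>s n x - s (r i) x\<bar>) \<partial>\<nu>)"
      proof (rule nn_integral_cong_AE)
        show "AE x in \<nu>. ennreal \<bar>s n x - f x\<bar> = liminf (\<lambda>i. ennreal \<bar>s n x - s (r i) x\<bar>)"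
          using lim
        proof eventually_elim
          case (elim x)
          then have "(\<lambda>i. ennreal \<bar>s n x - s (r i) x\<bar>) \<longlonglongrightarrow> ennreal \<bar>s n x - f x\<bar>"
            by (intro tendsto_intros)
          then show ?case
            using lim_imp_Liminf[OF sequentially_bot] by metis
        qed
      qed
      also have "\<dots> \<le> liminf (\<lambda>i. \<integral>\<^sup>+x. ennreal \<bar>s n x - s (r i) x\<bar> \<partial>\<nu>)"
        by (rule nn_integral_liminf) simp
      also have "\<dots> \<le> limsup (\<lambda>i. \<integral>\<^sup>+x. ennreal \<bar>s n x - s (r i) x\<bar> \<partial>\<nu>)"
        by (rule Liminf_le_Limsup) simp
      also have "\<dots> \<le> ennreal \<epsilon>"
      proof (rule Limsup_bounded)
        have "N \<le> r i" if "N \<le> i" for i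
          using that seq_suble[OF r(1), of i] by linarith
        then show "\<forall>\<^sub>F i in sequentially. (\<integral>\<^sup>+x. ennreal \<bar>s n x - s (r i) x\<bar> \<partial>\<nu>) \<le> ennreal \<epsilon>"
          using n N[THEN less_imp_le] s
          by (auto simp: ennreal_L1_norm[symmetric] eventually_sequentially intro!: exI[of _ N] ennreal_leI)
      qed
      finally show ?thesis .
    qed
    then show ?thesis by blast
  qed
  \<comment> \<open>The limit is integrable because it is at finite distance from one integrable
    member of the sequence.\<close>
  obtain N where "(\<integral>\<^sup>+x. ennreal \<bar>s N x - f x\<bar> \<partial>\<nu>) \<le> ennreal 1"
    using close[of 1] by auto
  then have "integrable \<nu> (\<lambda>x. s N x - f x)"
    by (intro integrableI_bounded) (auto simp: le_less_trans)
  from Bochner_Integration.integrable_diff[OF s[of N] this] have int: "integrable \<nu> f"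
    by simp
  moreover have "(\<lambda>n. L1_norm \<nu> (\<lambda>x. s n x - f x)) \<longlonglongrightarrow> 0"
  proof (rule LIMSEQ_I)
    fix \<epsilon> :: real assume \<epsilon>: "0 < \<epsilon>"
    then obtain N where "\<And>n. N \<le> n \<Longrightarrow> (\<integral>\<^sup>+x. ennreal \<bar>s n x - f x\<bar> \<partial>\<nu>) \<le> ennreal (\<epsilon> / 2)"
      using close[of "\<epsilon> / 2"] by auto
    then have "L1_norm \<nu> (\<lambda>x. s n x - f x) \<le> \<epsilon> / 2" if "N \<le> n" for n
      using that \<epsilon> s int by (simp add: ennreal_L1_norm[symmetric])
    then show "\<exists>N. \<forall>n\<ge>N. norm (L1_norm \<nu> (\<lambda>x. s n x - f x) - 0) < \<epsilon>"
      using \<epsilon> by (intro exI[of _ N]) fastforce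
  qed
  ultimately show ?thesis by blast
qed

instance bcontfun :: (metric_space, banach) banach ..

text \<open>The space of integrable functions modulo null sets depends on the measure, hence is not a type. It embeds
  isometrically into the bounded functions on the set of all test functions, carrying the discrete
  topology.\<close>

definition test_functions :: "'a measure \<Rightarrow> ('a \<Rightarrow> real) set" where
  "test_functions \<nu> = {\<phi> \<in> borel_measurable \<nu>. \<forall>x. \<bar>\<phi> x\<bar> \<le> 1}"

text \<open>A function is represented by its integrals against all test functions; their supremum is
  the L1 norm, so exactly the null functions become 0. The value 0 at arguments that are not test
  functions keeps the image bounded.\<close>

definition L1_embed :: "'a measure \<Rightarrow> ('a \<Rightarrow> real) \<Rightarrow> ('a \<Rightarrow> real) discrete \<Rightarrow>\<^sub>C real" where
  "L1_embed \<nu> f = Bcontfun (\<lambda>d. if of_discrete d \<in> test_functions \<nu> then \<integral>x. of_discrete d x * f x \<partial>\<nu> else 0)"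

definition L1_space :: "'a measure \<Rightarrow> (('a \<Rightarrow> real) discrete \<Rightarrow>\<^sub>C real) set" where
  "L1_space \<nu> = L1_embed \<nu> ` {f. integrable \<nu> f}"

definition L1_rep :: "'a measure \<Rightarrow> (('a \<Rightarrow> real) discrete \<Rightarrow>\<^sub>C real) \<Rightarrow> 'a \<Rightarrow> real" where
  "L1_rep \<nu> v = (SOME f. integrable \<nu> f \<and> L1_embed \<nu> f = v)"

lemma integrable_test_mult:
  assumes "\<phi> \<in> test_functions \<nu>" "integrable \<nu> f"
  shows "integrable \<nu> (\<lambda>x. \<phi> x * f x)"
proof (rule Bochner_Integration.integrable_bound[OF assms(2)])
  show "(\<lambda>x. \<phi> x * f x) \<in> borel_measurable \<nu>"
    using assms by (auto simp: test_functions_def)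
  show "AE x in \<nu>. norm (\<phi> x * f x) \<le> norm (f x)"
    using assms(1) by (auto simp: test_functions_def abs_mult mult_left_le_one_le)
qed

lemma abs_test_integral_le:
  assumes "\<phi> \<in> test_functions \<nu>" "integrable \<nu> f"
  shows "\<bar>\<integral>x. \<phi> x * f x \<partial>\<nu>\<bar> \<le> L1_norm \<nu> f"
proof -
  have "\<bar>\<integral>x. \<phi> x * f x \<partial>\<nu>\<bar> \<le> (\<integral>x. \<bar>\<phi> x * f x\<bar> \<partial>\<nu>)"
    using integral_norm_bound[of \<nu> "\<lambda>x. \<phi> x * f x"] by simp
  also have "\<dots> \<le> L1_norm \<nu> f"
    unfolding L1_norm_def
  proof (rule integral_mono)
    show "\<bar>\<phi> x * f x\<bar> \<le> \<bar>f x\<bar>" for x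
      using assms(1) by (simp add: test_functions_def abs_mult mult_left_le_one_le)
  qed (intro integrable_abs integrable_test_mult assms)+
  finally show ?thesis .
qed

lemma continuous_on_discrete: "continuous_on A (f :: 'a discrete \<Rightarrow> 'b::topological_space)"
  unfolding continuous_on_open_invariant by (metis open_discrete)

lemma apply_L1_embed:
  assumes "integrable \<nu> f"
  shows "apply_bcontfun (L1_embed \<nu> f) d =
    (if of_discrete d \<in> test_functions \<nu> then \<integral>x. of_discrete d x * f x \<partial>\<nu> else 0)"
  unfolding L1_embed_def
  by (subst Bcontfun_inverse, rule bcontfun_normI[where b = "L1_norm \<nu> f"])
    (auto simp: continuous_on_discrete abs_test_integral_le assms)

lemma apply_L1_embed_test:
  "integrable \<nu> f \<Longrightarrow> \<phi> \<in> test_functions \<nu> \<Longrightarrow> apply_bcontfun (L1_embed \<nu> f) (discrete \<phi>) = (\<integral>x. \<phi> x * f x \<partial>\<nu>)"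
  by (simp add: apply_L1_embed discrete_inverse)

lemma L1_embed_add:
  "integrable \<nu> f \<Longrightarrow> integrable \<nu> g \<Longrightarrow> L1_embed \<nu> (\<lambda>x. f x + g x) = L1_embed \<nu> f + L1_embed \<nu> g"
  by (rule bcontfun_eqI) (simp add: apply_L1_embed integrable_test_mult distrib_left)

lemma L1_embed_diff:
  "integrable \<nu> f \<Longrightarrow> integrable \<nu> g \<Longrightarrow> L1_embed \<nu> (\<lambda>x. f x - g x) = L1_embed \<nu> f - L1_embed \<nu> g"
  by (rule bcontfun_eqI) (simp add: apply_L1_embed integrable_test_mult right_diff_distrib)

lemma L1_embed_scale:
  "integrable \<nu> f \<Longrightarrow> L1_embed \<nu> (\<lambda>x. r * f x) = r *\<^sub>R L1_embed \<nu> f"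
  by (rule bcontfun_eqI) (simp add: apply_L1_embed mult.left_commute)

lemma L1_embed_zero: "L1_embed \<nu> (\<lambda>x. 0) = 0"
  by (rule bcontfun_eqI) (simp add: apply_L1_embed)

lemma L1_embed_sum:
  "(\<And>i. i \<in> A \<Longrightarrow> integrable \<nu> (f i)) \<Longrightarrow> L1_embed \<nu> (\<lambda>x. \<Sum>i\<in>A. f i x) = (\<Sum>i\<in>A. L1_embed \<nu> (f i))"
  by (induction A rule: infinite_finite_induct) (simp_all add: L1_embed_zero L1_embed_add)

text \<open>The supremum over test functions is attained at the sign of f.\<close>

lemma norm_L1_embed:
  assumes "integrable \<nu> f"
  shows "norm (L1_embed \<nu> f) = L1_norm \<nu> f"
proof (rule antisym)
  show "norm (L1_embed \<nu> f) \<le> L1_norm \<nu> f"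
    by (rule norm_bound) (auto simp: apply_L1_embed assms abs_test_integral_le)
  have sgn: "(\<lambda>x. sgn (f x)) \<in> test_functions \<nu>"
    using assms by (auto simp: test_functions_def sgn_if)
  have "L1_norm \<nu> f = (\<integral>x. sgn (f x) * f x \<partial>\<nu>)"
    unfolding L1_norm_def by (simp add: abs_sgn mult.commute)
  also have "\<dots> = apply_bcontfun (L1_embed \<nu> f) (discrete (\<lambda>x. sgn (f x)))"
    by (simp add: apply_L1_embed_test assms sgn)
  also have "\<dots> \<le> norm (L1_embed \<nu> f)"
    using norm_bounded[of "L1_embed \<nu> f"] by (metis abs_le_D1 real_norm_def)
  finally show "L1_norm \<nu> f \<le> norm (L1_embed \<nu> f)" .
qed

lemma L1_embed_eq_iff:
  assumes "integrable \<nu> f" "integrable \<nu> g"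
  shows "L1_embed \<nu> f = L1_embed \<nu> g \<longleftrightarrow> (AE x in \<nu>. f x = g x)"
proof -
  have "L1_embed \<nu> f = L1_embed \<nu> g \<longleftrightarrow> norm (L1_embed \<nu> (\<lambda>x. f x - g x)) = 0"
    by (simp add: L1_embed_diff assms)
  also have "\<dots> \<longleftrightarrow> (AE x in \<nu>. f x = g x)"
    using assms by (subst norm_L1_embed) (simp_all add: L1_norm_eq_0_iff)
  finally show ?thesis .
qed

lemma L1_embed_cong:
  "integrable \<nu> f \<Longrightarrow> integrable \<nu> g \<Longrightarrow> AE x in \<nu>. f x = g x \<Longrightarrow> L1_embed \<nu> f = L1_embed \<nu> g"
  by (simp add: L1_embed_eq_iff)

lemma norm_L1_embed_diff:
  "integrable \<nu> f \<Longrightarrow> integrable \<nu> g \<Longrightarrow> norm (L1_embed \<nu> f - L1_embed \<nu> g) = L1_norm \<nu> (\<lambda>x. f x - g x)"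
  by (subst L1_embed_diff[symmetric]) (simp_all add: norm_L1_embed)

lemma L1_embed_mem [simp]: "integrable \<nu> f \<Longrightarrow> L1_embed \<nu> f \<in> L1_space \<nu>"
  by (simp add: L1_space_def)

lemma L1_rep:
  assumes "v \<in> L1_space \<nu>"
  shows "integrable \<nu> (L1_rep \<nu> v)" "L1_embed \<nu> (L1_rep \<nu> v) = v"
proof -
  have "\<exists>f. integrable \<nu> f \<and> L1_embed \<nu> f = v"
    using assms by (auto simp: L1_space_def)
  from someI_ex[OF this] show "integrable \<nu> (L1_rep \<nu> v)" "L1_embed \<nu> (L1_rep \<nu> v) = v"
    by (simp_all add: L1_rep_def)
qed

lemma L1_rep_embed:
  "integrable \<nu> f \<Longrightarrow> AE x in \<nu>. L1_rep \<nu> (L1_embed \<nu> f) x = f x"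
  using L1_rep[OF L1_embed_mem] L1_embed_eq_iff by blast

lemma subspace_L1_space: "subspace (L1_space \<nu>)"
proof (rule subspaceI)
  show "0 \<in> L1_space \<nu>"
    using L1_embed_mem[of \<nu> "\<lambda>x. 0"] by (simp add: L1_embed_zero)
  fix v w assume "v \<in> L1_space \<nu>" "w \<in> L1_space \<nu>"
  then show "v + w \<in> L1_space \<nu>"
    unfolding L1_space_def by (auto simp: L1_embed_add[symmetric])
next
  fix r v assume "v \<in> L1_space \<nu>"
  then show "r *\<^sub>R v \<in> L1_space \<nu>"
    unfolding L1_space_def by (auto simp: L1_embed_scale[symmetric])
qed

text \<open>An isometric image of a complete space is closed; \<open>L1_complete\<close> is applied
  to representatives of the sequence.\<close>

lemma closed_L1_space: "closed (L1_space \<nu>)"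
  unfolding closed_sequential_limits
proof safe
  fix v l assume v: "\<forall>n. v n \<in> L1_space \<nu>" and lim: "v \<longlonglongrightarrow> l"
  define s where "s n = L1_rep \<nu> (v n)" for n
  have s: "integrable \<nu> (s n)" and vs: "v n = L1_embed \<nu> (s n)" for n
    using v by (simp_all add: s_def L1_rep)
  have "Cauchy v"
    using lim by (rule LIMSEQ_imp_Cauchy)
  have "\<exists>N. \<forall>i\<ge>N. \<forall>j\<ge>N. L1_norm \<nu> (\<lambda>x. s i x - s j x) < \<epsilon>" if "0 < \<epsilon>" for \<epsilon>
    using CauchyD[OF \<open>Cauchy v\<close> that] by (simp add: vs norm_L1_embed_diff s)
  from L1_complete[of \<nu> s, OF s this]
  obtain f where f: "integrable \<nu> f" "(\<lambda>n. L1_norm \<nu> (\<lambda>x. s n x - f x)) \<longlonglongrightarrow> 0"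
    by blast
  then have "(\<lambda>n. norm (v n - L1_embed \<nu> f)) \<longlonglongrightarrow> 0"
    by (simp add: vs norm_L1_embed_diff s)
  then have "v \<longlonglongrightarrow> L1_embed \<nu> f"
    by (simp add: tendsto_norm_zero_iff LIM_zero_iff)
  then show "l \<in> L1_space \<nu>"
    using LIMSEQ_unique[OF lim] f(1) by (metis L1_embed_mem)
qed

lemma L1_tendsto_iff:
  assumes "\<forall>\<^sub>F i in F. integrable \<nu> (f i)" "integrable \<nu> g"
  shows "L1_tendsto \<nu> f g F \<longleftrightarrow> ((\<lambda>i. L1_embed \<nu> (f i)) \<longlongrightarrow> L1_embed \<nu> g) F"
proof -
  have "((\<lambda>i. L1_embed \<nu> (f i)) \<longlongrightarrow> L1_embed \<nu> g) F
      \<longleftrightarrow> ((\<lambda>i. norm (L1_embed \<nu> (f i) - L1_embed \<nu> g)) \<longlongrightarrow> 0) F"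
    by (simp add: tendsto_norm_zero_iff LIM_zero_iff)
  also have "\<dots> \<longleftrightarrow> L1_tendsto \<nu> f g F"
    unfolding L1_tendsto_def
    by (rule tendsto_cong, use assms(1) in eventually_elim) (simp add: norm_L1_embed_diff assms(2))
  finally show ?thesis by simp
qed

lemma L1_continuous_on_iff:
  assumes "\<And>t. t \<in> A \<Longrightarrow> integrable \<nu> (f t)"
  shows "L1_continuous_on \<nu> A f \<longleftrightarrow> continuous_on A (\<lambda>t. L1_embed \<nu> (f t))"
proof -
  have "\<forall>\<^sub>F s in at t within A. integrable \<nu> (f s)" for t
    using assms by (auto simp: eventually_at_filter)
  then show ?thesis
    unfolding L1_continuous_on_def continuous_on_def using assms by (simp add: L1_tendsto_iff)
qed

text \<open>The embedding is linear and isometric, so it carries Riemann sums to Riemann sums and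
  their L1 limit to a norm limit.\<close>

lemma has_L1_integral_iff:
  assumes f: "\<And>s. s \<in> {a..b} \<Longrightarrow> integrable \<nu> (f s)"
  shows "has_L1_integral \<nu> f I a b \<longleftrightarrow>
    integrable \<nu> I \<and> ((\<lambda>s. L1_embed \<nu> (f s)) has_integral L1_embed \<nu> I) {a..b}"
proof -
  let ?F = "division_filter {a..b}"
  let ?R = "\<lambda>p x. \<Sum>(s, J)\<in>p. measure lborel J * f s x"
  \<comment> \<open>Integrability of \<open>f s\<close> is known for s in the interval only, so the
    tags are first confined to it.\<close>
  have tags: "\<forall>\<^sub>F p in ?F. \<forall>(s, J)\<in>p. s \<in> {a..b}"
    using eventually_division_filter_tagged_division[of "{a..b}"]
    by eventually_elim (auto dest: tag_in_interval)
  have R: "\<forall>\<^sub>F p in ?F. integrable \<nu> (?R p)"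
    using tags by eventually_elim (auto intro!: Bochner_Integration.integrable_sum integrable_mult_right f split: prod.splits)
  have eq: "\<forall>\<^sub>F p in ?F. L1_embed \<nu> (?R p) = (\<Sum>(s, J)\<in>p. measure lborel J *\<^sub>R L1_embed \<nu> (f s))"
    using tags
  proof eventually_elim
    case (elim p)
    have "L1_embed \<nu> (\<lambda>x. \<Sum>z\<in>p. measure lborel (snd z) * f (fst z) x)
        = (\<Sum>z\<in>p. measure lborel (snd z) *\<^sub>R L1_embed \<nu> (f (fst z)))"
      using elim by (subst L1_embed_sum) (auto intro!: sum.cong L1_embed_scale f split: prod.splits)
    then show ?case
      by (simp add: case_prod_beta)
  qed
  have "L1_tendsto \<nu> ?R I ?F \<longleftrightarrow> ((\<lambda>s. L1_embed \<nu> (f s)) has_integral L1_embed \<nu> I) {a..b}"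
    if I: "integrable \<nu> I"
  proof -
    have "L1_tendsto \<nu> ?R I ?F \<longleftrightarrow> ((\<lambda>p. L1_embed \<nu> (?R p)) \<longlongrightarrow> L1_embed \<nu> I) ?F"
      by (rule L1_tendsto_iff[OF R I])
    also have "\<dots> \<longleftrightarrow> ((\<lambda>p. \<Sum>(s, J)\<in>p. measure lborel J *\<^sub>R L1_embed \<nu> (f s)) \<longlongrightarrow> L1_embed \<nu> I) ?F"
      by (rule tendsto_cong[OF eq])
    also have "\<dots> \<longleftrightarrow> ((\<lambda>s. L1_embed \<nu> (f s)) has_integral L1_embed \<nu> I) {a..b}"
      using has_integral_cbox[of "\<lambda>s. L1_embed \<nu> (f s)" "L1_embed \<nu> I" a b] by simp
    finally show ?thesis .
  qed
  then show ?thesis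
    unfolding has_L1_integral_def using f by auto
qed

section \<open>Positive cone, mass and Markov semigroups in the embedded space\<close>

definition L1_cone :: "'a measure \<Rightarrow> (('a \<Rightarrow> real) discrete \<Rightarrow>\<^sub>C real) set" where
  "L1_cone \<nu> = L1_embed \<nu> ` {f. integrable \<nu> f \<and> (AE x in \<nu>. 0 \<le> f x)}"

text \<open>The integral, written as evaluation at the constant test function 1: in this form it is
  bounded and linear on the whole ambient space and not only on the image of L1.\<close>

definition L1_mass :: "(('a \<Rightarrow> real) discrete \<Rightarrow>\<^sub>C real) \<Rightarrow> real" where
  "L1_mass v = apply_bcontfun v (discrete (\<lambda>_. 1))"

lemma L1_mass_embed: "integrable \<nu> f \<Longrightarrow> L1_mass (L1_embed \<nu> f) = (\<integral>x. f x \<partial>\<nu>)"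
  by (simp add: L1_mass_def apply_L1_embed_test test_functions_def)

lemma L1_embed_in_cone_iff:
  assumes "integrable \<nu> f"
  shows "L1_embed \<nu> f \<in> L1_cone \<nu> \<longleftrightarrow> (AE x in \<nu>. 0 \<le> f x)"
proof
  assume "L1_embed \<nu> f \<in> L1_cone \<nu>"
  then obtain g where "integrable \<nu> g" "AE x in \<nu>. 0 \<le> g x" "L1_embed \<nu> f = L1_embed \<nu> g"
    by (auto simp: L1_cone_def)
  moreover from this have "AE x in \<nu>. f x = g x"
    using assms by (simp add: L1_embed_eq_iff)
  ultimately show "AE x in \<nu>. 0 \<le> f x"
    by auto
qed (use assms in \<open>auto simp: L1_cone_def\<close>)

lemma L1_cone_sub: "L1_cone \<nu> \<subseteq> L1_space \<nu>"
  by (auto simp: L1_cone_def)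

text \<open>Linear inequalities survive limits, and this description yields closedness of the cone.
  For the inclusion from right to left the test function is the indicator of the set where f is
  negative.\<close>

lemma L1_cone_eq:
  "L1_cone \<nu> = L1_space \<nu> \<inter> {v. \<forall>\<phi>\<in>test_functions \<nu>. (\<forall>x. 0 \<le> \<phi> x) \<longrightarrow> 0 \<le> apply_bcontfun v (discrete \<phi>)}"
proof (intro equalityI subsetI)
  fix v assume "v \<in> L1_cone \<nu>"
  then obtain f where f: "integrable \<nu> f" "AE x in \<nu>. 0 \<le> f x" "v = L1_embed \<nu> f"
    by (auto simp: L1_cone_def)
  then show "v \<in> L1_space \<nu> \<inter> {v. \<forall>\<phi>\<in>test_functions \<nu>. (\<forall>x. 0 \<le> \<phi> x) \<longrightarrow> 0 \<le> apply_bcontfun v (discrete \<phi>)}"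
    by (auto simp: apply_L1_embed_test intro!: integral_nonneg_AE)
next
  fix v assume v: "v \<in> L1_space \<nu> \<inter> {v. \<forall>\<phi>\<in>test_functions \<nu>. (\<forall>x. 0 \<le> \<phi> x) \<longrightarrow> 0 \<le> apply_bcontfun v (discrete \<phi>)}"
  then obtain f where f: "integrable \<nu> f" "v = L1_embed \<nu> f"
    by (auto simp: L1_space_def)
  define \<phi> where "\<phi> = (\<lambda>x. if f x < 0 then 1 else 0 :: real)"
  have \<phi>: "\<phi> \<in> test_functions \<nu>"
    using f(1) by (auto simp: test_functions_def \<phi>_def)
  have "0 \<le> (\<integral>x. \<phi> x * f x \<partial>\<nu>)"
    using v \<phi> f by (auto simp: apply_L1_embed_test \<phi>_def)
  have int: "integrable \<nu> (\<lambda>x. - (\<phi> x * f x))"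
    by (intro Bochner_Integration.integrable_minus integrable_test_mult \<phi> f(1))
  have nonpos: "0 \<le> - (\<phi> x * f x)" for x
    by (simp add: \<phi>_def)
  have "(\<integral>x. - (\<phi> x * f x) \<partial>\<nu>) = 0"
  proof (rule antisym)
    show "0 \<le> (\<integral>x. - (\<phi> x * f x) \<partial>\<nu>)"
      by (rule Bochner_Integration.integral_nonneg) (rule nonpos)
  qed (use \<open>0 \<le> (\<integral>x. \<phi> x * f x \<partial>\<nu>)\<close> in simp)
  then have "AE x in \<nu>. - (\<phi> x * f x) = 0"
    using integral_nonneg_eq_0_iff_AE[OF int] nonpos by simp
  then have "AE x in \<nu>. 0 \<le> f x"
    by eventually_elim (auto simp: \<phi>_def split: if_splits)
  then show "v \<in> L1_cone \<nu>"
    using f by (auto simp: L1_cone_def)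
qed

lemma closed_L1_cone: "closed (L1_cone \<nu>)"
proof -
  have eq: "{v. \<forall>\<phi>\<in>test_functions \<nu>. (\<forall>x. 0 \<le> \<phi> x) \<longrightarrow> 0 \<le> apply_bcontfun v (discrete \<phi>)}
      = (\<Inter>\<phi>\<in>{\<phi>\<in>test_functions \<nu>. \<forall>x. 0 \<le> \<phi> x}. (\<lambda>v. apply_bcontfun v (discrete \<phi>)) -` {0..})"
    by auto
  have "closed ((\<lambda>v. apply_bcontfun v (discrete \<phi>)) -` {0::real..})" for \<phi> :: "'a \<Rightarrow> real"
    by (rule continuous_closed_vimage[OF _ linear_continuous_at[OF bounded_linear_apply_bcontfun]]) simp
  then show ?thesis
    unfolding L1_cone_eq eq by (intro closed_Int closed_L1_space closed_INT ballI)
qed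

text \<open>The difference of f and g has norm 0, so boundedness forces its image to vanish almost
  everywhere, and linearity separates the two terms. This is what allows an operator on functions to
  descend to classes.\<close>

lemma L1_bounded_linear_cong:
  assumes T: "L1_bounded_linear \<nu> T" and fg: "integrable \<nu> f" "integrable \<nu> g" "AE x in \<nu>. f x = g x"
  shows "AE x in \<nu>. T f x = T g x"
proof -
  define d where "d x = f x + - 1 * g x" for x
  have d: "integrable \<nu> d"
    unfolding d_def by (intro Bochner_Integration.integrable_add integrable_mult_right fg)
  have "L1_norm \<nu> d = 0"
    using fg by (subst L1_norm_eq_0_iff[OF d]) (auto simp: d_def)
  moreover obtain C where "L1_norm \<nu> (T d) \<le> C * L1_norm \<nu> d"
    using T d by (auto simp: L1_bounded_linear_def)
  ultimately have "L1_norm \<nu> (T d) = 0"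
    by (simp add: antisym)
  moreover have "integrable \<nu> (T d)"
    using T d by (simp add: L1_bounded_linear_def)
  ultimately have "AE x in \<nu>. T d x = 0"
    by (simp add: L1_norm_eq_0_iff)
  moreover have "AE x in \<nu>. T d x = T f x + T (\<lambda>x. - 1 * g x) x"
    using T fg unfolding d_def L1_bounded_linear_def by (metis integrable_mult_right)
  moreover have "AE x in \<nu>. T (\<lambda>x. - 1 * g x) x = - 1 * T g x"
    using T fg unfolding L1_bounded_linear_def by blast
  ultimately show ?thesis
    by eventually_elim simp
qed

locale adjoint_Markov =
  fixes \<nu> :: "'a measure" and S :: "real \<Rightarrow> ('a \<Rightarrow> real) \<Rightarrow> 'a \<Rightarrow> real"
  assumes S: "adjoint_Markov_semigroup \<nu> S"
begin

lemma S_linear: "0 \<le> t \<Longrightarrow> L1_bounded_linear \<nu> (S t)"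
  using S by (simp add: adjoint_Markov_semigroup_def L1_C0_semigroup_def)

lemma S_integrable [simp]: "0 \<le> t \<Longrightarrow> integrable \<nu> f \<Longrightarrow> integrable \<nu> (S t f)"
  using S_linear by (simp add: L1_bounded_linear_def)

lemma S_add: "0 \<le> t \<Longrightarrow> integrable \<nu> f \<Longrightarrow> integrable \<nu> g \<Longrightarrow> AE x in \<nu>. S t (\<lambda>x. f x + g x) x = S t f x + S t g x"
  using S_linear unfolding L1_bounded_linear_def by blast

lemma S_scale: "0 \<le> t \<Longrightarrow> integrable \<nu> f \<Longrightarrow> AE x in \<nu>. S t (\<lambda>x. r * f x) x = r * S t f x"
  using S_linear unfolding L1_bounded_linear_def by blast

lemma S_nonneg: "0 \<le> t \<Longrightarrow> integrable \<nu> f \<Longrightarrow> AE x in \<nu>. 0 \<le> f x \<Longrightarrow> AE x in \<nu>. 0 \<le> S t f x"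
  using S unfolding adjoint_Markov_semigroup_def by blast

lemma S_mass: "0 \<le> t \<Longrightarrow> integrable \<nu> f \<Longrightarrow> (\<integral>x. S t f x \<partial>\<nu>) = (\<integral>x. f x \<partial>\<nu>)"
  using S unfolding adjoint_Markov_semigroup_def by blast

text \<open>The C0 property supplies bounded operators only. Contractivity comes from positivity,
  which gives \<bar>S t f\<bar> \<le> S t \<bar>f\<bar> almost everywhere, and from conservation of
  mass.\<close>

lemma S_contraction:
  assumes t: "0 \<le> t" and f: "integrable \<nu> f"
  shows "L1_norm \<nu> (S t f) \<le> L1_norm \<nu> f"
proof -
  have int: "integrable \<nu> (\<lambda>x. \<bar>f x\<bar>)" "integrable \<nu> (\<lambda>x. - 1 * f x)"
    using f by auto
  have "AE x in \<nu>. 0 \<le> S t (\<lambda>x. \<bar>f x\<bar> + f x) x"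
    by (rule S_nonneg[OF t]) (use f in auto)
  moreover have "AE x in \<nu>. 0 \<le> S t (\<lambda>x. \<bar>f x\<bar> + - 1 * f x) x"
    by (rule S_nonneg[OF t]) (use f in auto)
  ultimately have "AE x in \<nu>. \<bar>S t f x\<bar> \<le> S t (\<lambda>x. \<bar>f x\<bar>) x"
    using S_add[OF t int(1) f] S_add[OF t int] S_scale[OF t f, of "- 1"]
    by eventually_elim auto
  then have "L1_norm \<nu> (S t f) \<le> (\<integral>x. S t (\<lambda>x. \<bar>f x\<bar>) x \<partial>\<nu>)"
    unfolding L1_norm_def using f t by (intro integral_mono_AE) auto
  also have "\<dots> = L1_norm \<nu> f"
    using S_mass[OF t int(1)] by (simp add: L1_norm_def)
  finally show ?thesis .
qed

text \<open>The operator is transported through a chosen representative; \<open>T_embed\<close>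
  shows that the choice does not matter.\<close>

definition T :: "real \<Rightarrow> (('a \<Rightarrow> real) discrete \<Rightarrow>\<^sub>C real) \<Rightarrow> (('a \<Rightarrow> real) discrete \<Rightarrow>\<^sub>C real)" where
  "T t v = L1_embed \<nu> (S t (L1_rep \<nu> v))"

lemma T_embed: "0 \<le> t \<Longrightarrow> integrable \<nu> f \<Longrightarrow> T t (L1_embed \<nu> f) = L1_embed \<nu> (S t f)"
  unfolding T_def
  by (intro L1_embed_cong L1_bounded_linear_cong[OF S_linear] L1_rep_embed S_integrable L1_rep L1_embed_mem)

sublocale markov_semigroup_on "L1_space \<nu>" T "L1_cone \<nu>" L1_mass
proof -
  interpret mass: bounded_linear "L1_mass :: (('a \<Rightarrow> real) discrete \<Rightarrow>\<^sub>C real) \<Rightarrow> real"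
    unfolding L1_mass_def[abs_def] by (rule bounded_linear_apply_bcontfun)
  show "markov_semigroup_on (L1_space \<nu>) T (L1_cone \<nu>) L1_mass"
  proof
    show "subspace (L1_space \<nu>)" "closed (L1_space \<nu>)"
      by (fact subspace_L1_space closed_L1_space)+
    show "L1_cone \<nu> \<subseteq> L1_space \<nu>" "closed (L1_cone \<nu>)"
      by (fact L1_cone_sub closed_L1_cone)+
    show "0 \<in> L1_cone \<nu>"
      using L1_embed_in_cone_iff[of \<nu> "\<lambda>_. 0"] by (simp add: L1_embed_zero)
  next
    fix t :: real and v assume t: "0 \<le> t" and "v \<in> L1_space \<nu>"
    then obtain f where f: "integrable \<nu> f" "v = L1_embed \<nu> f"
      by (auto simp: L1_space_def)
    show "T t v \<in> L1_space \<nu>" "L1_mass (T t v) = L1_mass v" "norm (T t v) \<le> norm v"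
      using f t by (auto simp: T_embed L1_mass_embed S_mass norm_L1_embed S_contraction)
    show "T t (r *\<^sub>R v) = r *\<^sub>R T t v" for r
      using f t S_scale[OF t f(1), of r]
      by (auto simp: T_embed L1_embed_scale[symmetric] intro!: L1_embed_cong)
  next
    fix t :: real and v w assume t: "0 \<le> t" and "v \<in> L1_space \<nu>" "w \<in> L1_space \<nu>"
    then obtain f g where "integrable \<nu> f" "v = L1_embed \<nu> f" "integrable \<nu> g" "w = L1_embed \<nu> g"
      by (auto simp: L1_space_def)
    then show "T t (v + w) = T t v + T t w"
      using t S_add[OF t, of f g]
      by (auto simp: T_embed L1_embed_add[symmetric] intro!: L1_embed_cong)
  next
    fix v assume "v \<in> L1_space \<nu>"
    then obtain f where f: "integrable \<nu> f" "v = L1_embed \<nu> f"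
      by (auto simp: L1_space_def)
    have "AE x in \<nu>. S 0 f x = f x" and lim: "L1_tendsto \<nu> (\<lambda>t. S t f) f (at_right 0)"
      using S f(1) by (auto simp: adjoint_Markov_semigroup_def L1_C0_semigroup_def)
    then show "T 0 v = v"
      using f by (auto simp: T_embed intro!: L1_embed_cong)
    have pos: "\<forall>\<^sub>F t in at_right (0::real). 0 < t"
      by (rule eventually_at_right_less)
    have "((\<lambda>t. L1_embed \<nu> (S t f)) \<longlongrightarrow> L1_embed \<nu> f) (at_right 0)"
      using lim L1_tendsto_iff[of \<nu> "\<lambda>t. S t f" "at_right 0" f] eventually_mono[OF pos, of "\<lambda>t. integrable \<nu> (S t f)"] f
      by simp
    moreover have "\<forall>\<^sub>F t in at_right 0. L1_embed \<nu> (S t f) = T t v"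
      using pos by eventually_elim (simp add: f T_embed)
    ultimately show "((\<lambda>h. T h v) \<longlongrightarrow> v) (at_right 0)"
      unfolding f(2) by (rule Lim_transform_eventually)
  next
    fix s t :: real and v assume st: "0 \<le> s" "0 \<le> t" and "v \<in> L1_space \<nu>"
    then obtain f where f: "integrable \<nu> f" "v = L1_embed \<nu> f"
      by (auto simp: L1_space_def)
    have "AE x in \<nu>. S (s + t) f x = S s (S t f) x"
      using S f(1) st unfolding adjoint_Markov_semigroup_def L1_C0_semigroup_def by blast
    then show "T s (T t v) = T (s + t) v"
      using f st by (auto simp: T_embed intro!: L1_embed_cong)
  next
    fix v assume "v \<in> L1_cone \<nu>"
    then obtain f where f: "integrable \<nu> f" "AE x in \<nu>. 0 \<le> f x" "v = L1_embed \<nu> f"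
      by (auto simp: L1_cone_def)
    show "norm v = L1_mass v"
      using f by (auto simp: norm_L1_embed L1_mass_embed L1_norm_def intro!: integral_cong_AE)
    show "r *\<^sub>R v \<in> L1_cone \<nu>" if "0 \<le> r" for r
      using f that by (auto simp: L1_embed_scale[symmetric] L1_embed_in_cone_iff)
    show "T t v \<in> L1_cone \<nu>" if "0 \<le> t" for t
      using f that by (auto simp: T_embed L1_embed_in_cone_iff S_nonneg)
  next
    fix v w assume "v \<in> L1_cone \<nu>" "w \<in> L1_cone \<nu>"
    then obtain f g where "integrable \<nu> f" "AE x in \<nu>. 0 \<le> f x" "v = L1_embed \<nu> f"
      "integrable \<nu> g" "AE x in \<nu>. 0 \<le> g x" "w = L1_embed \<nu> g"
      by (auto simp: L1_cone_def)
    then show "v + w \<in> L1_cone \<nu>"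
      by (auto simp: L1_embed_add[symmetric] L1_embed_in_cone_iff)
  qed
qed

lemma P_eq: "P = L1_embed \<nu> ` prob_densities \<nu>"
  unfolding P_def by (auto simp: prob_densities_def L1_cone_def L1_mass_embed)

lemma L1_embed_in_P: "integrable \<nu> \<rho> \<Longrightarrow> L1_embed \<nu> \<rho> \<in> P \<longleftrightarrow> \<rho> \<in> prob_densities \<nu>"
  by (simp add: P_def prob_densities_def L1_embed_in_cone_iff L1_mass_embed)

lemma generates_embed_iff:
  assumes "integrable \<nu> f" "integrable \<nu> g"
  shows "generates (L1_embed \<nu> f) (L1_embed \<nu> g) \<longleftrightarrow> L1_tendsto \<nu> (\<lambda>h x. (S h f x - f x) / h) g (at_right 0)"
proof -
  have pos: "\<forall>\<^sub>F h in at_right (0::real). 0 < h"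
    by (rule eventually_at_right_less)
  have "L1_tendsto \<nu> (\<lambda>h x. (S h f x - f x) / h) g (at_right 0)
      \<longleftrightarrow> ((\<lambda>h. L1_embed \<nu> (\<lambda>x. (S h f x - f x) / h)) \<longlongrightarrow> L1_embed \<nu> g) (at_right 0)"
    using assms by (intro L1_tendsto_iff eventually_mono[OF pos]) auto
  also have "\<dots> \<longleftrightarrow> generates (L1_embed \<nu> f) (L1_embed \<nu> g)"
    unfolding generates_def
  proof (rule tendsto_cong, use pos in eventually_elim)
    case (elim h)
    then show ?case
      using assms L1_embed_scale[of \<nu> "\<lambda>x. S h f x - f x" "inverse h"]
      by (simp add: T_embed L1_embed_diff divide_inverse mult.commute)
  qed
  finally show ?thesis by simp
qed

end

section \<open>Jump kernels\<close>

text \<open>A kernel is given by measurability of the mass of each fixed set; general integrands are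
  reached by the monotone class argument. Finiteness of the measures links \<open>emeasure\<close>
  with the real-valued masses.\<close>

lemma kernel_nn_integral_measurable:
  assumes k: "\<And>p. p \<in> space N \<Longrightarrow> finite_measure (k p)" "\<And>p. p \<in> space N \<Longrightarrow> sets (k p) = sets B"
    and meas: "\<And>A. A \<in> sets B \<Longrightarrow> (\<lambda>p. measure (k p) A) \<in> borel_measurable N"
    and g: "g \<in> borel_measurable B"
  shows "(\<lambda>p. \<integral>\<^sup>+z. g z \<partial>k p) \<in> borel_measurable N"
proof -
  have mk: "f \<in> borel_measurable (k p)" if "f \<in> borel_measurable B" "p \<in> space N" for f :: "'b \<Rightarrow> ennreal" and p
    using that(1) measurable_cong_sets[OF k(2)[OF that(2)] refl] by auto
  show ?thesis
    using g
  proof (induction rule: borel_measurable_induct)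
    case (cong f g)
    moreover have "(\<integral>\<^sup>+z. f z \<partial>k p) = (\<integral>\<^sup>+z. g z \<partial>k p)" if "p \<in> space N" for p
      using cong sets_eq_imp_space_eq[OF k(2)[OF that]] by (intro nn_integral_cong) auto
    ultimately show ?case
      by (simp cong: measurable_cong)
  next
    case (set A)
    have "(\<integral>\<^sup>+z. indicator A z \<partial>k p) = ennreal (measure (k p) A)" if "p \<in> space N" for p
    proof -
      interpret finite_measure "k p"
        by (rule k(1)[OF that])
      show ?thesis
        using set k(2)[OF that] by (simp add: emeasure_eq_measure)
    qed
    then show ?case
      using meas[OF set] by (simp cong: measurable_cong)
  next
    case (mult u c)
    then have "(\<integral>\<^sup>+z. c * u z \<partial>k p) = c * (\<integral>\<^sup>+z. u z \<partial>k p)" if "p \<in> space N" for p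
      using that by (intro nn_integral_cmult mk)
    then show ?case
      using mult by (simp cong: measurable_cong)
  next
    case (add u v)
    then have "(\<integral>\<^sup>+z. v z + u z \<partial>k p) = (\<integral>\<^sup>+z. v z \<partial>k p) + (\<integral>\<^sup>+z. u z \<partial>k p)" if "p \<in> space N" for p
      using that by (intro nn_integral_add mk)
    then show ?case
      using add by (simp cong: measurable_cong)
  next
    case (seq U)
    then have "(\<integral>\<^sup>+z. (SUP i. U i) z \<partial>k p) = (SUP i. \<integral>\<^sup>+z. U i z \<partial>k p)" if "p \<in> space N" for p
      unfolding SUP_apply using that by (intro nn_integral_monotone_convergence_SUP mk)
    then show ?case
      using seq by (simp cong: measurable_cong)
  qed
qed

lemma kernel_integral_measurable:
  fixes g :: "'b \<Rightarrow> real"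
  assumes k: "\<And>p. p \<in> space N \<Longrightarrow> finite_measure (k p)" "\<And>p. p \<in> space N \<Longrightarrow> sets (k p) = sets B"
    and meas: "\<And>A. A \<in> sets B \<Longrightarrow> (\<lambda>p. measure (k p) A) \<in> borel_measurable N"
    and g: "g \<in> borel_measurable B"
  shows "(\<lambda>p. \<integral>z. g z \<partial>k p) \<in> borel_measurable N"
proof -
  note g [measurable]
  note nn = kernel_nn_integral_measurable[OF k meas]
  have [measurable]: "(\<lambda>p. \<integral>\<^sup>+z. ennreal (g z) \<partial>k p) \<in> borel_measurable N"
    by (rule nn) simp_all
  have [measurable]: "(\<lambda>p. \<integral>\<^sup>+z. ennreal (- g z) \<partial>k p) \<in> borel_measurable N"
    by (rule nn) simp_all
  have [measurable]: "(\<lambda>p. \<integral>\<^sup>+z. ennreal \<bar>g z\<bar> \<partial>k p) \<in> borel_measurable N"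
    by (rule nn) simp_all
  \<comment> \<open>The Bochner integral takes the default value 0 where the absolute integral is
    infinite, so it is expressed by cases on a measurable finiteness condition.\<close>
  have "(\<integral>z. g z \<partial>k p) = (if (\<integral>\<^sup>+z. ennreal \<bar>g z\<bar> \<partial>k p) < \<infinity>
      then enn2real (\<integral>\<^sup>+z. ennreal (g z) \<partial>k p) - enn2real (\<integral>\<^sup>+z. ennreal (- g z) \<partial>k p) else 0)"
    if p: "p \<in> space N" for p
  proof -
    have "g \<in> borel_measurable (k p)"
      using g by (simp add: measurable_cong_sets[OF k(2)[OF p] refl])
    then show ?thesis
      by (auto simp: real_lebesgue_integral_def integrable_iff_bounded not_integrable_integral_eq)
  qed
  then show ?thesis
    by (simp cong: measurable_cong)
qed

text \<open>\<open>k y\<close> and \<open>ks y\<close> stand for the kernel and its adjoint at the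
  empirical measure of the n particles y. \<open>M\<close> bounds the forward kernel alone; every L1
  estimate of the gain term is routed through \<open>adjoint\<close>.\<close>

locale mean_field_kernel =
  fixes \<nu> :: "'a::polish_space measure" and n :: nat
    and k ks :: "(nat \<Rightarrow> 'a) \<Rightarrow> 'a \<Rightarrow> 'a measure" and M :: real
  assumes finite_\<nu>: "finite_measure \<nu>" and sets_\<nu> [measurable_cong]: "sets \<nu> = sets borel"
    and k: "finite_measure (k y x)" "sets (k y x) = sets borel"
    and k_meas: "A \<in> sets borel \<Longrightarrow>
      (\<lambda>(y, x). measure (k y x) A) \<in> borel_measurable (Pi\<^sub>M {..<n} (\<lambda>_. borel) \<Otimes>\<^sub>M borel)"
    and k_le: "measure (k y x) UNIV \<le> M"
    and ks: "finite_measure (ks y x)" "sets (ks y x) = sets borel"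
    and ks_meas: "A \<in> sets borel \<Longrightarrow>
      (\<lambda>(y, x). measure (ks y x) A) \<in> borel_measurable (Pi\<^sub>M {..<n} (\<lambda>_. borel) \<Otimes>\<^sub>M borel)"
    and adjoint: "C \<in> sets (borel \<Otimes>\<^sub>M borel) \<Longrightarrow>
      (\<integral>\<^sup>+x. emeasure (k y x) {z. (x, z) \<in> C} \<partial>\<nu>) = (\<integral>\<^sup>+z. emeasure (ks y z) {x. (x, z) \<in> C} \<partial>\<nu>)"
begin

definition W :: "(nat \<Rightarrow> 'a) measure" where "W = Pi\<^sub>M {..<n} (\<lambda>_. \<nu>)"

definition gen :: "(nat \<Rightarrow> 'a) \<Rightarrow> ('a \<Rightarrow> real) \<Rightarrow> 'a \<Rightarrow> real" where
  "gen y \<rho> x = adjoint_jump_generator (k y) (ks y) \<rho> x"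

text \<open>The weight \<open>\<sigma>\<close> on configurations is decoupled from the density
  \<open>\<rho>\<close> that is acted on. The mean-field term is the value at the product density of
  \<open>\<rho>\<close>, so its nonlinearity splits into a bilinear map and a tensor power.\<close>

definition bilin :: "('a \<Rightarrow> real) \<Rightarrow> ((nat \<Rightarrow> 'a) \<Rightarrow> real) \<Rightarrow> 'a \<Rightarrow> real" where
  "bilin \<rho> \<sigma> x = (\<integral>y. \<sigma> y * gen y \<rho> x \<partial>W)"

sublocale \<nu>: finite_measure \<nu>
  by (rule finite_\<nu>)

sublocale product_sigma_finite "\<lambda>_::nat. \<nu>"
  by standard

sublocale W: sigma_finite_measure W
  unfolding W_def by (rule sigma_finite) simp

sublocale W\<nu>: pair_sigma_finite W \<nu>
  by standard

lemma space_\<nu> [simp]: "space \<nu> = UNIV"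
  using sets_eq_imp_space_eq[OF sets_\<nu>] by simp

lemma sets_W [measurable_cong]: "sets W = sets (Pi\<^sub>M {..<n} (\<lambda>_. borel))"
  unfolding W_def by (intro sets_PiM_cong) (auto simp: sets_\<nu>)

lemma M_nonneg: "0 \<le> M"
  using k_le[of undefined undefined] measure_nonneg order_trans by blast

lemma space_k [simp]: "space (k y x) = UNIV" "space (ks y x) = UNIV"
  using sets_eq_imp_space_eq[OF k(2)] sets_eq_imp_space_eq[OF ks(2)] by auto

lemma sets_W\<nu>: "sets (W \<Otimes>\<^sub>M \<nu>) = sets (Pi\<^sub>M {..<n} (\<lambda>_. borel) \<Otimes>\<^sub>M borel)"
  by (intro sets_pair_measure_cong sets_W sets_\<nu>)

lemma borel_measurable_\<nu>: "f \<in> borel_measurable \<nu> \<longleftrightarrow> f \<in> borel_measurable borel"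
  by (simp add: measurable_cong_sets[OF sets_\<nu> refl])

lemma measurable_gen [measurable]:
  assumes [measurable]: "\<rho> \<in> borel_measurable borel"
  shows "(\<lambda>(y, x). gen y \<rho> x) \<in> borel_measurable (W \<Otimes>\<^sub>M \<nu>)"
proof -
  have "(\<lambda>p. \<integral>z. \<rho> z \<partial>ks (fst p) (snd p)) \<in> borel_measurable (W \<Otimes>\<^sub>M \<nu>)"
    by (rule kernel_integral_measurable[where B = borel])
      (use ks ks_meas in \<open>auto simp: measurable_cong_sets[OF sets_W\<nu> refl] case_prod_beta\<close>)
  moreover have "(\<lambda>p. measure (k (fst p) (snd p)) UNIV) \<in> borel_measurable (W \<Otimes>\<^sub>M \<nu>)"
    using k_meas[of UNIV] by (simp add: measurable_cong_sets[OF sets_W\<nu> refl] case_prod_beta)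
  ultimately show ?thesis
    unfolding gen_def adjoint_jump_generator_def case_prod_beta by measurable
qed

lemma measurable_gen_1: "\<rho> \<in> borel_measurable borel \<Longrightarrow> y \<in> space W \<Longrightarrow> gen y \<rho> \<in> borel_measurable \<nu>"
  using measurable_Pair2[OF measurable_gen, of \<rho> y] by simp

lemma measurable_gen_2: "\<rho> \<in> borel_measurable borel \<Longrightarrow> (\<lambda>y. gen y \<rho> x) \<in> borel_measurable W"
  using measurable_Pair1[OF measurable_gen, of \<rho> x] by simp

lemma emeasure_k: "emeasure (k y x) A = ennreal (measure (k y x) A)"
proof -
  interpret finite_measure "k y x" by (rule k(1))
  show ?thesis by (rule emeasure_eq_measure)
qed

lemma measurable_k_1: "y \<in> space W \<Longrightarrow> (\<lambda>x. measure (k y x) UNIV) \<in> borel_measurable \<nu>"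
proof -
  have "(\<lambda>(y, x). measure (k y x) UNIV) \<in> borel_measurable (W \<Otimes>\<^sub>M \<nu>)"
    using k_meas[of UNIV] by (simp add: measurable_cong_sets[OF sets_W\<nu> refl])
  then show "y \<in> space W \<Longrightarrow> ?thesis"
    using measurable_Pair2[of "\<lambda>(y, x). measure (k y x) UNIV" W \<nu> borel y] by simp
qed

lemma measurable_ks_nn_1:
  assumes "g \<in> borel_measurable borel" "y \<in> space W"
  shows "(\<lambda>x. \<integral>\<^sup>+z. g z \<partial>ks y x) \<in> borel_measurable \<nu>"
proof (rule kernel_nn_integral_measurable[where B = borel])
  fix A :: "'a set" assume "A \<in> sets borel"
  then have "(\<lambda>(y, x). measure (ks y x) A) \<in> borel_measurable (W \<Otimes>\<^sub>M \<nu>)"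
    using ks_meas[of A] by (simp add: measurable_cong_sets[OF sets_W\<nu> refl])
  then show "(\<lambda>x. measure (ks y x) A) \<in> borel_measurable \<nu>"
    using measurable_Pair2[of "\<lambda>(y, x). measure (ks y x) A" W \<nu> borel y] assms(2) by simp
qed (use ks assms in auto)

text \<open>For an indicator this is the adjoint relation at the rectangle A \<times> UNIV; monotone
  classes do the rest. It converts gain into loss, where the bound \<open>M\<close> is
  available.\<close>

lemma adjoint_nn_integral:
  assumes g: "g \<in> borel_measurable borel" and y: "y \<in> space W"
  shows "(\<integral>\<^sup>+x. (\<integral>\<^sup>+z. g z \<partial>ks y x) \<partial>\<nu>) = (\<integral>\<^sup>+x. g x * emeasure (k y x) UNIV \<partial>\<nu>)"
proof -
  have [measurable]: "(\<lambda>x. emeasure (k y x) UNIV) \<in> borel_measurable \<nu>"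
    using measurable_k_1[OF y] unfolding emeasure_k by measurable
  have mks: "f \<in> borel_measurable (ks y x)" if "f \<in> borel_measurable borel" for f :: "'a \<Rightarrow> ennreal" and x
    using that measurable_cong_sets[OF ks(2) refl] by auto
  show ?thesis
    using g
  proof (induction rule: borel_measurable_induct)
    case (cong f g)
    then show ?case
      by (simp add: fun_eq_iff cong: nn_integral_cong)
  next
    case (set A)
    have "A \<times> UNIV \<in> sets (borel \<Otimes>\<^sub>M (borel :: 'a measure))"
      using set by (intro pair_measureI) auto
    from adjoint[OF this, of y] have
      "(\<integral>\<^sup>+x. emeasure (ks y x) A \<partial>\<nu>) = (\<integral>\<^sup>+x. emeasure (k y x) {z. x \<in> A} \<partial>\<nu>)"
      by simp
    also have "\<dots> = (\<integral>\<^sup>+x. indicator A x * emeasure (k y x) UNIV \<partial>\<nu>)"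
      by (intro nn_integral_cong) (auto simp: indicator_def)
    finally show ?case
      using set ks(2) by simp
  next
    case (mult u c)
    moreover from this have "(\<lambda>x. \<integral>\<^sup>+z. u z \<partial>ks y x) \<in> borel_measurable \<nu>"
      by (intro measurable_ks_nn_1 y)
    ultimately show ?case
      by (simp add: nn_integral_cmult mks mult.assoc borel_measurable_\<nu>)
  next
    case (add u v)
    moreover have "(\<lambda>x. \<integral>\<^sup>+z. u z \<partial>ks y x) \<in> borel_measurable \<nu>"
      by (rule measurable_ks_nn_1[OF add(1) y])
    moreover have "(\<lambda>x. \<integral>\<^sup>+z. v z \<partial>ks y x) \<in> borel_measurable \<nu>"
      by (rule measurable_ks_nn_1[OF add(3) y])
    ultimately show ?case
      by (simp add: nn_integral_add mks distrib_right borel_measurable_\<nu>)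
  next
    case (seq U)
    have inc: "incseq (\<lambda>i x. \<integral>\<^sup>+z. U i z \<partial>ks y x)" "incseq (\<lambda>i x. U i x * emeasure (k y x) UNIV)"
      using seq(3) by (auto simp: incseq_def le_fun_def intro!: nn_integral_mono mult_right_mono)
    have "(\<integral>\<^sup>+x. (\<integral>\<^sup>+z. (SUP i. U i) z \<partial>ks y x) \<partial>\<nu>) = (\<integral>\<^sup>+x. (SUP i. \<integral>\<^sup>+z. U i z \<partial>ks y x) \<partial>\<nu>)"
      unfolding SUP_apply using seq by (intro nn_integral_cong nn_integral_monotone_convergence_SUP mks)
    also have "\<dots> = (SUP i. \<integral>\<^sup>+x. (\<integral>\<^sup>+z. U i z \<partial>ks y x) \<partial>\<nu>)"
      using seq by (intro nn_integral_monotone_convergence_SUP inc measurable_ks_nn_1 y)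
    also have "\<dots> = (SUP i. \<integral>\<^sup>+x. U i x * emeasure (k y x) UNIV \<partial>\<nu>)"
      using seq by simp
    also have "\<dots> = (\<integral>\<^sup>+x. (SUP i. U i x * emeasure (k y x) UNIV) \<partial>\<nu>)"
      using seq by (intro nn_integral_monotone_convergence_SUP[symmetric] inc) (auto simp: borel_measurable_\<nu>[symmetric])
    also have "\<dots> = (\<integral>\<^sup>+x. (SUP i. U i) x * emeasure (k y x) UNIV \<partial>\<nu>)"
      unfolding SUP_apply by (simp add: SUP_mult_right_ennreal)
    finally show ?case .
  qed
qed

text \<open>The integral of \<open>\<rho>\<close> against \<open>ks y x\<close> may diverge at
  individual points x; the adjoint relation makes the set of these points null. There the Bochner
  integral has the default value 0, which is why additivity of \<open>gen\<close> in
  \<open>\<rho>\<close> is stated almost everywhere.\<close>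

lemma AE_integrable_ks:
  fixes \<rho> :: "'a \<Rightarrow> real"
  assumes \<rho>: "integrable \<nu> \<rho>" and y: "y \<in> space W"
  shows "AE x in \<nu>. integrable (ks y x) \<rho>"
proof -
  have [measurable]: "\<rho> \<in> borel_measurable borel"
    using \<rho> by (simp add: borel_measurable_\<nu>[symmetric])
  have "(\<integral>\<^sup>+x. (\<integral>\<^sup>+z. ennreal \<bar>\<rho> z\<bar> \<partial>ks y x) \<partial>\<nu>) = (\<integral>\<^sup>+x. ennreal \<bar>\<rho> x\<bar> * emeasure (k y x) UNIV \<partial>\<nu>)"
    by (rule adjoint_nn_integral[OF _ y]) measurable
  also have "\<dots> \<le> (\<integral>\<^sup>+x. ennreal \<bar>\<rho> x\<bar> * ennreal M \<partial>\<nu>)"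
    by (intro nn_integral_mono mult_left_mono) (auto simp: emeasure_k k_le ennreal_leI)
  also have "\<dots> = ennreal (L1_norm \<nu> \<rho>) * ennreal M"
    using \<rho> by (subst nn_integral_multc) (auto simp: ennreal_L1_norm)
  also have "\<dots> < \<infinity>"
    by (simp add: ennreal_mult_less_top)
  finally have "AE x in \<nu>. (\<integral>\<^sup>+z. ennreal \<bar>\<rho> z\<bar> \<partial>ks y x) \<noteq> \<infinity>"
    by (intro nn_integral_PInf_AE measurable_ks_nn_1 y) auto
  then show ?thesis
  proof eventually_elim
    case (elim x)
    have "\<rho> \<in> borel_measurable (ks y x)"
      by (simp add: measurable_cong_sets[OF ks(2) refl])
    with elim show ?case
      by (simp add: integrable_iff_bounded less_top)
  qed
qed

text \<open>Gain and loss contribute M times the norm each, the gain by way of the adjoint relation;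
  hence the factor 2.\<close>

lemma gen_nn_norm:
  assumes \<rho>: "integrable \<nu> \<rho>" and y: "y \<in> space W"
  shows "(\<integral>\<^sup>+x. ennreal \<bar>gen y \<rho> x\<bar> \<partial>\<nu>) \<le> ennreal (2 * M * L1_norm \<nu> \<rho>)"
proof -
  have [measurable]: "\<rho> \<in> borel_measurable borel"
    using \<rho> by (simp add: borel_measurable_\<nu>[symmetric])
  have [measurable]: "(\<lambda>x. measure (k y x) UNIV) \<in> borel_measurable \<nu>"
    by (rule measurable_k_1[OF y])
  have [measurable]: "(\<lambda>x. \<integral>\<^sup>+z. ennreal \<bar>\<rho> z\<bar> \<partial>ks y x) \<in> borel_measurable \<nu>"
    by (rule measurable_ks_nn_1[OF _ y]) measurable
  have "(\<integral>\<^sup>+x. ennreal \<bar>gen y \<rho> x\<bar> \<partial>\<nu>)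
      \<le> (\<integral>\<^sup>+x. (\<integral>\<^sup>+z. ennreal \<bar>\<rho> z\<bar> \<partial>ks y x) + ennreal \<bar>\<rho> x\<bar> * emeasure (k y x) UNIV \<partial>\<nu>)"
  proof (rule nn_integral_mono)
    fix x
    have "ennreal \<bar>gen y \<rho> x\<bar> \<le> ennreal (\<bar>\<integral>z. \<rho> z \<partial>ks y x\<bar> + \<bar>\<rho> x\<bar> * measure (k y x) UNIV)"
      unfolding gen_def adjoint_jump_generator_def
      by (intro ennreal_leI) (metis abs_mult abs_of_nonneg abs_triangle_ineq4 measure_nonneg mult.commute)
    also have "\<dots> = ennreal \<bar>\<integral>z. \<rho> z \<partial>ks y x\<bar> + ennreal \<bar>\<rho> x\<bar> * emeasure (k y x) UNIV"
      by (simp add: emeasure_k ennreal_mult)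
    also have "ennreal \<bar>\<integral>z. \<rho> z \<partial>ks y x\<bar> \<le> (\<integral>\<^sup>+z. ennreal \<bar>\<rho> z\<bar> \<partial>ks y x)"
    \<comment> \<open>The default value 0 of a divergent integral satisfies the bound as
      well.\<close>
    proof (cases "integrable (ks y x) \<rho>")
      case True
      then show ?thesis
        using integral_norm_bound_ennreal[of "ks y x" \<rho>] by simp
    qed (simp add: not_integrable_integral_eq)
    finally show "ennreal \<bar>gen y \<rho> x\<bar> \<le> (\<integral>\<^sup>+z. ennreal \<bar>\<rho> z\<bar> \<partial>ks y x) + ennreal \<bar>\<rho> x\<bar> * emeasure (k y x) UNIV"
      by (simp add: add_right_mono)
  qed
  also have "\<dots> = (\<integral>\<^sup>+x. (\<integral>\<^sup>+z. ennreal \<bar>\<rho> z\<bar> \<partial>ks y x) \<partial>\<nu>) + (\<integral>\<^sup>+x. ennreal \<bar>\<rho> x\<bar> * emeasure (k y x) UNIV \<partial>\<nu>)"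
    unfolding emeasure_k by (rule nn_integral_add) measurable
  also have "(\<integral>\<^sup>+x. (\<integral>\<^sup>+z. ennreal \<bar>\<rho> z\<bar> \<partial>ks y x) \<partial>\<nu>) = (\<integral>\<^sup>+x. ennreal \<bar>\<rho> x\<bar> * emeasure (k y x) UNIV \<partial>\<nu>)"
    by (rule adjoint_nn_integral[OF _ y]) measurable
  also have "\<dots> + \<dots> = 2 * \<dots>"
    by (simp add: mult_2)
  also have "\<dots> \<le> 2 * (\<integral>\<^sup>+x. ennreal \<bar>\<rho> x\<bar> * ennreal M \<partial>\<nu>)"
    by (intro nn_integral_mono mult_left_mono) (auto simp: emeasure_k k_le ennreal_leI)
  also have "\<dots> = 2 * (ennreal (L1_norm \<nu> \<rho>) * ennreal M)"
    using \<rho> by (subst nn_integral_multc) (auto simp: ennreal_L1_norm)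
  also have "\<dots> = ennreal (2 * M * L1_norm \<nu> \<rho>)"
    using M_nonneg by (simp add: ennreal_mult mult_ac)
  finally show ?thesis .
qed

lemma integrable_gen:
  assumes \<rho>: "integrable \<nu> \<rho>" and y: "y \<in> space W"
  shows "integrable \<nu> (gen y \<rho>)"
proof (rule integrableI_bounded)
  show "gen y \<rho> \<in> borel_measurable \<nu>"
    using \<rho> by (intro measurable_gen_1 y) (simp add: borel_measurable_\<nu>[symmetric])
  show "(\<integral>\<^sup>+x. ennreal (norm (gen y \<rho> x)) \<partial>\<nu>) < \<infinity>"
    using gen_nn_norm[OF assms] by (simp add: le_less_trans)
qed

lemma gen_scale: "gen y (\<lambda>x. r * \<rho> x) x = r * gen y \<rho> x"
  by (simp add: gen_def adjoint_jump_generator_def algebra_simps)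

lemma gen_diff_AE:
  assumes \<rho>: "integrable \<nu> \<rho>" "integrable \<nu> \<rho>'" and y: "y \<in> space W"
  shows "AE x in \<nu>. gen y (\<lambda>x. \<rho> x - \<rho>' x) x = gen y \<rho> x - gen y \<rho>' x"
  using AE_integrable_ks[OF \<rho>(1) y] AE_integrable_ks[OF \<rho>(2) y]
  by eventually_elim (simp add: gen_def adjoint_jump_generator_def algebra_simps)

text \<open>By the adjoint relation the total gain equals the total loss, and both are finite.
  Nonnegativity lets the comparison run in the extended nonnegative reals; \<open>gen_mass\<close>
  then splits into positive and negative parts.\<close>

lemma gen_mass_nonneg:
  assumes \<rho>: "integrable \<nu> \<rho>" "\<And>x. 0 \<le> \<rho> x" and y: "y \<in> space W"
  shows "(\<integral>x. gen y \<rho> x \<partial>\<nu>) = 0"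
proof -
  have [measurable]: "\<rho> \<in> borel_measurable borel"
    using \<rho> by (simp add: borel_measurable_\<nu>[symmetric])
  have [measurable]: "(\<lambda>x. measure (k y x) UNIV) \<in> borel_measurable \<nu>"
    by (rule measurable_k_1[OF y])
  have int_loss: "integrable \<nu> (\<lambda>x. measure (k y x) UNIV * \<rho> x)"
  proof (rule Bochner_Integration.integrable_bound)
    show "integrable \<nu> (\<lambda>x. M * \<rho> x)"
      using \<rho> by simp
    show "(\<lambda>x. measure (k y x) UNIV * \<rho> x) \<in> borel_measurable \<nu>"
      using \<rho> by simp
    show "AE x in \<nu>. norm (measure (k y x) UNIV * \<rho> x) \<le> norm (M * \<rho> x)"
      using k_le M_nonneg \<rho>(2) by (auto simp: abs_mult intro!: mult_right_mono)
  qed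
  have gain: "(\<lambda>x. \<integral>z. \<rho> z \<partial>ks y x) = (\<lambda>x. gen y \<rho> x + measure (k y x) UNIV * \<rho> x)"
    by (simp add: gen_def adjoint_jump_generator_def)
  have int_gain: "integrable \<nu> (\<lambda>x. \<integral>z. \<rho> z \<partial>ks y x)"
    unfolding gain by (intro Bochner_Integration.integrable_add integrable_gen \<rho> y int_loss)
  have "ennreal (\<integral>x. (\<integral>z. \<rho> z \<partial>ks y x) \<partial>\<nu>) = (\<integral>\<^sup>+x. ennreal (\<integral>z. \<rho> z \<partial>ks y x) \<partial>\<nu>)"
    by (rule nn_integral_eq_integral[symmetric, OF int_gain])
      (auto intro!: Bochner_Integration.integral_nonneg \<rho>)
  also have "\<dots> = (\<integral>\<^sup>+x. (\<integral>\<^sup>+z. ennreal (\<rho> z) \<partial>ks y x) \<partial>\<nu>)"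
  proof (rule nn_integral_cong_AE)
    show "AE x in \<nu>. ennreal (\<integral>z. \<rho> z \<partial>ks y x) = (\<integral>\<^sup>+z. ennreal (\<rho> z) \<partial>ks y x)"
      using AE_integrable_ks[OF \<rho>(1) y] by eventually_elim (simp add: nn_integral_eq_integral \<rho>)
  qed
  also have "\<dots> = (\<integral>\<^sup>+x. ennreal (\<rho> x) * emeasure (k y x) UNIV \<partial>\<nu>)"
    by (rule adjoint_nn_integral[OF _ y]) measurable
  also have "\<dots> = (\<integral>\<^sup>+x. ennreal (measure (k y x) UNIV * \<rho> x) \<partial>\<nu>)"
    by (simp add: emeasure_k ennreal_mult'' \<rho> mult.commute)
  also have "\<dots> = ennreal (\<integral>x. measure (k y x) UNIV * \<rho> x \<partial>\<nu>)"
    by (rule nn_integral_eq_integral[OF int_loss]) (auto simp: \<rho>)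
  finally have "(\<integral>x. (\<integral>z. \<rho> z \<partial>ks y x) \<partial>\<nu>) = (\<integral>x. measure (k y x) UNIV * \<rho> x \<partial>\<nu>)"
    by (simp add: Bochner_Integration.integral_nonneg \<rho>)
  then show ?thesis
    unfolding gen_def adjoint_jump_generator_def
    by (subst Bochner_Integration.integral_diff[OF int_gain int_loss]) simp
qed

lemma gen_mass:
  assumes \<rho>: "integrable \<nu> \<rho>" and y: "y \<in> space W"
  shows "(\<integral>x. gen y \<rho> x \<partial>\<nu>) = 0"
proof -
  define p q where "p = (\<lambda>x. max 0 (\<rho> x))" and "q = (\<lambda>x. max 0 (- \<rho> x))"
  have pq: "integrable \<nu> p" "integrable \<nu> q" "\<And>x. 0 \<le> p x" "\<And>x. 0 \<le> q x"
    using \<rho> by (auto simp: p_def q_def)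
  have "\<rho> = (\<lambda>x. p x - q x)"
    by (auto simp: p_def q_def max_def)
  with gen_diff_AE[OF pq(1,2) y] have "AE x in \<nu>. gen y \<rho> x = gen y p x - gen y q x"
    by simp
  then have "(\<integral>x. gen y \<rho> x \<partial>\<nu>) = (\<integral>x. gen y p x - gen y q x \<partial>\<nu>)"
    by (intro integral_cong_AE borel_measurable_integrable Bochner_Integration.integrable_diff
        integrable_gen \<rho> pq y)
  then show ?thesis
    by (simp add: integrable_gen gen_mass_nonneg pq y)
qed

lemma bilin_nn_bound:
  assumes \<rho>: "integrable \<nu> \<rho>" and \<sigma>: "integrable W \<sigma>"
  shows "(\<integral>\<^sup>+y. (\<integral>\<^sup>+x. ennreal \<bar>\<sigma> y * gen y \<rho> x\<bar> \<partial>\<nu>) \<partial>W) \<le> ennreal (2 * M * L1_norm \<nu> \<rho> * L1_norm W \<sigma>)"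
proof -
  have \<rho>m: "\<rho> \<in> borel_measurable borel"
    using \<rho> by (simp add: borel_measurable_\<nu>[symmetric])
  have "(\<integral>\<^sup>+y. (\<integral>\<^sup>+x. ennreal \<bar>\<sigma> y * gen y \<rho> x\<bar> \<partial>\<nu>) \<partial>W)
      \<le> (\<integral>\<^sup>+y. ennreal \<bar>\<sigma> y\<bar> * ennreal (2 * M * L1_norm \<nu> \<rho>) \<partial>W)"
  proof (rule nn_integral_mono)
    fix y assume y: "y \<in> space W"
    have "(\<integral>\<^sup>+x. ennreal \<bar>\<sigma> y * gen y \<rho> x\<bar> \<partial>\<nu>) = ennreal \<bar>\<sigma> y\<bar> * (\<integral>\<^sup>+x. ennreal \<bar>gen y \<rho> x\<bar> \<partial>\<nu>)"
      using measurable_gen_1[OF \<rho>m y]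
      by (subst nn_integral_cmult[symmetric]) (auto simp: abs_mult ennreal_mult)
    also have "\<dots> \<le> ennreal \<bar>\<sigma> y\<bar> * ennreal (2 * M * L1_norm \<nu> \<rho>)"
      by (intro mult_left_mono gen_nn_norm \<rho> y) simp
    finally show "(\<integral>\<^sup>+x. ennreal \<bar>\<sigma> y * gen y \<rho> x\<bar> \<partial>\<nu>) \<le> ennreal \<bar>\<sigma> y\<bar> * ennreal (2 * M * L1_norm \<nu> \<rho>)" .
  qed
  also have "\<dots> = ennreal (L1_norm W \<sigma>) * ennreal (2 * M * L1_norm \<nu> \<rho>)"
    using \<sigma> by (subst nn_integral_multc) (auto simp: ennreal_L1_norm)
  also have "\<dots> = ennreal (2 * M * L1_norm \<nu> \<rho> * L1_norm W \<sigma>)"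
    using M_nonneg by (simp add: ennreal_mult mult_ac)
  finally show ?thesis .
qed

lemma measurable_bilin_integrand:
  assumes \<rho>: "integrable \<nu> \<rho>" and \<sigma>: "integrable W \<sigma>"
  shows "(\<lambda>(y, x). \<sigma> y * gen y \<rho> x) \<in> borel_measurable (W \<Otimes>\<^sub>M \<nu>)"
proof -
  have [measurable]: "\<rho> \<in> borel_measurable borel"
    using \<rho> by (simp add: borel_measurable_\<nu>[symmetric])
  have [measurable]: "\<sigma> \<in> borel_measurable W"
    using \<sigma> by simp
  have "(\<lambda>p. \<sigma> (fst p) * (\<lambda>(y, x). gen y \<rho> x) p) \<in> borel_measurable (W \<Otimes>\<^sub>M \<nu>)"
    by (intro borel_measurable_times measurable_gen) measurable
  then show ?thesis
    by (simp add: case_prod_beta)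
qed

lemma integrable_bilin_integrand:
  assumes \<rho>: "integrable \<nu> \<rho>" and \<sigma>: "integrable W \<sigma>"
  shows "integrable (W \<Otimes>\<^sub>M \<nu>) (\<lambda>(y, x). \<sigma> y * gen y \<rho> x)"
proof (rule integrableI_bounded)
  note [measurable] = measurable_bilin_integrand[OF assms]
  show "(\<lambda>(y, x). \<sigma> y * gen y \<rho> x) \<in> borel_measurable (W \<Otimes>\<^sub>M \<nu>)"
    by measurable
  have "(\<integral>\<^sup>+p. ennreal (norm (case p of (y, x) \<Rightarrow> \<sigma> y * gen y \<rho> x)) \<partial>(W \<Otimes>\<^sub>M \<nu>))
      = (\<integral>\<^sup>+y. (\<integral>\<^sup>+x. ennreal \<bar>\<sigma> y * gen y \<rho> x\<bar> \<partial>\<nu>) \<partial>W)"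
    by (subst \<nu>.nn_integral_fst[symmetric]) auto
  also have "\<dots> < \<infinity>"
    using bilin_nn_bound[OF assms] by (simp add: le_less_trans)
  finally show "(\<integral>\<^sup>+p. ennreal (norm (case p of (y, x) \<Rightarrow> \<sigma> y * gen y \<rho> x)) \<partial>(W \<Otimes>\<^sub>M \<nu>)) < \<infinity>" .
qed

lemma integrable_bilin [simp]:
  "integrable \<nu> \<rho> \<Longrightarrow> integrable W \<sigma> \<Longrightarrow> integrable \<nu> (bilin \<rho> \<sigma>)"
  unfolding bilin_def[abs_def] by (rule W\<nu>.integrable_snd[OF integrable_bilin_integrand])

lemma AE_bilin_integrable:
  "integrable \<nu> \<rho> \<Longrightarrow> integrable W \<sigma> \<Longrightarrow> AE x in \<nu>. integrable W (\<lambda>y. \<sigma> y * gen y \<rho> x)"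
  by (rule W\<nu>.AE_integrable_snd[OF integrable_bilin_integrand])

lemma bilin_norm:
  assumes \<rho>: "integrable \<nu> \<rho>" and \<sigma>: "integrable W \<sigma>"
  shows "L1_norm \<nu> (bilin \<rho> \<sigma>) \<le> 2 * M * L1_norm \<nu> \<rho> * L1_norm W \<sigma>"
proof -
  have "ennreal (L1_norm \<nu> (bilin \<rho> \<sigma>)) = (\<integral>\<^sup>+x. ennreal \<bar>bilin \<rho> \<sigma> x\<bar> \<partial>\<nu>)"
    by (rule ennreal_L1_norm[OF integrable_bilin[OF assms]])
  also have "\<dots> \<le> (\<integral>\<^sup>+x. (\<integral>\<^sup>+y. ennreal \<bar>\<sigma> y * gen y \<rho> x\<bar> \<partial>W) \<partial>\<nu>)"
  proof (rule nn_integral_mono_AE)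
    show "AE x in \<nu>. ennreal \<bar>bilin \<rho> \<sigma> x\<bar> \<le> (\<integral>\<^sup>+y. ennreal \<bar>\<sigma> y * gen y \<rho> x\<bar> \<partial>W)"
      using AE_bilin_integrable[OF assms]
    proof eventually_elim
      case (elim x)
      then show ?case
        using integral_norm_bound_ennreal[OF elim] by (simp add: bilin_def)
    qed
  qed
  also have "\<dots> = (\<integral>\<^sup>+y. (\<integral>\<^sup>+x. ennreal \<bar>\<sigma> y * gen y \<rho> x\<bar> \<partial>\<nu>) \<partial>W)"
    using measurable_bilin_integrand[OF assms] by (intro W\<nu>.Fubini') (simp add: case_prod_beta)
  also have "\<dots> \<le> ennreal (2 * M * L1_norm \<nu> \<rho> * L1_norm W \<sigma>)"
    by (rule bilin_nn_bound[OF assms])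
  finally show ?thesis
    using M_nonneg by (subst (asm) ennreal_le_iff) simp_all
qed

lemma bilin_scale_1: "bilin (\<lambda>x. r * \<rho> x) \<sigma> x = r * bilin \<rho> \<sigma> x"
  by (simp add: bilin_def gen_scale mult.left_commute)

lemma bilin_scale_2: "bilin \<rho> (\<lambda>y. r * \<sigma> y) x = r * bilin \<rho> \<sigma> x"
  by (simp add: bilin_def mult.assoc)

text \<open>For each configuration y the exceptional set of points x is null, but it varies with y;
  Fubini exchanges the two quantifiers.\<close>

lemma AE_swap_W:
  assumes "\<And>y. y \<in> space W \<Longrightarrow> AE x in \<nu>. P y x"
    and "Measurable.pred (W \<Otimes>\<^sub>M \<nu>) (\<lambda>(y, x). P y x)"
  shows "AE x in \<nu>. AE y in W. P y x"
proof -
  have "AE y in W. AE x in \<nu>. P y x"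
    using assms(1) by auto
  then show ?thesis
    using assms(2) by (subst W\<nu>.AE_commute[symmetric]) (simp_all add: pred_def case_prod_beta)
qed

lemma bilin_diff_1:
  assumes \<rho>: "integrable \<nu> \<rho>" "integrable \<nu> \<rho>'" and \<sigma>: "integrable W \<sigma>"
  shows "AE x in \<nu>. bilin (\<lambda>x. \<rho> x - \<rho>' x) \<sigma> x = bilin \<rho> \<sigma> x - bilin \<rho>' \<sigma> x"
proof -
  have [measurable]: "\<rho> \<in> borel_measurable borel" "\<rho>' \<in> borel_measurable borel"
    using \<rho> by (simp_all add: borel_measurable_\<nu>[symmetric])
  have [measurable]: "\<sigma> \<in> borel_measurable W"
    using \<sigma> by simp
  have "AE x in \<nu>. AE y in W. gen y (\<lambda>x. \<rho> x - \<rho>' x) x = gen y \<rho> x - gen y \<rho>' x"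
    by (rule AE_swap_W[OF gen_diff_AE[OF \<rho>]]) measurable
  then show ?thesis
    using AE_bilin_integrable[OF \<rho>(1) \<sigma>] AE_bilin_integrable[OF \<rho>(2) \<sigma>]
  proof eventually_elim
    case (elim x)
    have "bilin (\<lambda>x. \<rho> x - \<rho>' x) \<sigma> x = (\<integral>y. \<sigma> y * gen y \<rho> x - \<sigma> y * gen y \<rho>' x \<partial>W)"
      unfolding bilin_def
    proof (rule integral_cong_AE)
      show "(\<lambda>y. \<sigma> y * gen y (\<lambda>x. \<rho> x - \<rho>' x) x) \<in> borel_measurable W"
        "(\<lambda>y. \<sigma> y * gen y \<rho> x - \<sigma> y * gen y \<rho>' x) \<in> borel_measurable W"
        by (intro borel_measurable_times borel_measurable_diff measurable_gen_2; measurable)+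
      show "AE y in W. \<sigma> y * gen y (\<lambda>x. \<rho> x - \<rho>' x) x = \<sigma> y * gen y \<rho> x - \<sigma> y * gen y \<rho>' x"
        using elim(1) by eventually_elim (simp add: right_diff_distrib)
    qed
    then show ?case
      using elim by (simp add: bilin_def)
  qed
qed

lemma bilin_diff_2:
  assumes \<rho>: "integrable \<nu> \<rho>" and \<sigma>: "integrable W \<sigma>" "integrable W \<sigma>'"
  shows "AE x in \<nu>. bilin \<rho> (\<lambda>y. \<sigma> y - \<sigma>' y) x = bilin \<rho> \<sigma> x - bilin \<rho> \<sigma>' x"
  using AE_bilin_integrable[OF \<rho> \<sigma>(1)] AE_bilin_integrable[OF \<rho> \<sigma>(2)]
  by eventually_elim (simp add: bilin_def left_diff_distrib)

lemma bilin_mass: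
  assumes \<rho>: "integrable \<nu> \<rho>" and \<sigma>: "integrable W \<sigma>"
  shows "(\<integral>x. bilin \<rho> \<sigma> x \<partial>\<nu>) = 0"
proof -
  have "(\<integral>x. bilin \<rho> \<sigma> x \<partial>\<nu>) = (\<integral>y. (\<integral>x. \<sigma> y * gen y \<rho> x \<partial>\<nu>) \<partial>W)"
    unfolding bilin_def by (rule W\<nu>.Fubini_integral[OF integrable_bilin_integrand[OF assms]])
  also have "\<dots> = (\<integral>y. 0 \<partial>W)"
    by (intro Bochner_Integration.integral_cong) (auto simp: gen_mass \<rho>)
  finally show ?thesis by simp
qed

text \<open>A bound valid for each configuration is inherited by the average because the weight is a
  probability density. \<open>l\<close> may vary with x, as it will contain the value of the
  semigroup generator at 1.\<close>

lemma bilin_lower: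
  assumes \<rho>: "integrable \<nu> \<rho>" and \<sigma>: "integrable W \<sigma>" "\<And>y. 0 \<le> \<sigma> y" "(\<integral>y. \<sigma> y \<partial>W) = 1"
    and l: "l \<in> borel_measurable \<nu>" "\<And>y. y \<in> space W \<Longrightarrow> AE x in \<nu>. l x \<le> gen y \<rho> x"
  shows "AE x in \<nu>. l x \<le> bilin \<rho> \<sigma> x"
proof -
  have [measurable]: "\<rho> \<in> borel_measurable borel"
    using \<rho> by (simp add: borel_measurable_\<nu>[symmetric])
  note [measurable] = l(1)
  have "AE x in \<nu>. AE y in W. l x \<le> gen y \<rho> x"
    by (rule AE_swap_W[OF l(2)]) measurable
  then show ?thesis
    using AE_bilin_integrable[OF \<rho> \<sigma>(1)]
  proof eventually_elim
    case (elim x)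
    have "l x = (\<integral>y. \<sigma> y * l x \<partial>W)"
      using \<sigma> by simp
    also have "\<dots> \<le> bilin \<rho> \<sigma> x"
      unfolding bilin_def
    proof (rule integral_mono_AE)
      show "AE y in W. \<sigma> y * l x \<le> \<sigma> y * gen y \<rho> x"
        using elim(1) by eventually_elim (intro mult_left_mono \<sigma>)
    qed (use elim \<sigma> in auto)
    finally show ?case .
  qed
qed

lemma bilin_upper:
  assumes \<rho>: "integrable \<nu> \<rho>" and \<sigma>: "integrable W \<sigma>" "\<And>y. 0 \<le> \<sigma> y" "(\<integral>y. \<sigma> y \<partial>W) = 1"
    and l: "l \<in> borel_measurable \<nu>" "\<And>y. y \<in> space W \<Longrightarrow> AE x in \<nu>. gen y \<rho> x \<le> l x"
  shows "AE x in \<nu>. bilin \<rho> \<sigma> x \<le> l x"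
proof -
  have "AE x in \<nu>. - l x \<le> bilin (\<lambda>x. - 1 * \<rho> x) \<sigma> x"
  proof (rule bilin_lower[OF _ \<sigma>])
    show "AE x in \<nu>. - l x \<le> gen y (\<lambda>x. - 1 * \<rho> x) x" if "y \<in> space W" for y
      using l(2)[OF that] unfolding gen_scale by eventually_elim simp
  qed (use \<rho> l in auto)
  then show ?thesis
    unfolding bilin_scale_1 by simp
qed

text \<open>The gain is nonnegative and the loss rate is at most \<open>M\<close>. This decides how
  large the shift has to be.\<close>

lemma bilin_ge_loss:
  assumes \<rho>: "integrable \<nu> \<rho>" "\<And>x. 0 \<le> \<rho> x"
    and \<sigma>: "integrable W \<sigma>" "\<And>y. 0 \<le> \<sigma> y" "(\<integral>y. \<sigma> y \<partial>W) = 1"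
  shows "AE x in \<nu>. - M * \<rho> x \<le> bilin \<rho> \<sigma> x"
proof (rule bilin_lower[OF \<rho>(1) \<sigma>])
  have "- M * \<rho> x \<le> gen y \<rho> x" for x y
  proof -
    have "measure (k y x) UNIV * \<rho> x \<le> M * \<rho> x"
      by (intro mult_right_mono k_le \<rho>)
    moreover have "0 \<le> (\<integral>z. \<rho> z \<partial>ks y x)"
      by (simp add: Bochner_Integration.integral_nonneg \<rho>)
    ultimately show ?thesis
      by (simp add: gen_def adjoint_jump_generator_def)
  qed
  then show "AE x in \<nu>. - M * \<rho> x \<le> gen y \<rho> x" for y
    by simp
qed (use \<rho> in simp)

section \<open>Tensor powers of densities and their difference quotients\<close>

abbreviation Pw :: "nat \<Rightarrow> (nat \<Rightarrow> 'a) measure" where "Pw m \<equiv> Pi\<^sub>M {..<m} (\<lambda>_. \<nu>)"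

lemma nn_integral_lessThan_Suc:
  assumes "f \<in> borel_measurable (Pw (Suc m))"
  shows "integral\<^sup>N (Pw (Suc m)) f = (\<integral>\<^sup>+y. (\<integral>\<^sup>+z. f (y(m := z)) \<partial>\<nu>) \<partial>Pw m)"
  using assms unfolding lessThan_Suc by (intro product_nn_integral_insert) auto

lemma measurable_tensor [measurable]:
  "f \<in> borel_measurable \<nu> \<Longrightarrow> (\<lambda>y. \<Prod>i<m. f (y i) :: real) \<in> borel_measurable (Pw m)"
  by (intro borel_measurable_prod measurable_compose[OF measurable_component_singleton])

lemma tensor_upd:
  fixes m :: nat
  shows "(\<Prod>i<m. f ((y(m := z)) i)) = (\<Prod>i<m. f (y i))"
  by (intro prod.cong) auto

lemma nn_integral_tensor:
  assumes f: "integrable \<nu> f" "L1_norm \<nu> f = 1"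
  shows "(\<integral>\<^sup>+y. ennreal \<bar>\<Prod>i<m. f (y i)\<bar> \<partial>Pw m) = 1"
proof -
  have "(\<integral>\<^sup>+y. ennreal \<bar>\<Prod>i<m. f (y i)\<bar> \<partial>Pw m) = (\<integral>\<^sup>+y. (\<Prod>i<m. ennreal \<bar>f (y i)\<bar>) \<partial>Pw m)"
    by (simp add: abs_prod prod_ennreal)
  also have "\<dots> = (\<Prod>i<m. \<integral>\<^sup>+z. ennreal \<bar>f z\<bar> \<partial>\<nu>)"
    using f by (intro product_nn_integral_prod) auto
  also have "\<dots> = 1"
    using f by (simp add: ennreal_L1_norm[symmetric])
  finally show ?thesis .
qed

text \<open>Three products of a function of the old particles and a function of the new one: the
  shape of the discrete product rule in \<open>tensor_quotients\<close>.\<close>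

lemma nn_integral_split:
  assumes u: "u \<in> borel_measurable (Pw m)" "v \<in> borel_measurable \<nu>"
    and u': "u' \<in> borel_measurable (Pw m)" "v' \<in> borel_measurable \<nu>"
    and u'': "u'' \<in> borel_measurable (Pw m)" "v'' \<in> borel_measurable \<nu>"
  shows "(\<integral>\<^sup>+y. (\<integral>\<^sup>+z. u y * v z + u' y * v' z + u'' y * v'' z \<partial>\<nu>) \<partial>Pw m) =
    (\<integral>\<^sup>+y. u y \<partial>Pw m) * (\<integral>\<^sup>+z. v z \<partial>\<nu>) + (\<integral>\<^sup>+y. u' y \<partial>Pw m) * (\<integral>\<^sup>+z. v' z \<partial>\<nu>) +
    (\<integral>\<^sup>+y. u'' y \<partial>Pw m) * (\<integral>\<^sup>+z. v'' z \<partial>\<nu>)"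
  using assms by (simp add: nn_integral_add nn_integral_cmult nn_integral_multc)

text \<open>Telescoping: exchanging the factors one at a time costs the L1 distance each, since all
  other factors have norm one.\<close>

lemma tensor_lipschitz:
  assumes b: "integrable \<nu> b" "L1_norm \<nu> b = 1" and c: "integrable \<nu> c" "L1_norm \<nu> c = 1"
  shows "(\<integral>\<^sup>+y. ennreal \<bar>(\<Prod>i<m. b (y i)) - (\<Prod>i<m. c (y i))\<bar> \<partial>Pw m)
    \<le> ennreal (real m * L1_norm \<nu> (\<lambda>x. b x - c x))"
proof (induction m)
  case 0
  then show ?case by simp
next
  case (Suc m)
  let ?B = "\<lambda>y. \<Prod>i<m. b (y i)" and ?C = "\<lambda>y. \<Prod>i<m. c (y i)"
  let ?D = "L1_norm \<nu> (\<lambda>x. b x - c x)"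
  have [measurable]: "b \<in> borel_measurable \<nu>" "c \<in> borel_measurable \<nu>"
    using b c by auto
  have "(\<integral>\<^sup>+y. ennreal \<bar>(\<Prod>i<Suc m. b (y i)) - (\<Prod>i<Suc m. c (y i))\<bar> \<partial>Pw (Suc m))
      = (\<integral>\<^sup>+y. (\<integral>\<^sup>+z. ennreal \<bar>?B y * b z - ?C y * c z\<bar> \<partial>\<nu>) \<partial>Pw m)"
    by (subst nn_integral_lessThan_Suc) (simp_all add: tensor_upd del: fun_upd_apply, simp)
  \<comment> \<open>The summand 0 * 0 pads the two-term product rule to the shape of
    \<open>nn_integral_split\<close>.\<close>
  also have "\<dots> \<le> (\<integral>\<^sup>+y. (\<integral>\<^sup>+z. ennreal \<bar>?B y - ?C y\<bar> * ennreal \<bar>b z\<bar> + ennreal \<bar>?C y\<bar> * ennreal \<bar>b z - c z\<bar> + 0 * 0 \<partial>\<nu>) \<partial>Pw m)"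
  proof (intro nn_integral_mono)
    fix y z
    have "?B y * b z - ?C y * c z = (?B y - ?C y) * b z + ?C y * (b z - c z)"
      by (simp add: algebra_simps)
    then have "\<bar>?B y * b z - ?C y * c z\<bar> \<le> \<bar>?B y - ?C y\<bar> * \<bar>b z\<bar> + \<bar>?C y\<bar> * \<bar>b z - c z\<bar>"
      by (metis abs_mult abs_triangle_ineq)
    then show "ennreal \<bar>?B y * b z - ?C y * c z\<bar>
        \<le> ennreal \<bar>?B y - ?C y\<bar> * ennreal \<bar>b z\<bar> + ennreal \<bar>?C y\<bar> * ennreal \<bar>b z - c z\<bar> + 0 * 0"
      by (simp add: ennreal_mult[symmetric] ennreal_plus[symmetric] ennreal_leI del: ennreal_plus)
  qed
  also have "\<dots> = (\<integral>\<^sup>+y. ennreal \<bar>?B y - ?C y\<bar> \<partial>Pw m) * (\<integral>\<^sup>+z. ennreal \<bar>b z\<bar> \<partial>\<nu>) +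
      (\<integral>\<^sup>+y. ennreal \<bar>?C y\<bar> \<partial>Pw m) * (\<integral>\<^sup>+z. ennreal \<bar>b z - c z\<bar> \<partial>\<nu>) + (\<integral>\<^sup>+y. 0 \<partial>Pw m) * (\<integral>\<^sup>+z. 0 \<partial>\<nu>)"
    by (rule nn_integral_split) measurable
  also have "\<dots> = (\<integral>\<^sup>+y. ennreal \<bar>?B y - ?C y\<bar> \<partial>Pw m) * ennreal (L1_norm \<nu> b) + 1 * ennreal ?D"
    unfolding ennreal_L1_norm[OF b(1)] ennreal_L1_norm[OF Bochner_Integration.integrable_diff[OF b(1) c(1)]]
      nn_integral_tensor[OF c] by simp
  also have "\<dots> \<le> ennreal (real m * ?D) * 1 + 1 * ennreal ?D"
    using Suc b by (intro add_mono mult_mono) auto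
  also have "\<dots> = ennreal (real (Suc m) * ?D)"
    by (simp add: ennreal_plus[symmetric] algebra_simps del: ennreal_plus)
  finally show ?case .
qed

text \<open>Discrete product rule, one particle at a time. In the mixed term the new factor b - c
  meets the quotient of the first m factors, which costs m times that of a single factor; summation
  over the particles gives the square.\<close>

lemma tensor_quotients:
  assumes a: "integrable \<nu> a" "L1_norm \<nu> a = 1" and b: "integrable \<nu> b" "L1_norm \<nu> b = 1"
    and c: "integrable \<nu> c" "L1_norm \<nu> c = 1" and h: "0 < h" and l: "0 < l"
  defines "d \<equiv> \<lambda>x. (b x - a x) / h" and "e \<equiv> \<lambda>x. (c x - a x) / l"
  shows "(\<integral>\<^sup>+y. ennreal \<bar>((\<Prod>i<m. b (y i)) - (\<Prod>i<m. a (y i))) / h - ((\<Prod>i<m. c (y i)) - (\<Prod>i<m. a (y i))) / l\<bar> \<partial>Pw m)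
    \<le> ennreal (real m * L1_norm \<nu> (\<lambda>x. d x - e x) + (real m)\<^sup>2 * L1_norm \<nu> (\<lambda>x. b x - c x) * L1_norm \<nu> e)"
proof (induction m)
  case 0
  then show ?case by simp
next
  case (Suc m)
  let ?A = "\<lambda>y. \<Prod>i<m. a (y i)" and ?B = "\<lambda>y. \<Prod>i<m. b (y i)" and ?C = "\<lambda>y. \<Prod>i<m. c (y i)"
  let ?X = "\<lambda>y. (?B y - ?A y) / h - (?C y - ?A y) / l" and ?E = "\<lambda>y. (?C y - ?A y) / l"
  let ?de = "L1_norm \<nu> (\<lambda>x. d x - e x)" and ?bc = "L1_norm \<nu> (\<lambda>x. b x - c x)" and ?e = "L1_norm \<nu> e"
  have [measurable]: "a \<in> borel_measurable \<nu>" "b \<in> borel_measurable \<nu>" "c \<in> borel_measurable \<nu>"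
    using a b c by auto
  have int: "integrable \<nu> d" "integrable \<nu> e" "integrable \<nu> (\<lambda>x. c x - a x)"
    using a b c by (auto simp: d_def e_def)
  have [measurable]: "d \<in> borel_measurable \<nu>" "e \<in> borel_measurable \<nu>"
    using int by auto
  have e_norm: "L1_norm \<nu> (\<lambda>x. c x - a x) / l = ?e"
    using l by (simp add: e_def L1_norm_def)
  have E: "(\<integral>\<^sup>+y. ennreal \<bar>?E y\<bar> \<partial>Pw m) \<le> ennreal (real m * ?e)"
  proof -
    have "(\<integral>\<^sup>+y. ennreal \<bar>?E y\<bar> \<partial>Pw m) = (\<integral>\<^sup>+y. ennreal \<bar>?C y - ?A y\<bar> * ennreal (1 / l) \<partial>Pw m)"
      using l by (intro nn_integral_cong) (simp add: ennreal_mult[symmetric])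
    also have "\<dots> = (\<integral>\<^sup>+y. ennreal \<bar>?C y - ?A y\<bar> \<partial>Pw m) * ennreal (1 / l)"
      by (rule nn_integral_multc) measurable
    also have "\<dots> \<le> ennreal (real m * L1_norm \<nu> (\<lambda>x. c x - a x)) * ennreal (1 / l)"
      by (intro mult_right_mono tensor_lipschitz a c) simp
    also have "\<dots> = ennreal (real m * ?e)"
      using l by (simp add: ennreal_mult[symmetric] e_norm[symmetric])
    finally show ?thesis .
  qed
  have "(\<integral>\<^sup>+y. ennreal \<bar>((\<Prod>i<Suc m. b (y i)) - (\<Prod>i<Suc m. a (y i))) / h - ((\<Prod>i<Suc m. c (y i)) - (\<Prod>i<Suc m. a (y i))) / l\<bar> \<partial>Pw (Suc m))
      = (\<integral>\<^sup>+y. (\<integral>\<^sup>+z. ennreal \<bar>(?B y * b z - ?A y * a z) / h - (?C y * c z - ?A y * a z) / l\<bar> \<partial>\<nu>) \<partial>Pw m)"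
    by (subst nn_integral_lessThan_Suc) (simp_all add: tensor_upd del: fun_upd_apply, simp)
  also have "\<dots> \<le> (\<integral>\<^sup>+y. (\<integral>\<^sup>+z. ennreal \<bar>?X y\<bar> * ennreal \<bar>b z\<bar> + ennreal \<bar>?E y\<bar> * ennreal \<bar>b z - c z\<bar>
      + ennreal \<bar>?A y\<bar> * ennreal \<bar>d z - e z\<bar> \<partial>\<nu>) \<partial>Pw m)"
  proof (intro nn_integral_mono)
    fix y z
    have "(?B y * b z - ?A y * a z) / h - (?C y * c z - ?A y * a z) / l
        = ?X y * b z + ?E y * (b z - c z) + ?A y * (d z - e z)"
      using h l by (simp add: d_def e_def field_simps)
    also have "\<bar>\<dots>\<bar> \<le> \<bar>?X y * b z\<bar> + \<bar>?E y * (b z - c z)\<bar> + \<bar>?A y * (d z - e z)\<bar>"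
      by linarith
    finally show "ennreal \<bar>(?B y * b z - ?A y * a z) / h - (?C y * c z - ?A y * a z) / l\<bar>
        \<le> ennreal \<bar>?X y\<bar> * ennreal \<bar>b z\<bar> + ennreal \<bar>?E y\<bar> * ennreal \<bar>b z - c z\<bar> + ennreal \<bar>?A y\<bar> * ennreal \<bar>d z - e z\<bar>"
      by (simp add: ennreal_mult[symmetric] ennreal_plus[symmetric] ennreal_leI abs_mult[symmetric] del: ennreal_plus)
  qed
  also have "\<dots> = (\<integral>\<^sup>+y. ennreal \<bar>?X y\<bar> \<partial>Pw m) * (\<integral>\<^sup>+z. ennreal \<bar>b z\<bar> \<partial>\<nu>) +
      (\<integral>\<^sup>+y. ennreal \<bar>?E y\<bar> \<partial>Pw m) * (\<integral>\<^sup>+z. ennreal \<bar>b z - c z\<bar> \<partial>\<nu>) +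
      (\<integral>\<^sup>+y. ennreal \<bar>?A y\<bar> \<partial>Pw m) * (\<integral>\<^sup>+z. ennreal \<bar>d z - e z\<bar> \<partial>\<nu>)"
    by (rule nn_integral_split) measurable
  also have "\<dots> = (\<integral>\<^sup>+y. ennreal \<bar>?X y\<bar> \<partial>Pw m) * ennreal (L1_norm \<nu> b) +
      (\<integral>\<^sup>+y. ennreal \<bar>?E y\<bar> \<partial>Pw m) * ennreal ?bc + 1 * ennreal ?de"
    unfolding ennreal_L1_norm[OF b(1)] ennreal_L1_norm[OF Bochner_Integration.integrable_diff[OF b(1) c(1)]]
      ennreal_L1_norm[OF Bochner_Integration.integrable_diff[OF int(1,2)]] nn_integral_tensor[OF a] by simp
  also have "\<dots> \<le> ennreal (real m * ?de + (real m)\<^sup>2 * ?bc * ?e) * 1 + ennreal (real m * ?e) * ennreal ?bc + 1 * ennreal ?de"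
    using Suc b E by (intro add_mono mult_mono) auto
  also have "\<dots> = ennreal (real m * ?de + (real m)\<^sup>2 * ?bc * ?e + real m * ?e * ?bc + ?de)"
    by (simp add: ennreal_mult[symmetric] ennreal_plus[symmetric] del: ennreal_plus)
  also have "\<dots> \<le> ennreal (real (Suc m) * ?de + (real (Suc m))\<^sup>2 * ?bc * ?e)"
  proof (rule ennreal_leI)
    \<comment> \<open>The induction hypothesis contributes m^2 and the new mixed term m, together at
      most (m + 1)^2.\<close>
    have "((real m)\<^sup>2 + real m) * (?bc * ?e) \<le> (real (Suc m))\<^sup>2 * (?bc * ?e)"
      by (intro mult_right_mono) (auto simp: power2_eq_square algebra_simps)
    then show "real m * ?de + (real m)\<^sup>2 * ?bc * ?e + real m * ?e * ?bc + ?de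
        \<le> real (Suc m) * ?de + (real (Suc m))\<^sup>2 * ?bc * ?e"
      by (simp add: algebra_simps)
  qed
  finally show ?case .
qed

end

section \<open>The mean-field term on densities\<close>

locale mean_field_equation =
  adjoint_Markov \<nu> S + mean_field_kernel \<nu> n k ks M
  for \<nu> :: "'a::polish_space measure" and S n k ks M
begin

text \<open>The truncation at 0 matches the one performed by \<^const>\<open>ennreal\<close> in the density of a particle.\<close>

definition tensor :: "('a \<Rightarrow> real) \<Rightarrow> (nat \<Rightarrow> 'a) \<Rightarrow> real" where
  "tensor \<rho> y = (\<Prod>i<n. max 0 (\<rho> (y i)))"

definition mean_field :: "('a \<Rightarrow> real) \<Rightarrow> 'a \<Rightarrow> real" where
  "mean_field \<rho> = bilin \<rho> (tensor \<rho>)"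

definition F :: "(('a \<Rightarrow> real) discrete \<Rightarrow>\<^sub>C real) \<Rightarrow> (('a \<Rightarrow> real) discrete \<Rightarrow>\<^sub>C real)" where
  "F v = L1_embed \<nu> (mean_field (L1_rep \<nu> v))"

lemma prob_densityD:
  assumes "\<rho> \<in> prob_densities \<nu>"
  shows "integrable \<nu> \<rho>" "AE x in \<nu>. 0 \<le> \<rho> x" "(\<integral>x. \<rho> x \<partial>\<nu>) = 1"
  using assms by (auto simp: prob_densities_def)

lemma pos_part:
  assumes "\<rho> \<in> prob_densities \<nu>"
  shows "integrable \<nu> (\<lambda>x. max 0 (\<rho> x))" "AE x in \<nu>. max 0 (\<rho> x) = \<rho> x"
    "L1_norm \<nu> (\<lambda>x. max 0 (\<rho> x)) = 1"
proof -
  note \<rho> = prob_densityD[OF assms]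
  show int: "integrable \<nu> (\<lambda>x. max 0 (\<rho> x))"
    using \<rho> by (intro Bochner_Integration.integrable_max) auto
  show AE: "AE x in \<nu>. max 0 (\<rho> x) = \<rho> x"
    using \<rho>(2) by eventually_elim simp
  have "L1_norm \<nu> (\<lambda>x. max 0 (\<rho> x)) = (\<integral>x. \<rho> x \<partial>\<nu>)"
    unfolding L1_norm_def by (intro integral_cong_AE) (use AE \<rho> in auto)
  then show "L1_norm \<nu> (\<lambda>x. max 0 (\<rho> x)) = 1"
    using \<rho> by simp
qed

lemma tensor_nonneg: "0 \<le> tensor \<rho> y"
  by (auto simp: tensor_def intro!: prod_nonneg)

lemma measurable_tensor' [measurable]:
  "\<rho> \<in> borel_measurable \<nu> \<Longrightarrow> tensor \<rho> \<in> borel_measurable W"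
  unfolding tensor_def[abs_def] W_def by (rule measurable_tensor) simp

lemma tensor_density:
  assumes "\<rho> \<in> prob_densities \<nu>"
  shows "integrable W (tensor \<rho>)" "(\<integral>y. tensor \<rho> y \<partial>W) = 1" "L1_norm W (tensor \<rho>) = 1"
proof -
  have nn: "(\<integral>\<^sup>+y. ennreal (tensor \<rho> y) \<partial>W) = 1"
    using nn_integral_tensor[OF pos_part(1,3)[OF assms], of n]
    by (simp add: tensor_def W_def abs_of_nonneg prod_nonneg)
  have [measurable]: "tensor \<rho> \<in> borel_measurable W"
    using prob_densityD(1)[OF assms] by (intro measurable_tensor') simp
  show int: "integrable W (tensor \<rho>)"
    using nn by (intro integrableI_nonneg) (auto simp: tensor_nonneg)
  have "ennreal (\<integral>y. tensor \<rho> y \<partial>W) = 1"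
    using nn nn_integral_eq_integral[OF int] by (simp add: tensor_nonneg)
  then show "(\<integral>y. tensor \<rho> y \<partial>W) = 1"
    by (simp add: tensor_nonneg Bochner_Integration.integral_nonneg)
  then show "L1_norm W (tensor \<rho>) = 1"
    by (simp add: L1_norm_def tensor_nonneg)
qed

lemma L1_norm_leI:
  assumes "integrable N f" "(\<integral>\<^sup>+x. ennreal \<bar>f x\<bar> \<partial>N) \<le> ennreal C" "0 \<le> C"
  shows "L1_norm N f \<le> C"
  using assms by (simp add: ennreal_L1_norm[symmetric])

lemma tensor_lipschitz':
  assumes "b \<in> prob_densities \<nu>" "c \<in> prob_densities \<nu>"
  shows "L1_norm W (\<lambda>y. tensor b y - tensor c y) \<le> real n * L1_norm \<nu> (\<lambda>x. b x - c x)"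
proof -
  have "L1_norm \<nu> (\<lambda>x. max 0 (b x) - max 0 (c x)) = L1_norm \<nu> (\<lambda>x. b x - c x)"
    using pos_part(2)[OF assms(1)] pos_part(2)[OF assms(2)]
    by (intro L1_norm_cong_AE Bochner_Integration.integrable_diff pos_part assms prob_densityD) auto
  then show ?thesis
    using tensor_lipschitz[OF pos_part(1,3)[OF assms(1)] pos_part(1,3)[OF assms(2)], of n]
    by (intro L1_norm_leI Bochner_Integration.integrable_diff tensor_density assms)
      (auto simp: tensor_def W_def)
qed

lemma tensor_quotients':
  assumes a: "a \<in> prob_densities \<nu>" "\<And>x. 0 \<le> a x" and b: "b \<in> prob_densities \<nu>" "\<And>x. 0 \<le> b x"
    and c: "c \<in> prob_densities \<nu>" "\<And>x. 0 \<le> c x" and h: "0 < h" and l: "0 < l"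
  shows "L1_norm W (\<lambda>y. inverse h * (tensor b y - tensor a y) - inverse l * (tensor c y - tensor a y))
    \<le> real n * L1_norm \<nu> (\<lambda>x. inverse h * (b x - a x) - inverse l * (c x - a x)) +
      (real n)\<^sup>2 * L1_norm \<nu> (\<lambda>x. b x - c x) * L1_norm \<nu> (\<lambda>x. inverse l * (c x - a x))"
proof (rule L1_norm_leI)
  have *: "integrable \<nu> f \<and> L1_norm \<nu> f = 1 \<and> tensor f = (\<lambda>y. \<Prod>i<n. f (y i))"
    if "f \<in> prob_densities \<nu>" "\<And>x. 0 \<le> f x" for f
    using pos_part(1,3)[OF that(1)] that(2) by (simp add: max_absorb2 tensor_def[abs_def])
  show "integrable W (\<lambda>y. inverse h * (tensor b y - tensor a y) - inverse l * (tensor c y - tensor a y))"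
    using a b c by (simp add: tensor_density)
  show "(\<integral>\<^sup>+y. ennreal \<bar>inverse h * (tensor b y - tensor a y) - inverse l * (tensor c y - tensor a y)\<bar> \<partial>W)
    \<le> ennreal (real n * L1_norm \<nu> (\<lambda>x. inverse h * (b x - a x) - inverse l * (c x - a x)) +
      (real n)\<^sup>2 * L1_norm \<nu> (\<lambda>x. b x - c x) * L1_norm \<nu> (\<lambda>x. inverse l * (c x - a x)))"
    using tensor_quotients[of a b c h l n] *[OF a] *[OF b] *[OF c] h l
    by (simp add: W_def divide_inverse mult.commute)
qed simp

lemma integrable_mean_field [simp]:
  "\<rho> \<in> prob_densities \<nu> \<Longrightarrow> integrable \<nu> (mean_field \<rho>)"
  unfolding mean_field_def by (intro integrable_bilin prob_densityD tensor_density)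

text \<open>In the embedded space the almost everywhere bilinearity of \<open>bilin\<close> becomes
  equality, so differences can be rearranged algebraically.\<close>

definition \<beta> :: "('a \<Rightarrow> real) \<Rightarrow> ((nat \<Rightarrow> 'a) \<Rightarrow> real) \<Rightarrow> (('a \<Rightarrow> real) discrete \<Rightarrow>\<^sub>C real)" where
  "\<beta> \<rho> \<sigma> = L1_embed \<nu> (bilin \<rho> \<sigma>)"

lemma \<beta>_diff_1:
  assumes "integrable \<nu> \<rho>" "integrable \<nu> \<rho>'" "integrable W \<sigma>"
  shows "\<beta> (\<lambda>x. \<rho> x - \<rho>' x) \<sigma> = \<beta> \<rho> \<sigma> - \<beta> \<rho>' \<sigma>"
  unfolding \<beta>_def using bilin_diff_1[OF assms] assms
  by (subst L1_embed_diff[symmetric]) (auto intro!: L1_embed_cong)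

lemma \<beta>_diff_2:
  assumes "integrable \<nu> \<rho>" "integrable W \<sigma>" "integrable W \<sigma>'"
  shows "\<beta> \<rho> (\<lambda>y. \<sigma> y - \<sigma>' y) = \<beta> \<rho> \<sigma> - \<beta> \<rho> \<sigma>'"
  unfolding \<beta>_def using bilin_diff_2[OF assms] assms
  by (subst L1_embed_diff[symmetric]) (auto intro!: L1_embed_cong)

lemma \<beta>_scale_1:
  assumes "integrable \<nu> \<rho>" "integrable W \<sigma>"
  shows "\<beta> (\<lambda>x. r * \<rho> x) \<sigma> = r *\<^sub>R \<beta> \<rho> \<sigma>"
  unfolding \<beta>_def using assms by (simp add: L1_embed_scale[symmetric] bilin_scale_1[abs_def])

lemma \<beta>_scale_2:
  assumes "integrable \<nu> \<rho>" "integrable W \<sigma>"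
  shows "\<beta> \<rho> (\<lambda>y. r * \<sigma> y) = r *\<^sub>R \<beta> \<rho> \<sigma>"
  unfolding \<beta>_def using assms by (simp add: L1_embed_scale[symmetric] bilin_scale_2[abs_def])

lemma norm_\<beta>:
  assumes "integrable \<nu> \<rho>" "integrable W \<sigma>"
  shows "norm (\<beta> \<rho> \<sigma>) \<le> 2 * M * (L1_norm \<nu> \<rho> * L1_norm W \<sigma>)"
  unfolding \<beta>_def using assms bilin_norm[OF assms] by (simp add: norm_L1_embed mult.assoc)

text \<open>The weights are compared in L1 norm, the form in which \<open>tensor_lipschitz'\<close>
  delivers their agreement.\<close>

lemma \<beta>_cong:
  assumes \<rho>: "integrable \<nu> \<rho>" "integrable \<nu> \<rho>'" "AE x in \<nu>. \<rho> x = \<rho>' x"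
    and \<sigma>: "integrable W \<sigma>" "integrable W \<sigma>'" "L1_norm W (\<lambda>y. \<sigma> y - \<sigma>' y) = 0"
  shows "\<beta> \<rho> \<sigma> = \<beta> \<rho>' \<sigma>'"
proof -
  have "L1_norm \<nu> (\<lambda>x. \<rho> x - \<rho>' x) = 0"
    using \<rho> by (subst L1_norm_eq_0_iff) auto
  then have "norm (\<beta> \<rho> \<sigma> - \<beta> \<rho>' \<sigma>) \<le> 0"
    using norm_\<beta>[of "\<lambda>x. \<rho> x - \<rho>' x" \<sigma>] \<rho> \<sigma> by (simp add: \<beta>_diff_1)
  moreover have "norm (\<beta> \<rho>' \<sigma> - \<beta> \<rho>' \<sigma>') \<le> 0"
    using norm_\<beta>[of \<rho>' "\<lambda>y. \<sigma> y - \<sigma>' y"] \<rho> \<sigma> by (simp add: \<beta>_diff_2)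
  ultimately show ?thesis
    by simp
qed

text \<open>\<open>F\<close> is defined through a chosen representative. Two representatives of one
  class have tensor powers at L1 distance 0 by the Lipschitz bound, so the bilinear map sends them
  to the same element.\<close>

lemma F_embed:
  assumes \<rho>: "\<rho> \<in> prob_densities \<nu>"
  shows "F (L1_embed \<nu> \<rho>) = L1_embed \<nu> (mean_field \<rho>)"
proof -
  define \<rho>' where "\<rho>' = L1_rep \<nu> (L1_embed \<nu> \<rho>)"
  have int: "integrable \<nu> \<rho>"
    by (rule prob_densityD[OF \<rho>])
  have \<rho>'_int: "integrable \<nu> \<rho>'" and AE: "AE x in \<nu>. \<rho>' x = \<rho> x"
    using L1_rep(1)[OF L1_embed_mem[OF int]] L1_rep_embed[OF int] by (simp_all add: \<rho>'_def)
  then have \<rho>': "\<rho>' \<in> prob_densities \<nu>"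
    using \<rho> int by (auto simp: prob_densities_def cong: integral_cong_AE)
  have "L1_norm \<nu> (\<lambda>x. \<rho>' x - \<rho> x) = 0"
    using \<rho>'_int int AE by (subst L1_norm_eq_0_iff) auto
  then have "L1_norm W (\<lambda>y. tensor \<rho>' y - tensor \<rho> y) = 0"
    using tensor_lipschitz'[OF \<rho>' \<rho>] by (simp add: antisym)
  then have "\<beta> \<rho>' (tensor \<rho>') = \<beta> \<rho> (tensor \<rho>)"
    by (intro \<beta>_cong int \<rho>'_int AE tensor_density \<rho> \<rho>')
  then show ?thesis
    by (simp add: F_def mean_field_def \<beta>_def \<rho>'_def)
qed

text \<open>An everywhere nonnegative representative makes the truncation in \<open>tensor\<close>
  invisible.\<close>

lemma P_nonneg_rep:
  assumes "u \<in> P"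
  shows "\<exists>a. a \<in> prob_densities \<nu> \<and> (\<forall>x. 0 \<le> a x) \<and> u = L1_embed \<nu> a"
proof -
  from assms obtain \<rho> where \<rho>: "\<rho> \<in> prob_densities \<nu>" "u = L1_embed \<nu> \<rho>"
    unfolding P_eq by blast
  have "(\<lambda>x. max 0 (\<rho> x)) \<in> prob_densities \<nu>"
    using pos_part[OF \<rho>(1)] by (simp add: prob_densities_def L1_norm_def)
  moreover have "u = L1_embed \<nu> (\<lambda>x. max 0 (\<rho> x))"
    using pos_part[OF \<rho>(1)] prob_densityD[OF \<rho>(1)] by (auto simp: \<rho>(2) intro!: L1_embed_cong)
  ultimately show ?thesis
    by (intro exI[of _ "\<lambda>x. max 0 (\<rho> x)"]) auto
qed

text \<open>The shift M + 1 stays positive when M = 0. In the Lipschitz constant the factor 2 * M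
  bounds the bilinear map; the product rule gives 1 + n in front of the difference of quotients and
  n + n^2 in front of the mixed term, and 1 + n + n^2 dominates both.\<close>

sublocale mean_field_semigroup "L1_space \<nu>" T "L1_cone \<nu>" L1_mass F "M + 1" "2 * M * (1 + real n + (real n)\<^sup>2)"
proof unfold_locales
  show "0 < M + 1" "0 \<le> 2 * M * (1 + real n + (real n)\<^sup>2)"
    using M_nonneg by auto
next
  fix u assume "u \<in> P"
  from P_nonneg_rep[OF this] obtain a where a: "a \<in> prob_densities \<nu>" "\<And>x. 0 \<le> a x" "u = L1_embed \<nu> a"
    by blast
  note int = prob_densityD(1)[OF a(1)]
  show "F u \<in> L1_space \<nu>"
    by (simp add: a F_embed)
  show "L1_mass (F u) = 0"
    using a by (simp add: F_embed L1_mass_embed mean_field_def bilin_mass int tensor_density)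
  have "AE x in \<nu>. - M * a x \<le> mean_field a x"
    unfolding mean_field_def by (intro bilin_ge_loss int a tensor_density tensor_nonneg)
  then have "AE x in \<nu>. 0 \<le> mean_field a x + (M + 1) * a x"
    by eventually_elim (use a(2) in \<open>simp add: algebra_simps add_increasing2\<close>)
  moreover have "F u + (M + 1) *\<^sub>R u = L1_embed \<nu> (\<lambda>x. mean_field a x + (M + 1) * a x)"
    using a int by (simp add: F_embed L1_embed_add L1_embed_scale)
  ultimately show "F u + (M + 1) *\<^sub>R u \<in> L1_cone \<nu>"
    using a int by (simp add: L1_embed_in_cone_iff)
next
  fix u v v' and h l :: real
  assume uv: "u \<in> P" "v \<in> P" "v' \<in> P" and h: "0 < h" and l: "0 < l"
  from P_nonneg_rep[OF uv(1)] obtain a where a: "a \<in> prob_densities \<nu>" "\<And>x. 0 \<le> a x" "u = L1_embed \<nu> a"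
    by blast
  from P_nonneg_rep[OF uv(2)] obtain b where b: "b \<in> prob_densities \<nu>" "\<And>x. 0 \<le> b x" "v = L1_embed \<nu> b"
    by blast
  from P_nonneg_rep[OF uv(3)] obtain c where c: "c \<in> prob_densities \<nu>" "\<And>x. 0 \<le> c x" "v' = L1_embed \<nu> c"
    by blast
  define d where "d = (\<lambda>x. inverse h * (b x - a x))"
  define e where "e = (\<lambda>x. inverse l * (c x - a x))"
  define \<tau> where "\<tau> = (\<lambda>y. inverse h * (tensor b y - tensor a y) - inverse l * (tensor c y - tensor a y))"
  have int: "integrable \<nu> a" "integrable \<nu> b" "integrable \<nu> c"
    using a b c by (auto simp: prob_densityD)
  then have int': "integrable \<nu> (\<lambda>x. b x - a x)" "integrable \<nu> (\<lambda>x. c x - a x)" "integrable \<nu> d" "integrable \<nu> e"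
    by (auto simp: d_def e_def)
  note tint = tensor_density(1)[OF a(1)] tensor_density(1)[OF b(1)] tensor_density(1)[OF c(1)]
  have tint': "integrable W (\<lambda>y. tensor b y - tensor a y)" "integrable W (\<lambda>y. tensor c y - tensor a y)"
      "integrable W (\<lambda>y. tensor b y - tensor c y)" "integrable W \<tau>"
    using tint by (auto simp: \<tau>_def)
  let ?B = "\<lambda>\<rho> \<sigma>. \<beta> \<rho> (tensor \<sigma>)"
  have d: "\<beta> d \<sigma> = inverse h *\<^sub>R (\<beta> b \<sigma> - \<beta> a \<sigma>)" and e: "\<beta> e \<sigma> = inverse l *\<^sub>R (\<beta> c \<sigma> - \<beta> a \<sigma>)"
    if "integrable W \<sigma>" for \<sigma>
    unfolding d_def e_def using that int int' by (simp_all add: \<beta>_scale_1 \<beta>_diff_1)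
  have \<tau>: "\<beta> a \<tau> = inverse h *\<^sub>R (?B a b - ?B a a) - inverse l *\<^sub>R (?B a c - ?B a a)"
    unfolding \<tau>_def using int tint tint' by (simp add: \<beta>_scale_2 \<beta>_diff_2)
  have "(F v - F u) /\<^sub>R h - (F v' - F u) /\<^sub>R l = inverse h *\<^sub>R (?B b b - ?B a a) - inverse l *\<^sub>R (?B c c - ?B a a)"
    by (simp add: a b c F_embed mean_field_def \<beta>_def)
  \<comment> \<open>Product rule for the bilinear map: difference of quotients in the first
    argument, mixed term, difference of quotients of the weight.\<close>
  also have "\<dots> = \<beta> (\<lambda>x. d x - e x) (tensor b) + \<beta> e (\<lambda>y. tensor b y - tensor c y) + \<beta> a \<tau>"
    using int int' tint tint'
    by (simp add: \<beta>_diff_1 \<beta>_diff_2 d e \<tau>) (simp add: algebra_simps)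
  finally have eq: "(F v - F u) /\<^sub>R h - (F v' - F u) /\<^sub>R l =
      \<beta> (\<lambda>x. d x - e x) (tensor b) + \<beta> e (\<lambda>y. tensor b y - tensor c y) + \<beta> a \<tau>" .
  have "norm ((F v - F u) /\<^sub>R h - (F v' - F u) /\<^sub>R l) \<le> norm (\<beta> (\<lambda>x. d x - e x) (tensor b)) + norm (\<beta> e (\<lambda>y. tensor b y - tensor c y)) + norm (\<beta> a \<tau>)"
    unfolding eq by (intro norm_triangle_le add_mono order_refl norm_triangle_ineq)
  also have "\<dots> \<le> 2 * M * (L1_norm \<nu> (\<lambda>x. d x - e x) * L1_norm W (tensor b)) +
      2 * M * (L1_norm \<nu> e * L1_norm W (\<lambda>y. tensor b y - tensor c y)) + 2 * M * (L1_norm \<nu> a * L1_norm W \<tau>)"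
    by (rule add_mono[OF add_mono[OF norm_\<beta>[OF Bochner_Integration.integrable_diff[OF int'(3,4)] tint(2)]
        norm_\<beta>[OF int'(4) tint'(3)]] norm_\<beta>[OF int(1) tint'(4)]])
  also have "\<dots> \<le> 2 * M * (L1_norm \<nu> (\<lambda>x. d x - e x) * 1) +
      2 * M * (L1_norm \<nu> e * (real n * L1_norm \<nu> (\<lambda>x. b x - c x))) +
      2 * M * (1 * (real n * L1_norm \<nu> (\<lambda>x. d x - e x) + (real n)\<^sup>2 * L1_norm \<nu> (\<lambda>x. b x - c x) * L1_norm \<nu> e))"
  proof (intro add_mono)
    show "2 * M * (L1_norm \<nu> (\<lambda>x. d x - e x) * L1_norm W (tensor b)) \<le> 2 * M * (L1_norm \<nu> (\<lambda>x. d x - e x) * 1)"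
      by (simp add: tensor_density(3)[OF b(1)])
    show "2 * M * (L1_norm \<nu> e * L1_norm W (\<lambda>y. tensor b y - tensor c y))
        \<le> 2 * M * (L1_norm \<nu> e * (real n * L1_norm \<nu> (\<lambda>x. b x - c x)))"
      using tensor_lipschitz'[OF b(1) c(1)] M_nonneg by (intro mult_left_mono) auto
    have "L1_norm \<nu> a = 1"
      using pos_part(3)[OF a(1)] a(2) by (simp add: max_absorb2)
    moreover have "L1_norm W \<tau> \<le> real n * L1_norm \<nu> (\<lambda>x. d x - e x) + (real n)\<^sup>2 * L1_norm \<nu> (\<lambda>x. b x - c x) * L1_norm \<nu> e"
      unfolding \<tau>_def d_def e_def by (rule tensor_quotients'[OF a(1,2) b(1,2) c(1,2) h l])
    ultimately show "2 * M * (L1_norm \<nu> a * L1_norm W \<tau>) \<le>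
        2 * M * (1 * (real n * L1_norm \<nu> (\<lambda>x. d x - e x) + (real n)\<^sup>2 * L1_norm \<nu> (\<lambda>x. b x - c x) * L1_norm \<nu> e))"
      using M_nonneg by (simp add: mult_left_mono)
  qed
  also have "\<dots> \<le> 2 * M * (1 + real n + (real n)\<^sup>2) * L1_norm \<nu> (\<lambda>x. d x - e x) +
      2 * M * (1 + real n + (real n)\<^sup>2) * L1_norm \<nu> (\<lambda>x. b x - c x) * L1_norm \<nu> e"
  proof -
    have "0 \<le> 2 * M * ((real n)\<^sup>2 * L1_norm \<nu> (\<lambda>x. d x - e x))" "0 \<le> 2 * M * (L1_norm \<nu> (\<lambda>x. b x - c x) * L1_norm \<nu> e)"
      using M_nonneg by auto
    then show ?thesis
      by (simp add: algebra_simps)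
  qed
  finally have le: "norm ((F v - F u) /\<^sub>R h - (F v' - F u) /\<^sub>R l) \<le>
      2 * M * (1 + real n + (real n)\<^sup>2) * L1_norm \<nu> (\<lambda>x. d x - e x) +
      2 * M * (1 + real n + (real n)\<^sup>2) * L1_norm \<nu> (\<lambda>x. b x - c x) * L1_norm \<nu> e" .
  have n1: "norm ((v - u) /\<^sub>R h - (v' - u) /\<^sub>R l) = L1_norm \<nu> (\<lambda>x. d x - e x)"
    using int int' by (simp add: a b c L1_embed_diff[symmetric] L1_embed_scale[symmetric] norm_L1_embed d_def e_def)
  have n2: "norm (v - v') = L1_norm \<nu> (\<lambda>x. b x - c x)"
    using int by (simp add: b c norm_L1_embed_diff)
  have n3: "norm ((v' - u) /\<^sub>R l) = L1_norm \<nu> e"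
    using int int' by (simp add: a c L1_embed_diff[symmetric] L1_embed_scale[symmetric] norm_L1_embed e_def)
  show "norm ((F v - F u) /\<^sub>R h - (F v' - F u) /\<^sub>R l) \<le>
      2 * M * (1 + real n + (real n)\<^sup>2) * norm ((v - u) /\<^sub>R h - (v' - u) /\<^sub>R l) +
      2 * M * (1 + real n + (real n)\<^sup>2) * norm (v - v') * norm ((v' - u) /\<^sub>R l)"
    unfolding n1 n2 n3 by (rule le)
qed

end

section \<open>Logarithmic oscillation\<close>

lemma measurable_elog [measurable]: "elog \<in> borel_measurable borel"
  unfolding elog_def[abs_def] by measurable

lemma elog_diff_infinite: "\<not> 0 < r \<Longrightarrow> \<bar>elog r - elog s\<bar> = \<infinity>"
  by (simp add: elog_def)

text \<open>Almost everywhere statements are vacuous for the zero measure; a function with nonzero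
  integral excludes that case.\<close>

lemma AE_exists:
  assumes "AE x in \<nu>. Q x" "(\<integral>x. \<rho> x \<partial>\<nu>) \<noteq> (0::real)"
  shows "\<exists>x. Q x"
proof (rule ccontr)
  assume "\<nexists>x. Q x"
  then have "AE x in \<nu>. \<rho> x = 0"
    using assms(1) by (auto elim: eventually_mono)
  then have "(\<integral>x. \<rho> x \<partial>\<nu>) = 0"
    by (rule integral_eq_zero_AE)
  with assms(2) show False by simp
qed

lemma ess_osc_elog_le:
  assumes \<nu>: "finite_measure \<nu>" and \<rho> [measurable]: "\<rho> \<in> borel_measurable \<nu>"
    and ab: "0 < a" "0 < b" "AE x in \<nu>. a \<le> \<rho> x \<and> \<rho> x \<le> b"
  shows "ess_osc \<nu> (\<lambda>x. elog (\<rho> x)) \<le> ereal (ln b - ln a)"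
  unfolding ess_osc_def
proof (rule esssup_I)
  interpret finite_measure \<nu> by (rule \<nu>)
  interpret \<nu>\<nu>: pair_sigma_finite \<nu> \<nu> ..
  show "(\<lambda>(x, y). \<bar>elog (\<rho> x) - elog (\<rho> y)\<bar>) \<in> borel_measurable (\<nu> \<Otimes>\<^sub>M \<nu>)"
    by measurable
  show "AE p in \<nu> \<Otimes>\<^sub>M \<nu>. (case p of (x, y) \<Rightarrow> \<bar>elog (\<rho> x) - elog (\<rho> y)\<bar>) \<le> ereal (ln b - ln a)"
  proof (rule \<nu>\<nu>.AE_pair_measure)
    have "AE y in \<nu>. \<bar>elog (\<rho> x) - elog (\<rho> y)\<bar> \<le> ereal (ln b - ln a)" if x: "a \<le> \<rho> x \<and> \<rho> x \<le> b" for x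
      using ab(3)
    proof eventually_elim
      case (elim y)
      have "ln a \<le> ln (\<rho> z) \<and> ln (\<rho> z) \<le> ln b \<and> 0 < \<rho> z" if "a \<le> \<rho> z \<and> \<rho> z \<le> b" for z
        using that ab(1,2) by auto
      from this[OF x] this[OF elim] show ?case
        by (auto simp: elog_def)
    qed
    then show "AE x in \<nu>. AE y in \<nu>. (case (x, y) of (x, y) \<Rightarrow> \<bar>elog (\<rho> x) - elog (\<rho> y)\<bar>) \<le> ereal (ln b - ln a)"
      using ab(3) by (auto elim: eventually_mono)
  qed measurable
qed

text \<open>Turns finite oscillation into two-sided bounds without loss: b is the exponential of the
  essential supremum of ln \<rho>, and a is b times exp (- c) for the oscillation c. With such
  bounds, (iii) becomes the propagation of two constant barriers.\<close>

lemma ess_osc_elog_attained: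
  assumes \<nu>: "finite_measure \<nu>" and \<rho>: "\<rho> \<in> prob_densities \<nu>"
    and fin: "ess_osc \<nu> (\<lambda>x. elog (\<rho> x)) < \<infinity>"
  shows "\<exists>a b. 0 < a \<and> 0 < b \<and> (AE x in \<nu>. a \<le> \<rho> x \<and> \<rho> x \<le> b) \<and>
    ess_osc \<nu> (\<lambda>x. elog (\<rho> x)) = ereal (ln b - ln a)"
proof -
  interpret finite_measure \<nu> by (rule \<nu>)
  interpret \<nu>\<nu>: pair_sigma_finite \<nu> \<nu> ..
  let ?c = "ess_osc \<nu> (\<lambda>x. elog (\<rho> x))"
  have [measurable]: "\<rho> \<in> borel_measurable \<nu>" and mass: "(\<integral>x. \<rho> x \<partial>\<nu>) \<noteq> 0"
    using \<rho> by (auto simp: prob_densities_def)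
  have "AE p in \<nu> \<Otimes>\<^sub>M \<nu>. (case p of (x, y) \<Rightarrow> \<bar>elog (\<rho> x) - elog (\<rho> y)\<bar>) \<le> ?c"
    unfolding ess_osc_def by (rule esssup_AE)
  from \<nu>\<nu>.AE_pair[OF this] have osc: "AE x in \<nu>. AE y in \<nu>. \<bar>elog (\<rho> x) - elog (\<rho> y)\<bar> \<le> ?c"
    by simp
  \<comment> \<open>Two sample points show that the oscillation is nonnegative, hence a real number
    once it is finite.\<close>
  obtain x0 where x0: "AE y in \<nu>. \<bar>elog (\<rho> x0) - elog (\<rho> y)\<bar> \<le> ?c"
    using AE_exists[OF osc mass] by blast
  obtain y0 where y0: "\<bar>elog (\<rho> x0) - elog (\<rho> y0)\<bar> \<le> ?c"
    using AE_exists[OF x0 mass] by blast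
  have "0 \<le> ?c"
    using y0 by (rule order_trans[rotated]) simp
  then obtain c where c: "?c = ereal c" "0 \<le> c"
    using fin by (cases ?c) auto
  \<comment> \<open>Where the density is not positive, its extended logarithm is at infinite
    distance from every other value.\<close>
  have pos: "AE x in \<nu>. 0 < \<rho> x"
    using osc
  proof eventually_elim
    case (elim x)
    obtain y where "\<bar>elog (\<rho> x) - elog (\<rho> y)\<bar> \<le> ?c"
      using AE_exists[OF elim mass] by blast
    then show ?case
      using elog_diff_infinite[of "\<rho> x" "\<rho> y"] c by fastforce
  qed
  have real_osc: "AE x in \<nu>. AE y in \<nu>. \<bar>ln (\<rho> x) - ln (\<rho> y)\<bar> \<le> c"
    using osc[unfolded c(1)] pos
  proof eventually_elim
    case (elim x)
    from elim(1) pos show ?case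
      by eventually_elim (use elim(2) in \<open>simp add: elog_def\<close>)
  qed
  define B where "B = esssup \<nu> (\<lambda>x. ereal (ln (\<rho> x)))"
  have below: "AE x in \<nu>. ereal (ln (\<rho> x)) \<le> B"
    unfolding B_def by (rule esssup_AE)
  have above: "AE x in \<nu>. B \<le> ereal (ln (\<rho> x) + c)"
    using real_osc
  proof eventually_elim
    case (elim x)
    from elim have "AE y in \<nu>. ereal (ln (\<rho> y)) \<le> ereal (ln (\<rho> x) + c)"
      by eventually_elim auto
    then show ?case
      unfolding B_def by (intro esssup_I) auto
  qed
  have "AE x in \<nu>. ereal (ln (\<rho> x)) \<le> B \<and> B \<le> ereal (ln (\<rho> x) + c)"
    using below above by eventually_elim simp
  \<comment> \<open>A single point sandwiches \<open>B\<close> between two reals, so it is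
    finite.\<close>
  from AE_exists[OF this mass] obtain z where "ereal (ln (\<rho> z)) \<le> B" "B \<le> ereal (ln (\<rho> z) + c)"
    by blast
  then obtain b where b: "B = ereal b"
    by (cases B) auto
  have "AE x in \<nu>. exp (b - c) \<le> \<rho> x \<and> \<rho> x \<le> exp b"
    using below above pos
  proof eventually_elim
    case (elim x)
    then show ?case
      using ln_ge_iff[of "\<rho> x" "b - c"] ln_le_cancel_iff[of "\<rho> x" "exp b"] by (simp add: b)
  qed
  then show ?thesis
    by (intro exI[of _ "exp (b - c)"] exI[of _ "exp b"]) (simp add: c(1))
qed

context mean_field_kernel
begin

text \<open>A product measure is determined by its values on boxes, and there both sides factor. The
  truncation at 0 is the real form of what \<open>ennreal\<close> does to negative values.\<close>

lemma PiM_density: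
  assumes [measurable]: "\<rho> \<in> borel_measurable \<nu>" and prob: "prob_space (density \<nu> (\<lambda>x. ennreal (\<rho> x)))"
  shows "Pi\<^sub>M {..<n} (\<lambda>_. density \<nu> (\<lambda>x. ennreal (\<rho> x))) = density W (\<lambda>y. ennreal (\<Prod>i<n. max 0 (\<rho> (y i))))"
proof -
  interpret prob_space "density \<nu> (\<lambda>x. ennreal (\<rho> x))" by (rule prob)
  interpret D: product_sigma_finite "\<lambda>_::nat. density \<nu> (\<lambda>x. ennreal (\<rho> x))"
    by standard
  have pos_part: "ennreal (max 0 r) = ennreal r" for r :: real
    by (simp add: max_def ennreal_neg)
  have tensor: "ennreal (\<Prod>i<n. max 0 (\<rho> (y i))) = (\<Prod>i<n. ennreal (\<rho> (y i)))" for y :: "nat \<Rightarrow> 'a"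
    by (simp add: prod_ennreal[symmetric] pos_part)
  have [measurable]: "(\<lambda>y. \<Prod>i<n. ennreal (\<rho> (y i))) \<in> borel_measurable W"
    unfolding W_def
    by (intro borel_measurable_prod_ennreal measurable_compose[OF measurable_component_singleton]) auto
  have "density W (\<lambda>y. \<Prod>i<n. ennreal (\<rho> (y i))) = Pi\<^sub>M {..<n} (\<lambda>_. density \<nu> (\<lambda>x. ennreal (\<rho> x)))"
  proof (rule D.PiM_eqI)
    show "sets (density W (\<lambda>y. \<Prod>i<n. ennreal (\<rho> (y i)))) = sets (Pi\<^sub>M {..<n} (\<lambda>_. density \<nu> (\<lambda>x. ennreal (\<rho> x))))"
      by (simp add: W_def cong: sets_PiM_cong)
    fix A assume "\<And>i. i \<in> {..<n} \<Longrightarrow> A i \<in> sets (density \<nu> (\<lambda>x. ennreal (\<rho> x)))"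
    then have A: "\<And>i. i \<in> {..<n} \<Longrightarrow> A i \<in> sets \<nu>"
      by simp
    then have PA: "Pi\<^sub>E {..<n} A \<in> sets W"
      unfolding W_def by (intro sets_PiM_I_finite) auto
    have "emeasure (density W (\<lambda>y. \<Prod>i<n. ennreal (\<rho> (y i)))) (Pi\<^sub>E {..<n} A)
        = (\<integral>\<^sup>+y. (\<Prod>i<n. ennreal (\<rho> (y i))) * indicator (Pi\<^sub>E {..<n} A) y \<partial>W)"
      by (rule emeasure_density) (use PA in auto)
    also have "\<dots> = (\<integral>\<^sup>+y. (\<Prod>i<n. ennreal (\<rho> (y i)) * indicator (A i) (y i)) \<partial>W)"
    proof (rule nn_integral_cong)
      fix y assume "y \<in> space W"
      then have "y \<in> extensional {..<n}"
        unfolding W_def space_PiM PiE_def by blast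
      then have ind: "indicator (Pi\<^sub>E {..<n} A) y = (\<Prod>i<n. indicator (A i) (y i) :: ennreal)"
      proof (cases "y \<in> Pi\<^sub>E {..<n} A")
        case True
        then have "(\<Prod>i<n. indicator (A i) (y i) :: ennreal) = (\<Prod>i<n. 1)"
          by (intro prod.cong) (auto simp: PiE_iff)
        with True show ?thesis by simp
      next
        case False
        with \<open>y \<in> extensional {..<n}\<close> obtain i where "i < n" "y i \<notin> A i"
          by (auto simp: PiE_iff)
        then have "(\<Prod>i<n. indicator (A i) (y i) :: ennreal) = 0"
          by (intro prod_zero) (auto intro!: bexI[of _ i])
        with False show ?thesis by simp
      qed
      show "(\<Prod>i<n. ennreal (\<rho> (y i))) * indicator (Pi\<^sub>E {..<n} A) y
          = (\<Prod>i<n. ennreal (\<rho> (y i)) * indicator (A i) (y i))"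
        unfolding ind by (simp only: prod.distrib)
    qed
    also have "\<dots> = (\<Prod>i<n. \<integral>\<^sup>+z. ennreal (\<rho> z) * indicator (A i) z \<partial>\<nu>)"
      unfolding W_def using A by (intro product_nn_integral_prod) auto
    also have "\<dots> = (\<Prod>i<n. emeasure (density \<nu> (\<lambda>x. ennreal (\<rho> x))) (A i))"
      using A by (intro prod.cong emeasure_density[symmetric]) auto
    finally show "emeasure (density W (\<lambda>y. \<Prod>i<n. ennreal (\<rho> (y i)))) (Pi\<^sub>E {..<n} A)
        = (\<Prod>i<n. emeasure (density \<nu> (\<lambda>x. ennreal (\<rho> x))) (A i))" .
  qed simp
  then show ?thesis
    by (simp add: tensor)
qed

end

context mean_field_equation
begin

text \<open>The averaging measure has density \<open>tensor \<rho>\<close> with respect to the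
  product of copies of \<nu>, so averaging is the bilinear map at that weight.\<close>

lemma averaged_gen_eq:
  assumes \<rho>: "\<rho> \<in> prob_densities \<nu>"
  shows "(\<integral>y. gen y \<rho> x \<partial>Pi\<^sub>M {..<n} (\<lambda>_. density \<nu> (\<lambda>x. ennreal (\<rho> x)))) = mean_field \<rho> x"
proof -
  note D = prob_densityD[OF \<rho>]
  have [measurable]: "\<rho> \<in> borel_measurable \<nu>"
    using D by simp
  have "prob_space (density \<nu> (\<lambda>x. ennreal (\<rho> x)))"
  proof (rule prob_spaceI)
    have "emeasure (density \<nu> (\<lambda>x. ennreal (\<rho> x))) UNIV = (\<integral>\<^sup>+x. ennreal (\<rho> x) \<partial>\<nu>)"
      using sets.top[of \<nu>] by (subst emeasure_density) auto
    also have "\<dots> = 1"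
      using D by (simp add: nn_integral_eq_integral)
    finally show "emeasure (density \<nu> (\<lambda>x. ennreal (\<rho> x))) (space (density \<nu> (\<lambda>x. ennreal (\<rho> x)))) = 1"
      by simp
  qed
  then have "Pi\<^sub>M {..<n} (\<lambda>_. density \<nu> (\<lambda>x. ennreal (\<rho> x))) = density W (\<lambda>y. ennreal (tensor \<rho> y))"
    unfolding tensor_def by (intro PiM_density) simp
  then have "(\<integral>y. gen y \<rho> x \<partial>Pi\<^sub>M {..<n} (\<lambda>_. density \<nu> (\<lambda>x. ennreal (\<rho> x)))) = (\<integral>y. gen y \<rho> x \<partial>density W (\<lambda>y. ennreal (tensor \<rho> y)))"
    by simp
  also have "\<dots> = mean_field \<rho> x"
    using D unfolding mean_field_def bilin_def
    by (subst integral_real_density)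
      (auto intro!: measurable_gen_2 measurable_tensor' simp: tensor_nonneg borel_measurable_\<nu>[symmetric])
  finally show ?thesis .
qed

text \<open>The integral I is pinned down, up to a null set, by the equation it occurs in, so the
  existential quantifier disappears in the embedded space. The factors exp (0 * s) match
  \<open>mild\<close> at c = 0.\<close>

lemma duhamel_iff:
  assumes \<rho>: "\<And>s. 0 \<le> s \<Longrightarrow> \<rho> s \<in> prob_densities \<nu>" and t: "0 \<le> t"
    and G: "\<And>s. 0 \<le> s \<Longrightarrow> G s = mean_field (\<rho> s)"
  shows "(\<exists>I. has_L1_integral \<nu> (\<lambda>s. S (t - s) (G s)) I 0 t \<and> (AE x in \<nu>. \<rho> t x = S t (\<rho> 0) x + I x)) \<longleftrightarrow>
    ((\<lambda>s. exp (0 * s) *\<^sub>R T (t - s) (F (L1_embed \<nu> (\<rho> s)))) has_integral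
      (exp (0 * t) *\<^sub>R L1_embed \<nu> (\<rho> t) - T t (L1_embed \<nu> (\<rho> 0)))) {0..t}" (is "?L \<longleftrightarrow> ?R")
proof -
  have int: "integrable \<nu> (\<rho> s)" if "0 \<le> s" for s
    using prob_densityD(1)[OF \<rho>[OF that]] .
  have SG: "integrable \<nu> (S (t - s) (G s))" if "s \<in> {0..t}" for s
    using that by (simp add: G \<rho>)
  have emb: "L1_embed \<nu> (S (t - s) (G s)) = exp (0 * s) *\<^sub>R T (t - s) (F (L1_embed \<nu> (\<rho> s)))" if "s \<in> {0..t}" for s
    using that by (simp add: F_embed T_embed G \<rho>)
  have integral: "has_L1_integral \<nu> (\<lambda>s. S (t - s) (G s)) I 0 t \<longleftrightarrow> integrable \<nu> I \<and>
      ((\<lambda>s. exp (0 * s) *\<^sub>R T (t - s) (F (L1_embed \<nu> (\<rho> s)))) has_integral L1_embed \<nu> I) {0..t}" for I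
    using has_L1_integral_iff[of 0 t \<nu> "\<lambda>s. S (t - s) (G s)" I, OF SG] has_integral_cong[of "{0..t}", OF emb] by simp
  have eq: "(AE x in \<nu>. \<rho> t x = S t (\<rho> 0) x + I x) \<longleftrightarrow>
      L1_embed \<nu> I = exp (0 * t) *\<^sub>R L1_embed \<nu> (\<rho> t) - T t (L1_embed \<nu> (\<rho> 0))" if "integrable \<nu> I" for I
  proof -
    have "(AE x in \<nu>. \<rho> t x = S t (\<rho> 0) x + I x) \<longleftrightarrow> L1_embed \<nu> (\<rho> t) = L1_embed \<nu> (\<lambda>x. S t (\<rho> 0) x + I x)"
      using that t int by (subst L1_embed_eq_iff) auto
    also have "\<dots> \<longleftrightarrow> L1_embed \<nu> (\<rho> t) = T t (L1_embed \<nu> (\<rho> 0)) + L1_embed \<nu> I"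
      using that t int by (simp add: L1_embed_add T_embed)
    also have "\<dots> \<longleftrightarrow> L1_embed \<nu> I = exp (0 * t) *\<^sub>R L1_embed \<nu> (\<rho> t) - T t (L1_embed \<nu> (\<rho> 0))"
      by (auto simp: algebra_simps)
    finally show ?thesis .
  qed
  show ?thesis
  proof
    assume ?L
    then obtain I where I: "has_L1_integral \<nu> (\<lambda>s. S (t - s) (G s)) I 0 t" "AE x in \<nu>. \<rho> t x = S t (\<rho> 0) x + I x"
      by blast
    note I_int = I(1)[unfolded integral]
    show ?R
      using conjunct2[OF I_int] I(2) unfolding eq[OF conjunct1[OF I_int]] by (simp only:)
  next
    assume ?R
    define I where "I = (\<lambda>x. \<rho> t x - S t (\<rho> 0) x)"
    have I: "integrable \<nu> I"
      using int t by (simp add: I_def)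
    moreover have "AE x in \<nu>. \<rho> t x = S t (\<rho> 0) x + I x"
      by (simp add: I_def)
    moreover from this \<open>?R\<close> have "has_L1_integral \<nu> (\<lambda>s. S (t - s) (G s)) I 0 t"
      unfolding integral eq[OF I] by (simp only: I)
    ultimately show ?L
      by blast
  qed
qed

end

section \<open>The averaged mean-field equation\<close>

context mean_field_equation
begin

text \<open>With the weight \<open>tensor a\<close> frozen the generator is linear in the density
  acted on. Writing a = q + b or a = q - b with b nonnegative, the rate bound handles q and the loss
  bound handles b; the shift M + 1 leaves at least b itself as surplus.\<close>

lemma constant_profile_bounds:
  assumes \<kappa>: "integrable \<nu> \<kappa>"
    and rate: "\<And>y. y \<in> space W \<Longrightarrow> AE x in \<nu>. \<bar>\<kappa> x + gen y (\<lambda>_. 1) x\<bar> \<le> r"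
    and v: "v \<in> P" and q: "0 \<le> q"
  defines "e \<equiv> L1_embed \<nu> (\<lambda>_. 1)" and "k' \<equiv> L1_embed \<nu> \<kappa>"
  shows "v - q *\<^sub>R e \<in> L1_cone \<nu> \<Longrightarrow> F v + (M + 1) *\<^sub>R v - q *\<^sub>R ((M + 1 - r) *\<^sub>R e - k') \<in> L1_cone \<nu>"
    and "q *\<^sub>R e - v \<in> L1_cone \<nu> \<Longrightarrow> q *\<^sub>R ((M + 1 + r) *\<^sub>R e - k') - (F v + (M + 1) *\<^sub>R v) \<in> L1_cone \<nu>"
proof -
  from P_nonneg_rep[OF v] obtain a where a: "a \<in> prob_densities \<nu>" "v = L1_embed \<nu> a"
    by blast
  note int = prob_densityD(1)[OF a(1)] and one = \<nu>.integrable_const[of "1::real"]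
  let ?\<tau> = "tensor a"
  note \<tau> = tensor_density(1)[OF a(1)] tensor_nonneg tensor_density(2)[OF a(1)]
  have bil_int: "integrable \<nu> (bilin f ?\<tau>)" if "integrable \<nu> f" for f
    using that \<tau> by simp
  have rate_low: "AE x in \<nu>. - r - \<kappa> x \<le> bilin (\<lambda>_. 1) ?\<tau> x"
  proof (rule bilin_lower[OF one \<tau>])
    show "AE x in \<nu>. - r - \<kappa> x \<le> gen y (\<lambda>_. 1) x" if "y \<in> space W" for y
      using rate[OF that] by eventually_elim linarith
  qed (use \<kappa> in simp)
  have rate_up: "AE x in \<nu>. bilin (\<lambda>_. 1) ?\<tau> x \<le> r - \<kappa> x"
  proof (rule bilin_upper[OF one \<tau>])
    show "AE x in \<nu>. gen y (\<lambda>_. 1) x \<le> r - \<kappa> x" if "y \<in> space W" for y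
      using rate[OF that] by eventually_elim linarith
  qed (use \<kappa> in simp)
  have Fv: "F v = L1_embed \<nu> (bilin a ?\<tau>)"
    using a by (simp add: F_embed mean_field_def)
  \<comment> \<open>The sign \<epsilon> is 1 for the lower barrier and - 1 for the upper one, which
    treats a = q + b and a = q - b at once.\<close>
  have split: "AE x in \<nu>. bilin a ?\<tau> x = \<epsilon> * bilin b ?\<tau> x + q * bilin (\<lambda>_. 1) ?\<tau> x"
    if b: "integrable \<nu> b" "AE x in \<nu>. \<epsilon> * b x = a x - q * 1" for b \<epsilon>
  proof -
    have "\<epsilon> *\<^sub>R \<beta> b ?\<tau> = \<beta> (\<lambda>x. \<epsilon> * b x) ?\<tau>"
      using b \<tau> by (simp add: \<beta>_scale_1)
    also have "\<dots> = \<beta> (\<lambda>x. a x - q * 1) ?\<tau>"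
      using b int one \<tau> by (intro \<beta>_cong) (auto simp: L1_norm_def)
    also have "\<dots> = \<beta> a ?\<tau> - q *\<^sub>R \<beta> (\<lambda>_. 1) ?\<tau>"
      using int one \<tau> \<beta>_diff_1[of a "\<lambda>x. q * 1" ?\<tau>] \<beta>_scale_1[OF one \<tau>(1), of q] by simp
    finally have "L1_embed \<nu> (bilin a ?\<tau>) = L1_embed \<nu> (\<lambda>x. \<epsilon> * bilin b ?\<tau> x + q * bilin (\<lambda>_. 1) ?\<tau> x)"
      using b(1) one bil_int by (simp add: \<beta>_def L1_embed_add L1_embed_scale)
    then show ?thesis
      using b(1) one int bil_int by (subst (asm) L1_embed_eq_iff) auto
  qed
  show "F v + (M + 1) *\<^sub>R v - q *\<^sub>R ((M + 1 - r) *\<^sub>R e - k') \<in> L1_cone \<nu>"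
    if cone: "v - q *\<^sub>R e \<in> L1_cone \<nu>"
  proof -
    \<comment> \<open>The truncation makes b nonnegative everywhere, as \<open>bilin_ge_loss\<close>
      asks; by the cone condition it changes a - q on a null set only.\<close>
    define b where "b x = max 0 (a x - q * 1)" for x
    have b: "integrable \<nu> b" "\<And>x. 0 \<le> b x"
      using int one unfolding b_def by (auto intro!: Bochner_Integration.integrable_max)
    have "v - q *\<^sub>R e = L1_embed \<nu> (\<lambda>x. a x - q * 1)"
      using int one by (subst L1_embed_diff) (auto simp: a e_def L1_embed_scale[OF one, of q, simplified])
    with cone have "AE x in \<nu>. 0 \<le> a x - q * 1"
      using int one by (simp add: L1_embed_in_cone_iff)
    then have ba: "AE x in \<nu>. 1 * b x = a x - q * 1"
      by eventually_elim (simp add: b_def)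
    have "F v + (M + 1) *\<^sub>R v - q *\<^sub>R ((M + 1 - r) *\<^sub>R e - k')
        = L1_embed \<nu> (\<lambda>x. bilin a ?\<tau> x + (M + 1) * a x - q * ((M + 1 - r) * 1 - \<kappa> x))"
      unfolding Fv unfolding a(2) e_def k'_def using int one \<kappa> bil_int
      by (simp only: L1_embed_add L1_embed_diff L1_embed_scale Bochner_Integration.integrable_add
          Bochner_Integration.integrable_diff integrable_mult_right)
    moreover have "AE x in \<nu>. 0 \<le> bilin a ?\<tau> x + (M + 1) * a x - q * ((M + 1 - r) * 1 - \<kappa> x)"
      using split[OF b(1) ba] ba rate_low bilin_ge_loss[OF b \<tau>]
    proof eventually_elim
      case (elim x)
      have "q * (- r - \<kappa> x) \<le> q * bilin (\<lambda>_. 1) ?\<tau> x"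
        using elim(3) q by (rule mult_left_mono)
      moreover have "a x = b x + q"
        using elim(2) by simp
      ultimately show ?case
        using elim(1,4) b(2)[of x] by (simp add: algebra_simps)
    qed
    ultimately show ?thesis
      using int one \<kappa> bil_int by (simp add: L1_embed_in_cone_iff)
  qed
  show "q *\<^sub>R ((M + 1 + r) *\<^sub>R e - k') - (F v + (M + 1) *\<^sub>R v) \<in> L1_cone \<nu>"
    if cone: "q *\<^sub>R e - v \<in> L1_cone \<nu>"
  proof -
    define b where "b x = max 0 (q * 1 - a x)" for x
    have b: "integrable \<nu> b" "\<And>x. 0 \<le> b x"
      using int one unfolding b_def by (auto intro!: Bochner_Integration.integrable_max)
    have "q *\<^sub>R e - v = L1_embed \<nu> (\<lambda>x. q * 1 - a x)"
      using int one by (subst L1_embed_diff) (auto simp: a e_def L1_embed_scale[OF one, of q, simplified])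
    with cone have "AE x in \<nu>. 0 \<le> q * 1 - a x"
      using int one by (simp add: L1_embed_in_cone_iff)
    then have ba: "AE x in \<nu>. - 1 * b x = a x - q * 1"
      by eventually_elim (simp add: b_def)
    have "q *\<^sub>R ((M + 1 + r) *\<^sub>R e - k') - (F v + (M + 1) *\<^sub>R v)
        = L1_embed \<nu> (\<lambda>x. q * ((M + 1 + r) * 1 - \<kappa> x) - (bilin a ?\<tau> x + (M + 1) * a x))"
      unfolding Fv unfolding a(2) e_def k'_def using int one \<kappa> bil_int
      by (simp only: L1_embed_add L1_embed_diff L1_embed_scale Bochner_Integration.integrable_add
          Bochner_Integration.integrable_diff integrable_mult_right)
    moreover have "AE x in \<nu>. 0 \<le> q * ((M + 1 + r) * 1 - \<kappa> x) - (bilin a ?\<tau> x + (M + 1) * a x)"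
      using split[OF b(1) ba] ba rate_up bilin_ge_loss[OF b \<tau>]
    proof eventually_elim
      case (elim x)
      have "q * bilin (\<lambda>_. 1) ?\<tau> x \<le> q * (r - \<kappa> x)"
        using elim(3) q by (rule mult_left_mono)
      moreover have ax: "a x = q - b x"
        using elim(2) by simp
      ultimately show ?case
        unfolding ax using elim(1,4) b(2)[of x] by (simp add: algebra_simps)
    qed
    ultimately show ?thesis
      using int one \<kappa> bil_int by (simp add: L1_embed_in_cone_iff)
  qed
qed

end

section \<open>From empirical jump kernels to the abstract setting\<close>

lemma measure_le_kernel_bound:
  fixes \<Lambda> :: "'a::topological_space measure \<Rightarrow> 'a \<Rightarrow> 'a measure"
  assumes "\<mu> \<in> empirical_measures N" "\<Lambda> \<mu> \<in> J_plus"
  shows "ereal (measure (\<Lambda> \<mu> x) UNIV) \<le> kernel_bound N \<Lambda>"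
proof -
  have "space (\<Lambda> \<mu> x) = UNIV"
    using assms(2) sets_eq_imp_space_eq[of "\<Lambda> \<mu> x" borel] by (simp add: J_plus_def)
  then have "ereal (measure (\<Lambda> \<mu> x) UNIV) = ereal \<bar>\<integral>z. 1 \<partial>\<Lambda> \<mu> x\<bar>"
    by simp
  \<comment> \<open>The constant 1 is an admissible test function, and the total mass is the
    integral against it.\<close>
  also have "\<dots> \<le> tv_norm (\<Lambda> \<mu> x)"
    unfolding tv_norm_def by (rule SUP_upper) simp
  also have "\<dots> \<le> J_norm (\<Lambda> \<mu>)"
    unfolding J_norm_def by (rule SUP_upper) simp
  also have "\<dots> \<le> kernel_bound N \<Lambda>"
    unfolding kernel_bound_def by (rule SUP_upper) (rule assms(1))
  finally show ?thesis .
qed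

lemma empirical_measure_mem [simp]: "empirical_measure (N - 1) y \<in> empirical_measures N"
  by (simp add: empirical_measures_def)

locale averaged_mean_field =
  fixes \<nu> :: "'a::polish_space measure" and N :: nat
    and S :: "real \<Rightarrow> ('a \<Rightarrow> real) \<Rightarrow> 'a \<Rightarrow> real"
    and D :: "('a \<Rightarrow> real) set" and K :: "('a \<Rightarrow> real) \<Rightarrow> 'a \<Rightarrow> real"
    and \<Lambda> \<Lambda>s :: "'a measure \<Rightarrow> 'a \<Rightarrow> 'a measure"
  assumes fin: "finite_measure \<nu>" and sets: "sets \<nu> = sets borel"
    and semigroup: "adjoint_Markov_semigroup \<nu> S" and gen: "infinitesimal_generator \<nu> S D K"
    and kernel: "empirical_jump_kernel N \<Lambda>" and bound: "kernel_bound N \<Lambda> < \<infinity>"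
    and adj: "\<forall>\<mu>\<in>empirical_measures N. adjoint_kernel \<nu> (\<Lambda> \<mu>) (\<Lambda>s \<mu>)" and adj_meas: "jointly_measurable N \<Lambda>s"
begin

lemma \<Lambda>_J: "\<Lambda> (empirical_measure (N - 1) y) \<in> J_plus"
  using kernel empirical_measure_mem[of N y] unfolding empirical_jump_kernel_def J_plus0_def by blast

lemma \<Lambda>s_J: "\<Lambda>s (empirical_measure (N - 1) y) \<in> J_plus"
  using adj empirical_measure_mem[of N y] unfolding adjoint_kernel_def by blast

lemma kernel_bound_real: "kernel_bound N \<Lambda> = ereal (real_of_ereal (kernel_bound N \<Lambda>))"
proof -
  have "ereal 0 \<le> kernel_bound N \<Lambda>"
    by (rule order_trans[OF _ measure_le_kernel_bound[of _ N \<Lambda>, OF empirical_measure_mem \<Lambda>_J]]) simp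
  then show ?thesis
    using bound by (cases "kernel_bound N \<Lambda>") auto
qed

sublocale mean_field_equation \<nu> S "N - 1" "\<lambda>y. \<Lambda> (empirical_measure (N - 1) y)"
  "\<lambda>y. \<Lambda>s (empirical_measure (N - 1) y)" "real_of_ereal (kernel_bound N \<Lambda>)"
proof (intro mean_field_equation.intro adjoint_Markov.intro mean_field_kernel.intro)
  show "adjoint_Markov_semigroup \<nu> S" "finite_measure \<nu>" "sets \<nu> = sets borel"
    by (fact semigroup fin sets)+
  fix y :: "nat \<Rightarrow> 'a" and x
  let ?\<mu> = "empirical_measure (N - 1) y"
  show "finite_measure (\<Lambda> ?\<mu> x)" "sets (\<Lambda> ?\<mu> x) = sets borel" "finite_measure (\<Lambda>s ?\<mu> x)" "sets (\<Lambda>s ?\<mu> x) = sets borel"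
    using \<Lambda>_J[of y] \<Lambda>s_J[of y] by (auto simp: J_plus_def)
  show "measure (\<Lambda> ?\<mu> x) UNIV \<le> real_of_ereal (kernel_bound N \<Lambda>)"
    using measure_le_kernel_bound[of _ N \<Lambda>, OF empirical_measure_mem \<Lambda>_J] kernel_bound_real by (metis ereal_less_eq(3))
  show "(\<integral>\<^sup>+x. emeasure (\<Lambda> ?\<mu> x) {z. (x, z) \<in> C} \<partial>\<nu>) = (\<integral>\<^sup>+z. emeasure (\<Lambda>s ?\<mu> z) {x. (x, z) \<in> C} \<partial>\<nu>)"
    if "C \<in> sets (borel \<Otimes>\<^sub>M borel)" for C
    using adj that empirical_measure_mem[of N y] unfolding adjoint_kernel_def by blast
next
  fix A :: "'a set" assume "A \<in> sets borel"
  then show "(\<lambda>(y, x). measure (\<Lambda> (empirical_measure (N - 1) y) x) A) \<in> borel_measurable (Pi\<^sub>M {..<N - 1} (\<lambda>_. borel) \<Otimes>\<^sub>M borel)"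
    "(\<lambda>(y, x). measure (\<Lambda>s (empirical_measure (N - 1) y) x) A) \<in> borel_measurable (Pi\<^sub>M {..<N - 1} (\<lambda>_. borel) \<Otimes>\<^sub>M borel)"
    using kernel adj_meas by (auto simp: empirical_jump_kernel_def jointly_measurable_def)
qed

lemma mean_field_term_eq:
  assumes "\<rho> \<in> prob_densities \<nu>"
  shows "mean_field_term \<nu> N \<Lambda> \<Lambda>s \<rho> = mean_field \<rho>"
  by (rule ext) (simp only: averaged_adjoint_generator_def averaged_gen_eq[OF assms, unfolded gen_def])

text \<open>On curves of densities each clause translates separately, and the initial condition is
  contained in the Duhamel formula at time 0. For all other curves both sides are false.\<close>

lemma mild_solution_iff:
  assumes \<rho>0: "\<rho>0 \<in> prob_densities \<nu>"
  shows "mild_solution \<nu> S N \<Lambda> \<Lambda>s \<rho>0 \<rho> \<longleftrightarrow>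
    (\<forall>t\<ge>0. \<rho> t \<in> prob_densities \<nu>) \<and> continuous_on {0..} (\<lambda>t. L1_embed \<nu> (\<rho> t)) \<and>
    mild 0 (\<lambda>s. F (L1_embed \<nu> (\<rho> s))) (L1_embed \<nu> \<rho>0) (\<lambda>t. L1_embed \<nu> (\<rho> t))"
proof (cases "\<forall>t\<ge>0. \<rho> t \<in> prob_densities \<nu>")
  case True
  then have \<rho>: "\<rho> t \<in> prob_densities \<nu>" if "0 \<le> t" for t
    using that by blast
  have int: "integrable \<nu> (\<rho> t)" if "0 \<le> t" for t
    by (rule prob_densityD(1)[OF \<rho>[OF that]])
  have int0: "integrable \<nu> \<rho>0"
    by (rule prob_densityD(1)[OF \<rho>0])
  have cont: "L1_continuous_on \<nu> {0..} \<rho> \<longleftrightarrow> continuous_on {0..} (\<lambda>t. L1_embed \<nu> (\<rho> t))"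
    by (rule L1_continuous_on_iff) (simp add: int)
  have init: "(AE x in \<nu>. \<rho> 0 x = \<rho>0 x) \<longleftrightarrow> L1_embed \<nu> (\<rho> 0) = L1_embed \<nu> \<rho>0"
    by (simp add: L1_embed_eq_iff int int0)
  have duhamel: "(\<forall>t\<ge>0. \<exists>I. has_L1_integral \<nu> (\<lambda>s. S (t - s) (mean_field_term \<nu> N \<Lambda> \<Lambda>s (\<rho> s))) I 0 t \<and>
      (AE x in \<nu>. \<rho> t x = S t (\<rho> 0) x + I x)) \<longleftrightarrow>
      mild 0 (\<lambda>s. F (L1_embed \<nu> (\<rho> s))) (L1_embed \<nu> (\<rho> 0)) (\<lambda>t. L1_embed \<nu> (\<rho> t))"
    unfolding mild_def
    by (intro all_cong imp_cong refl duhamel_iff \<rho> mean_field_term_eq)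
  have "mild 0 (\<lambda>s. F (L1_embed \<nu> (\<rho> s))) (L1_embed \<nu> \<rho>0) (\<lambda>t. L1_embed \<nu> (\<rho> t))
      \<Longrightarrow> L1_embed \<nu> (\<rho> 0) = L1_embed \<nu> \<rho>0"
    by (erule mild_at_0[where u = "\<lambda>t. L1_embed \<nu> (\<rho> t)"]) (rule L1_embed_mem[OF int0])
  then show ?thesis
    unfolding mild_solution_def duhamel cont init using True by auto
qed (unfold mild_solution_def, blast)

lemma mild_solution_exists_unique:
  assumes \<rho>0: "\<rho>0 \<in> prob_densities \<nu>"
  shows "\<exists>\<rho>. mild_solution \<nu> S N \<Lambda> \<Lambda>s \<rho>0 \<rho> \<and>
    (\<forall>\<rho>'. mild_solution \<nu> S N \<Lambda> \<Lambda>s \<rho>0 \<rho>' \<longrightarrow> (\<forall>t\<ge>0. AE x in \<nu>. \<rho>' t x = \<rho> t x))"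
proof -
  have "L1_embed \<nu> \<rho>0 \<in> P"
    using \<rho>0 by (simp add: P_eq)
  from mild_exists[OF this] obtain u where u: "continuous_on {0..} u" "\<And>t. 0 \<le> t \<Longrightarrow> u t \<in> P"
      "mild 0 (\<lambda>s. F (u s)) (L1_embed \<nu> \<rho>0) u"
    by blast
  define \<rho> where "\<rho> t = L1_rep \<nu> (u t)" for t
  have emb: "L1_embed \<nu> (\<rho> t) = u t" and int: "integrable \<nu> (\<rho> t)" if "0 \<le> t" for t
    using L1_rep[OF P_V[OF u(2)[OF that]]] by (simp_all add: \<rho>_def)
  have \<rho>P: "\<rho> t \<in> prob_densities \<nu>" if "0 \<le> t" for t
    using u(2)[OF that] L1_embed_in_P[OF int[OF that]] emb[OF that] by simp
  have mild_\<rho>: "mild 0 (\<lambda>s. F (L1_embed \<nu> (\<rho> s))) (L1_embed \<nu> \<rho>0) (\<lambda>t. L1_embed \<nu> (\<rho> t))"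
    unfolding mild_def
  proof safe
    fix t :: real assume t: "0 \<le> t"
    have "((\<lambda>s. exp (0 * s) *\<^sub>R T (t - s) (F (u s))) has_integral (exp (0 * t) *\<^sub>R u t - T t (L1_embed \<nu> \<rho>0))) {0..t}"
      using u(3) t unfolding mild_def by blast
    then show "((\<lambda>s. exp (0 * s) *\<^sub>R T (t - s) (F (L1_embed \<nu> (\<rho> s)))) has_integral
        (exp (0 * t) *\<^sub>R L1_embed \<nu> (\<rho> t) - T t (L1_embed \<nu> \<rho>0))) {0..t}"
      unfolding emb[OF t] by (rule has_integral_eq[rotated]) (simp add: emb)
  qed
  have cont: "continuous_on {0..} (\<lambda>t. L1_embed \<nu> (\<rho> t))"
    using u(1) by (rule continuous_on_eq) (simp add: emb)
  have "mild_solution \<nu> S N \<Lambda> \<Lambda>s \<rho>0 \<rho>"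
    unfolding mild_solution_iff[OF \<rho>0] using \<rho>P cont mild_\<rho> by blast
  moreover have "AE x in \<nu>. \<rho>' t x = \<rho> t x" if \<rho>': "mild_solution \<nu> S N \<Lambda> \<Lambda>s \<rho>0 \<rho>'" and t: "0 \<le> t" for \<rho>' t
  proof -
    note \<rho>' = \<rho>'[unfolded mild_solution_iff[OF \<rho>0]]
    have \<rho>'P: "\<rho>' t \<in> prob_densities \<nu>" if "0 \<le> t" for t
      using \<rho>' that by blast
    have "L1_embed \<nu> (\<rho>' t) = L1_embed \<nu> (\<rho> t)"
    proof (rule mild_unique[where u = "\<lambda>t. L1_embed \<nu> (\<rho>' t)" and v = "\<lambda>t. L1_embed \<nu> (\<rho> t)"])
      show "L1_embed \<nu> (\<rho>' t) \<in> P" "L1_embed \<nu> (\<rho> t) \<in> P" if "0 \<le> t" for t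
        using \<rho>'P[OF that] \<rho>P[OF that] by (auto simp: P_eq)
    qed (use \<rho>' cont mild_\<rho> t in blast)+
    then show ?thesis
      using prob_densityD(1)[OF \<rho>'P[OF t]] int[OF t] by (simp add: L1_embed_eq_iff)
  qed
  ultimately show ?thesis
    by blast
qed

lemma generates_K:
  assumes "f \<in> D"
  shows "integrable \<nu> f" "integrable \<nu> (K f)" "generates (L1_embed \<nu> f) (L1_embed \<nu> (K f))"
proof -
  show f: "integrable \<nu> f" and Kf: "integrable \<nu> (K f)"
    using gen assms unfolding infinitesimal_generator_def by blast+
  have "L1_tendsto \<nu> (\<lambda>h x. (S h f x - f x) / h) (K f) (at_right 0)"
    using gen assms unfolding infinitesimal_generator_def by blast
  then show "generates (L1_embed \<nu> f) (L1_embed \<nu> (K f))"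
    by (simp add: generates_embed_iff f Kf)
qed

text \<open>Limits are unique in the embedded space, so any limit of the generator quotients agrees
  with \<open>K f\<close> up to a null set.\<close>

lemma in_domainI:
  assumes f: "integrable \<nu> f" "integrable \<nu> g" "generates (L1_embed \<nu> f) (L1_embed \<nu> g)"
  shows "f \<in> D" "AE x in \<nu>. K f x = g x"
proof -
  have "L1_tendsto \<nu> (\<lambda>h x. (S h f x - f x) / h) g (at_right 0)"
    using f by (simp add: generates_embed_iff)
  then show D: "f \<in> D"
    using gen f(1,2) unfolding infinitesimal_generator_def by blast
  have "L1_embed \<nu> (K f) = L1_embed \<nu> g"
    using generates_K(3)[OF D] f(3) unfolding generates_def
    by (rule tendsto_unique[rotated]) simp
  then show "AE x in \<nu>. K f x = g x"
    using L1_embed_eq_iff[OF generates_K(2)[OF D] f(2)] by simp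
qed

lemma mild_solution_classical:
  assumes \<rho>0: "\<rho>0 \<in> prob_densities \<nu>" and mild: "mild_solution \<nu> S N \<Lambda> \<Lambda>s \<rho>0 \<rho>" and D: "\<rho>0 \<in> D"
  shows "classical_solution \<nu> D K N \<Lambda> \<Lambda>s \<rho>0 \<rho>"
proof -
  note m = mild[unfolded mild_solution_iff[OF \<rho>0]]
  have \<rho>P: "\<rho> t \<in> prob_densities \<nu>" if "0 \<le> t" for t
    using m that by blast
  have int: "integrable \<nu> (\<rho> t)" if "0 \<le> t" for t
    by (rule prob_densityD(1)[OF \<rho>P[OF that]])
  let ?u = "\<lambda>t. L1_embed \<nu> (\<rho> t)"
  have uP: "?u t \<in> P" if "0 \<le> t" for t
    using \<rho>P[OF that] by (simp add: P_eq)
  have xP: "L1_embed \<nu> \<rho>0 \<in> P"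
    using \<rho>0 by (simp add: P_eq)
  have "\<exists>w. continuous_on {0..} w \<and> (\<forall>t\<ge>0. (?u has_vector_derivative w t) (at t within {0..}) \<and>
      generates (?u t) (w t - F (?u t)))"
    using m uP by (intro mild_classical[OF _ _ _ xP generates_K(3)[OF D]]) blast+
  then obtain w where w: "continuous_on {0..} w"
      "\<And>t. 0 \<le> t \<Longrightarrow> (?u has_vector_derivative w t) (at t within {0..})"
      "\<And>t. 0 \<le> t \<Longrightarrow> generates (?u t) (w t - F (?u t))"
    by blast
  define \<rho>' where "\<rho>' t = L1_rep \<nu> (w t)" for t
  have wV: "w t \<in> L1_space \<nu>" if t: "0 \<le> t" for t
    using V_add[OF generates_mem[OF w(3)[OF t] P_V[OF uP[OF t]]] F_mem[OF uP[OF t]]] by simp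
  have emb: "L1_embed \<nu> (\<rho>' t) = w t" and int': "integrable \<nu> (\<rho>' t)" if "0 \<le> t" for t
    using L1_rep[OF wV[OF that]] by (simp_all add: \<rho>'_def)
  have "L1_continuous_on \<nu> {0..} \<rho>'"
    using L1_continuous_on_iff[of "{0..}" \<nu> \<rho>'] int' continuous_on_eq[OF w(1), of "\<lambda>t. L1_embed \<nu> (\<rho>' t)"]
    by (simp add: emb)
  moreover have "has_L1_derivative \<nu> \<rho> (\<rho>' t) t {0..}" if t: "0 \<le> t" for t
  proof -
    have quot_int: "integrable \<nu> (\<lambda>x. (\<rho> s x - \<rho> t x) / (s - t))" if "s \<in> {0..}" for s
      using that t by (intro integrable_divide Bochner_Integration.integrable_diff int) auto
    have quot: "(?u s - ?u t) /\<^sub>R (s - t) = L1_embed \<nu> (\<lambda>x. (\<rho> s x - \<rho> t x) / (s - t))" if "s \<in> {0..}" for s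
      using L1_embed_scale[of \<nu> "\<lambda>x. \<rho> s x - \<rho> t x" "inverse (s - t)"] that t int
      by (simp add: L1_embed_diff divide_inverse mult.commute)
    have ev: "\<forall>\<^sub>F s in at t within {0..}. s \<in> {0..}"
      by (simp add: eventually_at_filter)
    have "((\<lambda>s. (?u s - ?u t) /\<^sub>R (s - t)) \<longlongrightarrow> w t) (at t within {0..})"
      using w(2)[OF t] by (simp add: has_vector_derivative_iff_quotient)
    then have "((\<lambda>s. L1_embed \<nu> (\<lambda>x. (\<rho> s x - \<rho> t x) / (s - t))) \<longlongrightarrow> L1_embed \<nu> (\<rho>' t)) (at t within {0..})"
      unfolding emb[OF t]
      by (rule Lim_transform_eventually) (rule eventually_mono[OF ev], rule quot)
    then have "L1_tendsto \<nu> (\<lambda>s x. (\<rho> s x - \<rho> t x) / (s - t)) (\<rho>' t) (at t within {0..})"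
      by (subst L1_tendsto_iff[OF eventually_mono[OF ev quot_int] int'[OF t]])
    then show ?thesis
      using int int'[OF t] by (auto simp: has_L1_derivative_def)
  qed
  moreover have "\<rho> t \<in> D \<and> (AE x in \<nu>. \<rho>' t x = K (\<rho> t) x + mean_field_term \<nu> N \<Lambda> \<Lambda>s (\<rho> t) x)" if t: "0 \<le> t" for t
  proof -
    \<comment> \<open>The generator value at \<rho> t is the time derivative minus the mean-field
      term. This yields domain membership and the equation at once.\<close>
    let ?g = "\<lambda>x. \<rho>' t x - mean_field (\<rho> t) x"
    have g_int: "integrable \<nu> ?g"
      by (intro Bochner_Integration.integrable_diff int'[OF t] integrable_mean_field[OF \<rho>P[OF t]])
    have "w t - F (?u t) = L1_embed \<nu> (\<rho>' t) - L1_embed \<nu> (mean_field (\<rho> t))"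
      by (simp only: emb[OF t] F_embed[OF \<rho>P[OF t]])
    also have "\<dots> = L1_embed \<nu> ?g"
      by (rule L1_embed_diff[symmetric, OF int'[OF t] integrable_mean_field[OF \<rho>P[OF t]]])
    finally have "generates (?u t) (L1_embed \<nu> ?g)"
      using w(3)[OF t] by (simp only:)
    note dom = in_domainI[OF int[OF t] g_int this]
    from dom(2) have "AE x in \<nu>. \<rho>' t x = K (\<rho> t) x + mean_field_term \<nu> N \<Lambda> \<Lambda>s (\<rho> t) x"
      unfolding mean_field_term_eq[OF \<rho>P[OF t]] by eventually_elim simp
    with dom(1) show ?thesis
      by blast
  qed
  moreover have "AE x in \<nu>. \<rho> 0 x = \<rho>0 x"
    using mild by (simp add: mild_solution_def)
  ultimately show ?thesis
    unfolding classical_solution_def using \<rho>P by blast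
qed

end

context averaged_mean_field
begin

lemma jump_generator_one:
  "adjoint_jump_generator (\<Lambda> (empirical_measure (N - 1) y)) (\<Lambda>s (empirical_measure (N - 1) y)) (\<lambda>_. 1) x
    = measure (\<Lambda>s (empirical_measure (N - 1) y) x) UNIV - measure (\<Lambda> (empirical_measure (N - 1) y) x) UNIV"
  using space_k(2)[of y x] by (simp add: adjoint_jump_generator_def del: One_nat_def)

text \<open>The jump generator applied to 1 is the difference of the total masses of the two
  kernels, so its modulus is at most their sum; this is the source of the explicit constant. The
  first three claims together make the supremum a real number, the fourth provides the rate
  condition of the barriers.\<close>

lemma total_rate_bound_le:
  assumes one: "(\<lambda>_. 1) \<in> D" and K1: "Linf_norm \<nu> (K (\<lambda>_. 1)) < \<infinity>" and \<Lambda>s_bound: "kernel_bound N \<Lambda>s < \<infinity>"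
    and \<rho>0: "\<rho>0 \<in> prob_densities \<nu>"
  shows "0 \<le> total_rate_bound \<nu> N K \<Lambda> \<Lambda>s"
    and "total_rate_bound \<nu> N K \<Lambda> \<Lambda>s \<le> Linf_norm \<nu> (K (\<lambda>_. 1)) + kernel_bound N \<Lambda> + kernel_bound N \<Lambda>s"
    and "Linf_norm \<nu> (K (\<lambda>_. 1)) + kernel_bound N \<Lambda> + kernel_bound N \<Lambda>s < \<infinity>"
    and "y \<in> space W \<Longrightarrow> AE x in \<nu>. ereal \<bar>K (\<lambda>_. 1) x + gen y (\<lambda>_. 1) x\<bar> \<le> total_rate_bound \<nu> N K \<Lambda> \<Lambda>s"
proof -
  let ?R = "total_rate_bound \<nu> N K \<Lambda> \<Lambda>s"
  have mass: "(\<integral>x. \<rho>0 x \<partial>\<nu>) \<noteq> 0"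
    using prob_densityD(3)[OF \<rho>0] by simp
  have [measurable]: "K (\<lambda>_. 1) \<in> borel_measurable \<nu>"
    using generates_K(2)[OF one] by simp
  show le_R: "AE x in \<nu>. ereal \<bar>K (\<lambda>_. 1) x + gen y (\<lambda>_. 1) x\<bar> \<le> ?R" for y
  proof -
    have "AE x in \<nu>. ereal \<bar>K (\<lambda>_. 1) x + gen y (\<lambda>_. 1) x\<bar> \<le> Linf_norm \<nu> (\<lambda>x. K (\<lambda>_. 1) x + gen y (\<lambda>_. 1) x)"
      unfolding Linf_norm_def by (rule esssup_AE)
    moreover have "Linf_norm \<nu> (\<lambda>x. K (\<lambda>_. 1) x + gen y (\<lambda>_. 1) x) \<le> ?R"
      unfolding total_rate_bound_def gen_def by (rule SUP_upper) (rule empirical_measure_mem)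
    ultimately show ?thesis
      by (auto elim: eventually_mono)
  qed
  \<comment> \<open>Nonnegativity of the supremum needs one configuration and one point;
    \<open>undefined\<close> serves as an arbitrary configuration.\<close>
  from AE_exists[OF le_R mass] obtain z where "ereal \<bar>K (\<lambda>_. 1) z + gen undefined (\<lambda>_. 1) z\<bar> \<le> ?R"
    by blast
  then show "0 \<le> ?R"
    by (rule order_trans[rotated]) simp
  show "Linf_norm \<nu> (K (\<lambda>_. 1)) + kernel_bound N \<Lambda> + kernel_bound N \<Lambda>s < \<infinity>"
    using K1 bound \<Lambda>s_bound by simp
  have K1_AE: "AE x in \<nu>. ereal \<bar>K (\<lambda>_. 1) x\<bar> \<le> Linf_norm \<nu> (K (\<lambda>_. 1))"
    unfolding Linf_norm_def by (rule esssup_AE)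
  show "?R \<le> Linf_norm \<nu> (K (\<lambda>_. 1)) + kernel_bound N \<Lambda> + kernel_bound N \<Lambda>s"
    unfolding total_rate_bound_def
  proof (rule SUP_least)
    fix \<mu> :: "'a measure" assume "\<mu> \<in> empirical_measures N"
    then obtain y where \<mu>: "\<mu> = empirical_measure (N - 1) y"
      by (auto simp: empirical_measures_def)
    show "Linf_norm \<nu> (\<lambda>x. K (\<lambda>_. 1) x + adjoint_jump_generator (\<Lambda> \<mu>) (\<Lambda>s \<mu>) (\<lambda>_. 1) x)
        \<le> Linf_norm \<nu> (K (\<lambda>_. 1)) + kernel_bound N \<Lambda> + kernel_bound N \<Lambda>s"
      unfolding Linf_norm_def[of \<nu> "\<lambda>x. K (\<lambda>_. 1) x + _ x"]
    proof (rule esssup_I)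
      have [measurable]: "(\<lambda>x. measure (\<Lambda> \<mu> x) UNIV) \<in> borel_measurable \<nu>" "(\<lambda>x. measure (\<Lambda>s \<mu> x) UNIV) \<in> borel_measurable \<nu>"
        using \<Lambda>_J[of y] \<Lambda>s_J[of y] by (auto simp: \<mu> J_plus_def borel_measurable_\<nu>)
      show "(\<lambda>x. ereal \<bar>K (\<lambda>_. 1) x + adjoint_jump_generator (\<Lambda> \<mu>) (\<Lambda>s \<mu>) (\<lambda>_. 1) x\<bar>) \<in> borel_measurable \<nu>"
        unfolding \<mu> jump_generator_one unfolding \<mu>[symmetric] by measurable
      show "AE x in \<nu>. ereal \<bar>K (\<lambda>_. 1) x + adjoint_jump_generator (\<Lambda> \<mu>) (\<Lambda>s \<mu>) (\<lambda>_. 1) x\<bar>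
          \<le> Linf_norm \<nu> (K (\<lambda>_. 1)) + kernel_bound N \<Lambda> + kernel_bound N \<Lambda>s"
        using K1_AE
      proof eventually_elim
        case (elim x)
        have "ereal \<bar>K (\<lambda>_. 1) x + adjoint_jump_generator (\<Lambda> \<mu>) (\<Lambda>s \<mu>) (\<lambda>_. 1) x\<bar>
            \<le> ereal \<bar>K (\<lambda>_. 1) x\<bar> + ereal (measure (\<Lambda> \<mu> x) UNIV) + ereal (measure (\<Lambda>s \<mu> x) UNIV)"
          unfolding \<mu> jump_generator_one
          using measure_nonneg[of "\<Lambda> (empirical_measure (N - 1) y) x" UNIV]
            measure_nonneg[of "\<Lambda>s (empirical_measure (N - 1) y) x" UNIV] by (simp del: measure_nonneg)
        also have "\<dots> \<le> Linf_norm \<nu> (K (\<lambda>_. 1)) + kernel_bound N \<Lambda> + kernel_bound N \<Lambda>s"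
          unfolding \<mu>
          by (intro add_mono elim measure_le_kernel_bound[of _ N \<Lambda>] measure_le_kernel_bound[of _ N \<Lambda>s]
              empirical_measure_mem \<Lambda>_J \<Lambda>s_J)
        finally show ?case .
      qed
    qed
  qed
qed

lemma log_oscillation_bound:
  assumes one: "(\<lambda>_. 1) \<in> D" and K1: "Linf_norm \<nu> (K (\<lambda>_. 1)) < \<infinity>" and \<Lambda>s_bound: "kernel_bound N \<Lambda>s < \<infinity>"
    and \<rho>0: "\<rho>0 \<in> prob_densities \<nu>" and mild: "mild_solution \<nu> S N \<Lambda> \<Lambda>s \<rho>0 \<rho>" and t: "0 \<le> t"
  shows "ess_osc \<nu> (\<lambda>x. elog (\<rho> t x)) \<le>
    ess_osc \<nu> (\<lambda>x. elog (\<rho>0 x)) + 2 * total_rate_bound \<nu> N K \<Lambda> \<Lambda>s * ereal t"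
proof -
  note R = total_rate_bound_le[OF one K1 \<Lambda>s_bound \<rho>0]
  obtain r where r: "total_rate_bound \<nu> N K \<Lambda> \<Lambda>s = ereal r" "0 \<le> r"
    using R(1) le_less_trans[OF R(2,3)] by (cases "total_rate_bound \<nu> N K \<Lambda> \<Lambda>s") auto
  show ?thesis
  \<comment> \<open>An infinite initial oscillation makes the right-hand side infinite; otherwise it
    provides constant barriers for the initial density.\<close>
  proof (cases "ess_osc \<nu> (\<lambda>x. elog (\<rho>0 x)) < \<infinity>")
    case False
    then show ?thesis
      using t r by simp
  next
    case True
    from ess_osc_elog_attained[OF fin \<rho>0 True] obtain a b
      where ab: "0 < a" "0 < b" "AE x in \<nu>. a \<le> \<rho>0 x \<and> \<rho>0 x \<le> b"
        "ess_osc \<nu> (\<lambda>x. elog (\<rho>0 x)) = ereal (ln b - ln a)"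
      by blast
    note m = mild[unfolded mild_solution_iff[OF \<rho>0]]
    have \<rho>P: "\<rho> s \<in> prob_densities \<nu>" if "0 \<le> s" for s
      using m that by blast
    note int = prob_densityD(1)[OF \<rho>P[OF t]] and int0 = prob_densityD(1)[OF \<rho>0] and one_int = generates_K(1)[OF one]
    let ?u = "\<lambda>t. L1_embed \<nu> (\<rho> t)" and ?e = "L1_embed \<nu> (\<lambda>_. 1)"
    have scale_e: "q *\<^sub>R ?e = L1_embed \<nu> (\<lambda>_. q)" for q
      using L1_embed_scale[OF one_int, of q] by simp
    have const_int: "integrable \<nu> (\<lambda>_. q)" for q :: real
      by (rule \<nu>.integrable_const)
    have lower_cone: "L1_embed \<nu> f - q *\<^sub>R ?e \<in> L1_cone \<nu> \<longleftrightarrow> (AE x in \<nu>. q \<le> f x)"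
      and upper_cone: "q *\<^sub>R ?e - L1_embed \<nu> f \<in> L1_cone \<nu> \<longleftrightarrow> (AE x in \<nu>. f x \<le> q)"
      if "integrable \<nu> f" for f q
      unfolding scale_e using that const_int[of q]
      by (simp_all add: L1_embed_diff[symmetric] L1_embed_in_cone_iff)
    have rate: "AE x in \<nu>. \<bar>K (\<lambda>_. 1) x + gen y (\<lambda>_. 1) x\<bar> \<le> r" if "y \<in> space W" for y
      using R(4)[OF that] unfolding r(1) by simp
    note profile = constant_profile_bounds[where r = r, OF generates_K(2)[OF one] rate]
    have low: "F v + (real_of_ereal (kernel_bound N \<Lambda>) + 1) *\<^sub>R v -
        q *\<^sub>R ((real_of_ereal (kernel_bound N \<Lambda>) + 1 - r) *\<^sub>R ?e - L1_embed \<nu> (K (\<lambda>_. 1))) \<in> L1_cone \<nu>"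
      if "v \<in> P" "0 \<le> q" "v - q *\<^sub>R ?e \<in> L1_cone \<nu>" for v q
      by (rule profile(1)[OF _ that])
    have up: "q *\<^sub>R ((real_of_ereal (kernel_bound N \<Lambda>) + 1 + r) *\<^sub>R ?e - L1_embed \<nu> (K (\<lambda>_. 1))) -
        (F v + (real_of_ereal (kernel_bound N \<Lambda>) + 1) *\<^sub>R v) \<in> L1_cone \<nu>"
      if "v \<in> P" "0 \<le> q" "q *\<^sub>R ?e - v \<in> L1_cone \<nu>" for v q
      by (rule profile(2)[OF _ that])
    have cont: "continuous_on {0..} ?u" and mild_u: "mild 0 (\<lambda>s. F (?u s)) (L1_embed \<nu> \<rho>0) ?u"
      using m by blast+
    have uP: "?u s \<in> P" if "0 \<le> s" for s
      using \<rho>P[OF that] by (simp add: P_eq)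
    have xP: "L1_embed \<nu> \<rho>0 \<in> P"
      using \<rho>0 by (simp add: P_eq)
    have eQ: "?e \<in> L1_cone \<nu>"
      by (simp add: L1_embed_in_cone_iff one_int)
    have init: "L1_embed \<nu> \<rho>0 - a *\<^sub>R ?e \<in> L1_cone \<nu>" "b *\<^sub>R ?e - L1_embed \<nu> \<rho>0 \<in> L1_cone \<nu>"
      using ab(3) by (auto simp: lower_cone upper_cone int0)
    have nonneg: "0 \<le> a" "0 \<le> b"
      using ab by auto
    have "?u t - (a * exp (- r * t)) *\<^sub>R ?e \<in> L1_cone \<nu>" "(b * exp (r * t)) *\<^sub>R ?e - ?u t \<in> L1_cone \<nu>"
      by (rule mild_between_profiles[OF cont uP mild_u xP eQ generates_K(3)[OF one] low up nonneg init r(2) t]; assumption)+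
    then have "AE x in \<nu>. a * exp (- r * t) \<le> \<rho> t x \<and> \<rho> t x \<le> b * exp (r * t)"
      unfolding lower_cone[OF int] upper_cone[OF int] by (auto elim: eventually_elim2)
    then have "ess_osc \<nu> (\<lambda>x. elog (\<rho> t x)) \<le> ereal (ln (b * exp (r * t)) - ln (a * exp (- r * t)))"
      using int ab(1,2) by (intro ess_osc_elog_le fin) auto
    \<comment> \<open>Each barrier moves by r * t on the logarithmic scale, whence the factor
      2.\<close>
    also have "ln (b * exp (r * t)) - ln (a * exp (- r * t)) = ln b - ln a + 2 * r * t"
      using ab(1,2) by (simp add: ln_mult)
    finally show ?thesis
      by (simp add: ab(4) r(1))
  qed
qed

end

theorem theorem2p19:
  fixes \<nu> :: "'a::polish_space measure"
    and N :: nat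
    and S :: "real \<Rightarrow> ('a \<Rightarrow> real) \<Rightarrow> 'a \<Rightarrow> real"
    and D :: "('a \<Rightarrow> real) set"
    and K :: "('a \<Rightarrow> real) \<Rightarrow> 'a \<Rightarrow> real"
    and \<Lambda> \<Lambda>s :: "'a measure \<Rightarrow> 'a \<Rightarrow> 'a measure"
  assumes "finite_measure \<nu>" and "sets \<nu> = sets borel"
    and "N \<ge> 2"
    and "adjoint_Markov_semigroup \<nu> S" and "infinitesimal_generator \<nu> S D K"
    and "empirical_jump_kernel N \<Lambda>" and "kernel_bound N \<Lambda> < \<infinity>"
    and "\<forall>\<mu>\<in>empirical_measures N. adjoint_kernel \<nu> (\<Lambda> \<mu>) (\<Lambda>s \<mu>)" and "jointly_measurable N \<Lambda>s"
  shows "(\<forall>\<rho>0\<in>prob_densities \<nu>.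
            \<exists>\<rho>. mild_solution \<nu> S N \<Lambda> \<Lambda>s \<rho>0 \<rho> \<and>
              (\<forall>\<rho>'. mild_solution \<nu> S N \<Lambda> \<Lambda>s \<rho>0 \<rho>' \<longrightarrow> (\<forall>t\<ge>0. AE x in \<nu>. \<rho>' t x = \<rho> t x))) \<and>
         (\<forall>\<rho>0\<in>prob_densities \<nu>. \<forall>\<rho>. mild_solution \<nu> S N \<Lambda> \<Lambda>s \<rho>0 \<rho> \<longrightarrow>
            \<rho>0 \<in> D \<longrightarrow> classical_solution \<nu> D K N \<Lambda> \<Lambda>s \<rho>0 \<rho>) \<and>
         ((\<lambda>_. 1) \<in> D \<and> Linf_norm \<nu> (K (\<lambda>_. 1)) < \<infinity> \<and> kernel_bound N \<Lambda>s < \<infinity> \<longrightarrow>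
          (\<forall>\<rho>0\<in>prob_densities \<nu>. \<forall>\<rho>. mild_solution \<nu> S N \<Lambda> \<Lambda>s \<rho>0 \<rho> \<longrightarrow>
             (\<forall>t\<ge>0.
                ess_osc \<nu> (\<lambda>x. elog (\<rho> t x)) \<le>
                  ess_osc \<nu> (\<lambda>x. elog (\<rho>0 x)) + 2 * total_rate_bound \<nu> N K \<Lambda> \<Lambda>s * ereal t \<and>
                ess_osc \<nu> (\<lambda>x. elog (\<rho> t x)) \<le>
                  ess_osc \<nu> (\<lambda>x. elog (\<rho>0 x)) +
                  2 * (Linf_norm \<nu> (K (\<lambda>_. 1)) + kernel_bound N \<Lambda> + kernel_bound N \<Lambda>s) * ereal t)))"
proof -
  interpret averaged_mean_field \<nu> N S D K \<Lambda> \<Lambda>s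
    by (rule averaged_mean_field.intro) fact+
  have second: "ess_osc \<nu> (\<lambda>x. elog (\<rho> t x)) \<le> ess_osc \<nu> (\<lambda>x. elog (\<rho>0 x)) +
      2 * (Linf_norm \<nu> (K (\<lambda>_. 1)) + kernel_bound N \<Lambda> + kernel_bound N \<Lambda>s) * ereal t"
    if iii: "(\<lambda>_. 1) \<in> D" "Linf_norm \<nu> (K (\<lambda>_. 1)) < \<infinity>" "kernel_bound N \<Lambda>s < \<infinity>"
      and \<rho>0: "\<rho>0 \<in> prob_densities \<nu>" and mild: "mild_solution \<nu> S N \<Lambda> \<Lambda>s \<rho>0 \<rho>" and t: "0 \<le> t" for \<rho>0 \<rho> t
  proof (rule order_trans[OF log_oscillation_bound[OF iii \<rho>0 mild t]])
    show "ess_osc \<nu> (\<lambda>x. elog (\<rho>0 x)) + 2 * total_rate_bound \<nu> N K \<Lambda> \<Lambda>s * ereal t \<le> ess_osc \<nu> (\<lambda>x. elog (\<rho>0 x)) +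
        2 * (Linf_norm \<nu> (K (\<lambda>_. 1)) + kernel_bound N \<Lambda> + kernel_bound N \<Lambda>s) * ereal t"
      using total_rate_bound_le(2)[OF iii \<rho>0] t
      by (intro add_left_mono ereal_mult_right_mono ereal_mult_left_mono) auto
  qed
  show ?thesis
    using mild_solution_exists_unique mild_solution_classical log_oscillation_bound second by blast
qed

end
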